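(* Let $V=(J,(V_j)_{j\in J},d,H)$ be a hypergraph system and let $(\nu_e)_{e\in H}$ be a pseudorandom system of measures on $V$. For each $e\in H$ let $E_e\in\mathcal{A}_e$ be such that $$\mathbb{E}\Big(\prod_{e\in H}1_{E_e}(x)\,\nu_e(\pi_e(x))\ \Big|\ x\in V_J\Big)\le\delta$$ for some $0<\delta<1$. Then, if $N$ is sufficiently large depending on $\delta$ and $J$, for each $e\in H$ there is a set $E'_e\in\mathcal{A}_e$ such that $\bigcap_{e\in H}E'_e=\emptyset$ and $$\mathbb{E}\big(1_{E_e\setminus E'_e}(x)\,\nu_e(\pi_e(x))\mid x\in V_J\big)=o_{\delta\to0}(1)+o_{N\to\infty;\delta}(1)\quad\text{for all }e\in H.$$ Furthermore, there exist $\sigma$-algebras $\mathcal{B}_{e'}\subseteq\mathcal{A}_{e'}$ for every $e'\subseteq J$ with $|e'|<d$, such that $|\mathcal{B}_{e'}|=O_\delta(1)$ for all such $e'$ and $E'_e\in\bigvee_{e'\subsetneq e}\mathcal{B}_{e'}$ for all $e\in H$.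
   Context: A hypergraph system is a quadruple $V=(J,(V_j)_{j\in J},d,H)$ where $J$ is a finite set, each $V_j$ is a finite nonempty set, $d\ge1$ is an integer and $H\subseteq\binom{J}{d}:=\{e\subseteq J:|e|=d\}$. For $e\subseteq J$ put $V_e:=\prod_{j\in e}V_j$, let $\pi_e:V_J\to V_e$ be the coordinate projection and $\mathcal{A}_e:=\{\pi_e^{-1}(E):E\subseteq V_e\}$ (a $\sigma$-algebra on $V_J$). $\bigvee$ denotes the smallest $\sigma$-algebra containing the given ones; $|\mathcal{B}|$ is the number of sets in the finite $\sigma$-algebra $\mathcal{B}$. For a finite nonempty set $Z$ and $f:Z\to\mathbb{R}$, $\mathbb{E}(f(x)\mid x\in Z):=|Z|^{-1}\sum_{x\in Z}f(x)$; constraints written after the bar mean uniform averaging over all tuples satisfying them. All objects ($V_j$, $\nu_e$, $E_e$, …) depend on a parameter $N$ ranging over a sequence tending to infinity, while $J,d,H$ are fixed; all implicit constants may depend on $J$. $o_{x\to 0;y}(X)$ denotes a quantity bounded in magnitude by $c(x,y)X$ where $c(x,y)\to0$ as $x\to0$ for each fixed $y$; $O_y(X)$ denotes a quantity bounded by $C(y)X$. Cube notation: for a finite set $e$, $\{0,1\}^e$ is the set of tuples $\omega=(\omega_j)_{j\in e}$ with $\omega_j\in\{0,1\}$, and $0^e$ is the all-zero tuple; for $x^{(0)}_J,x^{(1)}_J\in V_J$, $e\subseteq J$ and $\omega\in\{0,1\}^e$, set $x^{(\omega)}_e:=(x^{(\omega_j)}_j)_{j\in e}\in V_e$ and $x^{(a)}_e:=(x^{(a)}_j)_{j\in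 e}$ for $a\in\{0,1\}$. A system of measures is a family of functions $\nu_e:V_e\to[0,\infty)$, $e\in H$, with $\mathbb{E}(\nu_e(x_e)\mid x_e\in V_e)=1+o_{N\to\infty}(1)$. For $e\in H$ and $f:V_e\to\mathbb{R}$, the dual function is $\mathcal{D}_ef(x^{(0)}_e):=\mathbb{E}\big(\prod_{\omega\in\{0,1\}^e,\ \omega\neq 0^e}f(x^{(\omega)}_e)\mid x^{(1)}_e\in V_e\big)$. The system is pseudorandom if: (i) $\mathcal{D}_e(\nu_e+1)(x_e)=O(1)$ for all $e\in H$, $x_e\in V_e$; (ii) for every choice of exponents $n_{e,\omega}\in\{0,1\}$, $\mathbb{E}\big(\prod_{e\in H}\prod_{\omega\in\{0,1\}^e}\nu_e(x^{(\omega)}_e)^{n_{e,\omega}}\mid x^{(0)}_J,x^{(1)}_J\in V_J\big)=1+o_{N\to\infty}(1)$; (iii) for every $e\in H$, $j\in e$, every choice of $n_{e,\omega}\in\{0,1\}$ and every integer $K\ge0$, $\mathbb{E}\Big(\mathbb{E}\big(\prod_{\omega\in\{0,1\}^e}\nu_e(x^{(\omega)}_e)^{n_{e,\omega}}\mid x^{(0)}_j,x^{(1)}_j\in V_j\big)^K\ \Big|\ x^{(0)}_{e\setminus\{j\}},x^{(1)}_{e\setminus\{j\}}\in V_{e\setminus\{j\}}\Big)=O_K(1)$. *)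

theory Defs
  imports "HOL-Analysis.Sigma_Algebra"
begin

text \<open>Conventions. The index set J is a finite set of elements of type 'j.
  Everything depending on the asymptotic parameter N is a function of N :: nat.
  Points of V_e are extensional functions in PiE e (V N).\<close>

definition avg :: "'a set \<Rightarrow> ('a \<Rightarrow> real) \<Rightarrow> real" where
  "avg Z f = (\<Sum>x\<in>Z. f x) / real (card Z)"

definition VJ :: "'j set \<Rightarrow> ('j \<Rightarrow> 'v set) \<Rightarrow> ('j \<Rightarrow> 'v) set" where
  "VJ J Vs = PiE J Vs"

definition cylAlg :: "'j set \<Rightarrow> ('j \<Rightarrow> 'v set) \<Rightarrow> 'j set \<Rightarrow> ('j \<Rightarrow> 'v) set set" where
  "cylAlg J Vs e = {{x \<in> PiE J Vs. restrict x e \<in> E} | E. E \<subseteq> PiE e Vs}"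

definition cube :: "'j set \<Rightarrow> ('j \<Rightarrow> bool) set" where
  "cube e = PiE e (\<lambda>_. UNIV)"

definition zero_cube :: "'j set \<Rightarrow> ('j \<Rightarrow> bool)" where
  "zero_cube e = restrict (\<lambda>_. False) e"

definition cpt :: "('j \<Rightarrow> 'v) \<Rightarrow> ('j \<Rightarrow> 'v) \<Rightarrow> ('j \<Rightarrow> bool) \<Rightarrow> 'j set \<Rightarrow> ('j \<Rightarrow> 'v)" where
  "cpt x0 x1 \<omega> e = restrict (\<lambda>j. if \<omega> j then x1 j else x0 j) e"

definition dual :: "('j \<Rightarrow> 'v set) \<Rightarrow> 'j set \<Rightarrow> (('j \<Rightarrow> 'v) \<Rightarrow> real) \<Rightarrow> ('j \<Rightarrow> 'v) \<Rightarrow> real" where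
  "dual Vs e f x0 = avg (PiE e Vs)
     (\<lambda>x1. \<Prod>\<omega>\<in>cube e - {zero_cube e}. f (cpt x0 x1 \<omega> e))"

definition hypergraph_system ::
  "'j set \<Rightarrow> (nat \<Rightarrow> 'j \<Rightarrow> 'v set) \<Rightarrow> nat \<Rightarrow> 'j set set \<Rightarrow> bool" where
  "hypergraph_system J V d H \<longleftrightarrow>
     finite J \<and> d \<ge> 1 \<and> H \<subseteq> {e. e \<subseteq> J \<and> card e = d} \<and>
     (\<forall>N. \<forall>j\<in>J. finite (V N j) \<and> V N j \<noteq> {})"

definition system_of_measures ::
  "'j set \<Rightarrow> (nat \<Rightarrow> 'j \<Rightarrow> 'v set) \<Rightarrow> 'j set set \<Rightarrow>
   (nat \<Rightarrow> 'j set \<Rightarrow> ('j \<Rightarrow> 'v) \<Rightarrow> real) \<Rightarrow> bool" where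
  "system_of_measures J V H \<nu> \<longleftrightarrow>
     (\<forall>N. \<forall>e\<in>H. \<forall>x\<in>PiE e (V N). \<nu> N e x \<ge> 0) \<and>
     (\<forall>e\<in>H. (\<lambda>N. avg (PiE e (V N)) (\<nu> N e)) \<longlonglongrightarrow> 1)"

definition pseudorandom ::
  "'j set \<Rightarrow> (nat \<Rightarrow> 'j \<Rightarrow> 'v set) \<Rightarrow> 'j set set \<Rightarrow>
   (nat \<Rightarrow> 'j set \<Rightarrow> ('j \<Rightarrow> 'v) \<Rightarrow> real) \<Rightarrow> bool" where
  "pseudorandom J V H \<nu> \<longleftrightarrow>
     system_of_measures J V H \<nu> \<and>
     \<comment> \<open>(i) linear forms / dual function bound\<close>
     (\<exists>C. \<forall>N. \<forall>e\<in>H. \<forall>x\<in>PiE e (V N).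
        \<bar>dual (V N) e (\<lambda>y. \<nu> N e y + 1) x\<bar> \<le> C) \<and>
     \<comment> \<open>(ii) the exponent n e omega = True means exponent 1\<close>
     (\<forall>n :: 'j set \<Rightarrow> ('j \<Rightarrow> bool) \<Rightarrow> bool.
        (\<lambda>N. avg (PiE J (V N) \<times> PiE J (V N))
           (\<lambda>(x0, x1). \<Prod>e\<in>H. \<Prod>\<omega>\<in>cube e.
               (if n e \<omega> then \<nu> N e (cpt x0 x1 \<omega> e) else 1))) \<longlonglongrightarrow> 1) \<and>
     \<comment> \<open>(iii) correlation condition\<close>
     (\<forall>e\<in>H. \<forall>j\<in>e. \<forall>n :: ('j \<Rightarrow> bool) \<Rightarrow> bool. \<forall>K :: nat. \<exists>C. \<forall>N.
        \<bar>avg (PiE (e - {j}) (V N) \<times> PiE (e - {j}) (V N))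
           (\<lambda>(y0, y1). (avg (V N j \<times> V N j)
              (\<lambda>(a0, a1). \<Prod>\<omega>\<in>cube e.
                 (if n \<omega> then \<nu> N e (cpt (y0(j := a0)) (y1(j := a1)) \<omega> e) else 1))) ^ K)\<bar>
        \<le> C)"

end

theory Submission
  imports Defs "HOL-Probability.Conditional_Expectation"
begin

text \<open>Suppose the removal lemma fails for some \<open>\<epsilon>\<close> along a sequence of counterexamples with
  \<open>\<delta> \<rightarrow> 0\<close>, and pass to the Loeb probability space of the ultraproduct of the sets \<open>V_J\<close>. The Loeb
  measure of \<open>\<nu>_e\<close> agrees with the uniform one on the \<open>\<sigma>\<close>-algebra \<open>A_{<e}\<close> generated by cylinders over
  proper subsets of \<open>e\<close>, so \<open>1_{E_e} \<nu>_e\<close> has a dense model: its conditional expectation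
  \<open>f_e : \<Omega> \<rightarrow> [0,1]\<close> given \<open>A_{<e}\<close>. Replacing the factors \<open>1_{E_e} \<nu>_e\<close> by \<open>f_e\<close> one edge at a time
  (the densification argument of Conlon, Fox and Zhao, which uses only condition (ii)) shows that
  \<open>\<integral> \<Prod> f_e = 0\<close>, so the sets \<open>{f_e > 0}\<close> have null intersection. The limiting removal statement for
  null intersections then follows by induction on the order of the sets, using only the conditional
  independence of cylinders, and yields finite Boolean combinations of internal cylinders, which can
  be read off at some finite level; the number of cylinders involved does not depend on the level.\<close>

section \<open>Ultrafilters and averages\<close>

text \<open>Two obstacles shape the argument. The average of the other factors over the coordinates
  outside an edge (the fibre average) is not bounded, so bounded test functions do not control it.
  The Cauchy-Schwarz argument therefore carries two copies of the outside coordinates, indexed by a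
  boolean \<open>c\<close>. It then controls products of two fibre averages, and the majorant of the
  fibre average has first and second moments tending to 1 both for the uniform measure and for the
  one weighted by \<open>\<nu>\<close>; hence truncating at 1 costs nothing in the limit. The second
  obstacle is that removal must produce an intersection that is empty, while measure theory in the
  limit space sees only null sets. Exactness enters at order 0, where a measurable set is empty or
  everything, and it is lifted to higher orders by working separately on each atom of a finite
  algebra.\<close>

lemma ultrafilter_exists:
  "\<exists>U::nat filter. U \<noteq> bot \<and> U \<le> sequentially \<and>
     (\<forall>P. eventually P U \<or> eventually (\<lambda>n. \<not> P n) U)"
proof -
  define A where "A = {F::nat filter. F \<noteq> bot \<and> F \<le> sequentially}"
  \<comment> \<open>The order is reversed: a smaller filter is a finer one, so a maximal element for
    \<open>le\<close> is a finest proper filter below \<open>sequentially\<close>.\<close>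
  define le where "le = (\<lambda>F G::nat filter. G \<le> F)"
  have po: "partial_order_on A (relation_of le A)"
    unfolding partial_order_on_def preorder_on_def relation_of_def le_def
    by (auto intro!: refl_onI transI antisymI)
  have "\<exists>m\<in>A. \<forall>a\<in>A. le m a \<longrightarrow> a = m"
  proof (rule predicate_Zorn[OF po])
    fix C assume C: "C \<in> Chains (relation_of le A)"
    have CA: "C \<subseteq> A" and lin: "\<And>F G. F \<in> C \<Longrightarrow> G \<in> C \<Longrightarrow> F \<le> G \<or> G \<le> F"
      using C unfolding Chains_def relation_of_def le_def by auto
    show "\<exists>u\<in>A. \<forall>a\<in>C. le a u"
    proof (cases "C = {}")
      case True
      have "sequentially \<in> A" unfolding A_def by auto
      then show ?thesis using True by auto
    next
      case False
      have "Inf C \<noteq> bot"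
      proof
        assume "Inf C = bot"
        then have "eventually (\<lambda>_. False) (Inf C)" by simp
        then have "\<exists>b\<in>C. eventually (\<lambda>_. False) b"
          using lin by (subst (asm) eventually_Inf_base[OF False]) (metis inf.absorb1 inf.absorb2 order_refl)+
        then show False using CA unfolding A_def by (auto simp: trivial_limit_def)
      qed
      moreover have "Inf C \<le> sequentially"
        using False CA unfolding A_def by (metis (mono_tags, lifting) Inf_lower2 all_not_in_conv mem_Collect_eq subsetD)
      ultimately show ?thesis unfolding A_def le_def by (auto intro!: bexI[of _ "Inf C"] Inf_lower)
    qed
  qed
  then obtain U where U: "U \<in> A" and max: "\<And>a. a \<in> A \<Longrightarrow> a \<le> U \<Longrightarrow> a = U"
    unfolding le_def by auto
  have "eventually P U \<or> eventually (\<lambda>n. \<not> P n) U" for P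
  \<comment> \<open>Adding \<open>P\<close> to \<open>U\<close> gives either the improper filter,
    and then \<open>U\<close> already contains the negation, or a proper refinement, which equals
    \<open>U\<close> by maximality.\<close>
  proof (cases "inf U (principal {n. P n}) = bot")
    case True
    then have "eventually (\<lambda>_. False) (inf U (principal {n. P n}))" by simp
    then show ?thesis by (simp add: eventually_inf_principal)
  next
    case False
    then have "inf U (principal {n. P n}) \<in> A" using U unfolding A_def by (auto intro: le_infI1)
    then have "inf U (principal {n. P n}) = U" by (intro max) auto
    then have "U \<le> principal {n. P n}" by (metis inf.orderI)
    then show ?thesis by (auto simp: le_principal)
  qed
  then show ?thesis using U unfolding A_def by auto
qed

lemma avg_add: "avg Z (\<lambda>x. f x + g x) = avg Z f + avg Z g"
  by (simp add: avg_def sum.distrib add_divide_distrib)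

lemma avg_diff: "avg Z (\<lambda>x. f x - g x) = avg Z f - avg Z g"
  by (simp add: avg_def sum_subtractf diff_divide_distrib)

lemma avg_cmult: "avg Z (\<lambda>x. c * f x) = c * avg Z f"
  by (simp add: avg_def sum_distrib_left)

lemma avg_cmult_right: "avg Z (\<lambda>x. f x * c) = avg Z f * c"
  by (simp add: avg_def sum_distrib_right)

lemma avg_divide: "avg Z (\<lambda>x. f x / c) = avg Z f / c"
  using avg_cmult_right[of Z f "1/c"] by simp

lemma avg_sum: "avg Z (\<lambda>x. \<Sum>i\<in>I. f i x) = (\<Sum>i\<in>I. avg Z (f i))"
  unfolding avg_def by (subst sum.swap) (simp add: sum_divide_distrib)

lemma avg_const: "finite Z \<Longrightarrow> Z \<noteq> {} \<Longrightarrow> avg Z (\<lambda>_. c) = c"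
  by (simp add: avg_def)

lemma avg_cong: "(\<And>x. x \<in> Z \<Longrightarrow> f x = g x) \<Longrightarrow> avg Z f = avg Z g"
  by (simp add: avg_def cong: sum.cong)

lemma avg_mono: "(\<And>x. x \<in> Z \<Longrightarrow> f x \<le> g x) \<Longrightarrow> avg Z f \<le> avg Z g"
  by (simp add: avg_def divide_right_mono sum_mono)

lemma avg_nonneg: "(\<And>x. x \<in> Z \<Longrightarrow> 0 \<le> f x) \<Longrightarrow> 0 \<le> avg Z f"
  by (simp add: avg_def sum_nonneg)

lemma avg_abs_le: "\<bar>avg Z f\<bar> \<le> avg Z (\<lambda>x. \<bar>f x\<bar>)"
  by (simp add: avg_def divide_right_mono)

lemma avg_swap: "avg Z (\<lambda>x. avg W (f x)) = avg W (\<lambda>y. avg Z (\<lambda>x. f x y))"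
  unfolding avg_def using sum.swap[of f W Z] by (simp add: sum_divide_distrib[symmetric] mult.commute)

lemma avg_Times: "avg (Z \<times> W) f = avg Z (\<lambda>x. avg W (\<lambda>y. f (x, y)))"
  unfolding avg_def using sum.cartesian_product[of "\<lambda>x y. f (x, y)" W Z]
  by (simp add: card_cartesian_product sum_divide_distrib[symmetric] mult.commute)

lemma avg_Cauchy_Schwarz:
  assumes w: "\<And>x. x \<in> Z \<Longrightarrow> 0 \<le> w x"
  shows "(avg Z (\<lambda>x. w x * f x))\<^sup>2 \<le> avg Z w * avg Z (\<lambda>x. w x * (f x)\<^sup>2)"
proof -
  have "(\<Sum>x\<in>Z. w x * f x)\<^sup>2 = (\<Sum>x\<in>Z. sqrt (w x) * (sqrt (w x) * f x))\<^sup>2"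
    using w by (intro arg_cong[where f="\<lambda>x. x\<^sup>2"] sum.cong) (auto simp flip: mult.assoc)
  also have "\<dots> \<le> (\<Sum>x\<in>Z. (sqrt (w x))\<^sup>2) * (\<Sum>x\<in>Z. (sqrt (w x) * f x)\<^sup>2)"
    by (rule Cauchy_Schwarz_ineq_sum)
  also have "\<dots> = (\<Sum>x\<in>Z. w x) * (\<Sum>x\<in>Z. w x * (f x)\<^sup>2)"
    using w by (auto simp: power_mult_distrib intro!: arg_cong2[where f="(*)"] sum.cong)
  finally show ?thesis
    unfolding avg_def by (simp add: power_divide power2_eq_square divide_right_mono)
qed

text \<open>Used to freeze coordinates at a worst choice without decreasing an average.\<close>

lemma avg_le_ex:
  assumes "finite Z" "Z \<noteq> {}"
  shows "\<exists>x\<in>Z. avg Z f \<le> f x"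
proof (rule ccontr)
  assume "\<not> ?thesis"
  then have *: "\<And>x. x \<in> Z \<Longrightarrow> f x < avg Z f" by auto
  have "(\<Sum>x\<in>Z. f x) < (\<Sum>x\<in>Z. avg Z f)"
    using assms * by (intro sum_strict_mono) auto
  then show False using assms by (simp add: avg_def)
qed

section \<open>Resampling coordinates of a product\<close>

definition glue :: "'j set \<Rightarrow> ('j \<Rightarrow> 'v) \<Rightarrow> ('j \<Rightarrow> 'v) \<Rightarrow> 'j \<Rightarrow> 'v" where
  "glue e x y = (\<lambda>j. if j \<in> e then x j else y j)"

lemma glue_in: "x \<in> PiE J W \<Longrightarrow> y \<in> PiE J W \<Longrightarrow> glue e x y \<in> PiE J W"
  by (auto simp: glue_def PiE_iff extensional_def)

lemma glue_glue [simp]: "glue e (glue e x y) (glue e y x) = x"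
  by (auto simp: glue_def)

lemma glue_upd: "glue (- {j}) x y = x(j := y j)"
  by (auto simp: glue_def)

lemma restrict_glue: "restrict (glue e x y) e = restrict x e"
  by (auto simp: glue_def restrict_def)

text \<open>The map \<open>(x, y) \<mapsto> (glue e x y, glue e y x)\<close> is an involution of the
  square of the product. This replaces Fubini for the splitting into \<open>e\<close> and its
  complement: all points stay functions on \<open>J\<close>, and no product over \<open>e\<close>
  has to be identified with a factor.\<close>

lemma avg_glue:
  assumes fin: "finite (PiE J W)" and ne: "PiE J W \<noteq> {}"
  shows "avg (PiE J W) (\<lambda>x. avg (PiE J W) (\<lambda>y. F (glue e x y))) = avg (PiE J W) F"
proof -
  let ?X = "PiE J W"
  have "(\<Sum>x\<in>?X. \<Sum>y\<in>?X. F (glue e x y)) = (\<Sum>(x, y)\<in>?X \<times> ?X. F (glue e x y))"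
    by (rule sum.cartesian_product)
  also have "\<dots> = (\<Sum>(x, y)\<in>?X \<times> ?X. F x)"
    by (rule sum.reindex_bij_witness[of _ "\<lambda>(x, y). (glue e x y, glue e y x)" "\<lambda>(x, y). (glue e x y, glue e y x)"])
       (clarsimp; (intro conjI glue_in)?; assumption?)+
  also have "\<dots> = (\<Sum>x\<in>?X. \<Sum>y\<in>?X. F x)"
    by (rule sum.cartesian_product[symmetric])
  finally show ?thesis
    using fin ne by (simp add: avg_def sum_divide_distrib[symmetric] sum_distrib_left[symmetric])
qed

lemma avg_upd:
  assumes fin: "finite (PiE J W)" and ne: "PiE J W \<noteq> {}"
  shows "avg (PiE J W) (\<lambda>x. avg (PiE J W) (\<lambda>y. F (x(j := y j)))) = avg (PiE J W) F"
  using avg_glue[OF fin ne, of F "- {j}"] by (simp add: glue_upd)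

text \<open>One Cauchy--Schwarz step of the Gowers argument: the unused second copy of coordinate \<open>j\<close>
  becomes the duplicated variable.\<close>

lemma avg_Cauchy_Schwarz_step:
  assumes fin: "finite (PiE J S)" and ne: "PiE J S \<noteq> {}"
    and X: "X = PiE J S"
    and W: "\<And>x0 x1. x0 \<in> X \<Longrightarrow> x1 \<in> X \<Longrightarrow> 0 \<le> W x0 x1 \<and> W x0 x1 \<le> W' x0 x1"
    and Wj: "\<And>x0 x1 y. x0 \<in> X \<Longrightarrow> x1 \<in> X \<Longrightarrow> y \<in> X \<Longrightarrow> W (x0(j := y j)) x1 = W x0 x1"
    and W'j: "\<And>x0 x1 y. x0 \<in> X \<Longrightarrow> x1 \<in> X \<Longrightarrow> y \<in> X \<Longrightarrow> W' (x0(j := y j)) x1 = W' x0 x1"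
      "\<And>x0 x1 y. x0 \<in> X \<Longrightarrow> x1 \<in> X \<Longrightarrow> y \<in> X \<Longrightarrow> W' x0 (x1(j := y j)) = W' x0 x1"
    and Kj: "\<And>x0 x1 y. x0 \<in> X \<Longrightarrow> x1 \<in> X \<Longrightarrow> y \<in> X \<Longrightarrow> K x0 (x1(j := y j)) = K x0 x1"
  shows "(avg X (\<lambda>x0. avg X (\<lambda>x1. W x0 x1 * K x0 x1)))\<^sup>2 \<le>
     avg X (\<lambda>x0. avg X (W' x0)) *
     avg X (\<lambda>x0. avg X (\<lambda>x1. W' x0 x1 * (K x0 x1 * K (x0(j := x1 j)) x1)))"
proof -
  \<comment> \<open>\<open>P\<close> averages \<open>K\<close> over coordinate \<open>j\<close> of
    the first point. Since \<open>W\<close> ignores this coordinate, \<open>K\<close> may be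
    exchanged for \<open>P\<close> before Cauchy-Schwarz, and one \<open>P\<close> back for
    \<open>K\<close> afterwards; the result contains two different copies of \<open>K\<close> and
    not a square.\<close>
  define P where "P x0 x1 = avg X (\<lambda>y. K (x0(j := y j)) x1)" for x0 x1
  have upd: "x0 \<in> X \<Longrightarrow> y \<in> X \<Longrightarrow> x0(j := y j) \<in> X" for x0 y
    using glue_in[of x0 J S y "- {j}"] by (simp add: X glue_upd)
  note au = avg_upd[OF fin ne, folded X]
  have 1: "avg X (\<lambda>x0. avg X (\<lambda>x1. A x0 x1 * K x0 x1)) = avg X (\<lambda>x0. avg X (\<lambda>x1. A x0 x1 * P x0 x1))"
    if A: "\<And>x0 x1 y. x0 \<in> X \<Longrightarrow> x1 \<in> X \<Longrightarrow> y \<in> X \<Longrightarrow> A (x0(j := y j)) x1 = A x0 x1" for A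
  proof -
    have "avg X (\<lambda>x0. avg X (\<lambda>x1. A x0 x1 * K x0 x1))
        = avg X (\<lambda>x0. avg X (\<lambda>y. avg X (\<lambda>x1. A (x0(j := y j)) x1 * K (x0(j := y j)) x1)))"
      by (rule au[symmetric])
    also have "\<dots> = avg X (\<lambda>x0. avg X (\<lambda>y. avg X (\<lambda>x1. A x0 x1 * K (x0(j := y j)) x1)))"
      using A by (intro avg_cong) auto
    also have "\<dots> = avg X (\<lambda>x0. avg X (\<lambda>x1. A x0 x1 * P x0 x1))"
      unfolding P_def avg_cmult[symmetric] by (intro avg_cong avg_swap)
    finally show ?thesis .
  qed
  have Pj: "P (x0(j := y j)) x1 = P x0 x1" for x0 x1 y by (simp add: P_def)
  let ?E = "\<lambda>F. avg (X \<times> X) (\<lambda>(x0, x1). F x0 x1)"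
  have E: "?E F = avg X (\<lambda>x0. avg X (F x0))" for F by (simp add: avg_Times)
  have "\<bar>avg X (\<lambda>x0. avg X (\<lambda>x1. W x0 x1 * K x0 x1))\<bar> = \<bar>?E (\<lambda>x0 x1. W x0 x1 * P x0 x1)\<bar>"
    unfolding E by (subst 1[of W]) (use Wj in auto)
  also have "\<dots> \<le> avg (X \<times> X) (\<lambda>(x0, x1). W' x0 x1 * \<bar>P x0 x1\<bar>)"
    using W by (intro order_trans[OF avg_abs_le] avg_mono) (auto simp: abs_mult intro!: mult_right_mono)
  finally have "(avg X (\<lambda>x0. avg X (\<lambda>x1. W x0 x1 * K x0 x1)))\<^sup>2
      \<le> (avg (X \<times> X) (\<lambda>z. (case z of (x0, x1) \<Rightarrow> W' x0 x1) * (case z of (x0, x1) \<Rightarrow> \<bar>P x0 x1\<bar>)))\<^sup>2"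
    by (metis (mono_tags, lifting) abs_le_square_iff abs_ge_zero abs_of_nonneg avg_cong case_prod_beta order_trans)
  also have "\<dots> \<le> ?E W' * avg (X \<times> X) (\<lambda>z. (case z of (x0, x1) \<Rightarrow> W' x0 x1) * (case z of (x0, x1) \<Rightarrow> \<bar>P x0 x1\<bar>)\<^sup>2)"
    using W by (intro avg_Cauchy_Schwarz) (auto intro: order_trans)
  also have "avg (X \<times> X) (\<lambda>z. (case z of (x0, x1) \<Rightarrow> W' x0 x1) * (case z of (x0, x1) \<Rightarrow> \<bar>P x0 x1\<bar>)\<^sup>2)
      = ?E (\<lambda>x0 x1. W' x0 x1 * P x0 x1 * P x0 x1)"
    by (intro avg_cong) (auto simp: power2_eq_square)
  also have "\<dots> = avg X (\<lambda>x0. avg X (\<lambda>x1. W' x0 x1 * P x0 x1 * K x0 x1))"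
    unfolding E by (rule 1[symmetric]) (simp add: Pj W'j)
  also have "\<dots> = avg X (\<lambda>x0. avg X (\<lambda>x1. W' x0 x1 * (K x0 x1 * K (x0(j := x1 j)) x1)))"
  proof (rule avg_cong)
    fix x0 assume x0: "x0 \<in> X"
    have "avg X (\<lambda>x1. W' x0 x1 * (K x0 x1 * K (x0(j := x1 j)) x1))
        = avg X (\<lambda>x1. avg X (\<lambda>y. W' x0 (x1(j := y j)) * (K x0 (x1(j := y j)) * K (x0(j := y j)) (x1(j := y j)))))"
      by (subst au[where j=j, symmetric]) simp
    also have "\<dots> = avg X (\<lambda>x1. avg X (\<lambda>y. W' x0 x1 * (K x0 x1 * K (x0(j := y j)) x1)))"
      using x0 by (intro avg_cong) (simp add: W'j Kj upd)
    also have "\<dots> = avg X (\<lambda>x1. W' x0 x1 * P x0 x1 * K x0 x1)"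
      by (intro avg_cong) (simp add: P_def avg_cmult mult_ac)
    finally show "avg X (\<lambda>x1. W' x0 x1 * P x0 x1 * K x0 x1)
        = avg X (\<lambda>x1. W' x0 x1 * (K x0 x1 * K (x0(j := x1 j)) x1))" by simp
  qed
  finally show ?thesis by (simp add: E)
qed

section \<open>Strong linear forms\<close>

locale vertex_system =
  fixes J :: "'j set" and V :: "nat \<Rightarrow> 'j \<Rightarrow> 'v set"
  assumes finite_J: "finite J"
    and finite_V: "j \<in> J \<Longrightarrow> finite (V n j)"
    and V_nonempty: "j \<in> J \<Longrightarrow> V n j \<noteq> {}"
begin

definition X :: "nat \<Rightarrow> ('j \<Rightarrow> 'v) set" where "X n = PiE J (V n)"

abbreviation av :: "nat \<Rightarrow> (('j \<Rightarrow> 'v) \<Rightarrow> real) \<Rightarrow> real" where "av n \<equiv> avg (X n)"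

lemma finite_X [simp, intro]: "finite (X n)"
  unfolding X_def using finite_J finite_V by (intro finite_PiE) auto

lemma X_nonempty [simp]: "X n \<noteq> {}"
  unfolding X_def using V_nonempty by (simp add: PiE_eq_empty_iff)

lemma av_const [simp]: "av n (\<lambda>_. c) = c"
  by (rule avg_const) auto

lemma glue_X: "x \<in> X n \<Longrightarrow> y \<in> X n \<Longrightarrow> glue e x y \<in> X n"
  unfolding X_def by (rule glue_in)

lemma upd_X: "x \<in> X n \<Longrightarrow> y \<in> X n \<Longrightarrow> x(j := y j) \<in> X n"
  using glue_X[of x n y "- {j}"] by (simp add: glue_upd)

lemma restrict_X: "x \<in> X n \<Longrightarrow> e \<subseteq> J \<Longrightarrow> restrict x e \<in> PiE e (V n)"
  by (auto simp: X_def PiE_iff)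

lemma av_glue: "av n (\<lambda>x. av n (\<lambda>y. F (glue e x y))) = av n F"
  unfolding X_def by (rule avg_glue) (use finite_X[of n] X_nonempty[of n] in \<open>auto simp only: X_def\<close>)

end

text \<open>The last assumption is condition (ii) with exponents recorded by membership: a cube
  vertex is the set \<open>D\<close> of coordinates read from \<open>x1\<close>, and
  \<open>T e\<close> collects the vertices of exponent 1. The filter is arbitrary, so the condition
  passes to a sequence of counterexamples and to an ultrafilter on it.\<close>

locale linear_forms_system = vertex_system J V
  for J :: "'j set" and V :: "nat \<Rightarrow> 'j \<Rightarrow> 'v set" +
  fixes H :: "'j set set" and d :: nat
    and \<nu> :: "nat \<Rightarrow> 'j set \<Rightarrow> ('j \<Rightarrow> 'v) \<Rightarrow> real"
    and U :: "nat filter"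
  assumes H_J: "e \<in> H \<Longrightarrow> e \<subseteq> J" and H_card: "e \<in> H \<Longrightarrow> card e = d" and d_pos: "d \<ge> 1"
    and nu_nonneg: "e \<in> H \<Longrightarrow> x \<in> PiE e (V n) \<Longrightarrow> 0 \<le> \<nu> n e x"
    and linear_forms: "(\<And>e. e \<in> H \<Longrightarrow> T e \<subseteq> Pow e) \<Longrightarrow>
      ((\<lambda>n. av n (\<lambda>x0. av n (\<lambda>x1. \<Prod>e\<in>H. \<Prod>D\<in>T e. \<nu> n e (restrict (glue D x1 x0) e)))) \<longlongrightarrow> 1) U"
begin

lemma finite_H: "finite H"
  using H_J finite_J by (meson Pow_iff finite_Pow_iff finite_subset subsetI)

lemma finite_edge: "e \<in> H \<Longrightarrow> finite e"
  using H_J finite_J finite_subset by blast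

lemma edge_not_subset: "e \<in> H \<Longrightarrow> e' \<in> H \<Longrightarrow> e \<noteq> e' \<Longrightarrow> \<not> e \<subseteq> e'"
  using card_subset_eq[OF finite_edge] H_card by metis

end

section \<open>Iterated Cauchy-Schwarz around one edge\<close>

locale linear_forms_edge = linear_forms_system J V H d \<nu> U
  for J :: "'j set" and V :: "nat \<Rightarrow> 'j \<Rightarrow> 'v set" and H d \<nu> U +
  fixes e1 :: "'j set"
  assumes e1: "e1 \<in> H"
begin

definition L where "L = H - {e1}"

definition oc :: "'j set \<Rightarrow> bool \<Rightarrow> 'j set" where "oc e c = (if c then e - e1 else {})"

definition M :: "('j set \<times> bool) set \<Rightarrow> nat \<Rightarrow> 'j set \<Rightarrow> bool \<Rightarrow> ('j \<Rightarrow> 'v) \<Rightarrow> real" where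
  "M S n e c x = (if (e, c) \<in> S then \<nu> n e x else 1)"

text \<open>The factor of \<open>e\<close> once Cauchy-Schwarz has doubled the coordinates in
  \<open>C\<close>: a copy of \<open>\<phi>\<close> for each outside copy \<open>c\<close> and each
  choice of the doubled coordinates.\<close>

definition block where
  "block \<phi> n C e x0 x1 = (\<Prod>c\<in>UNIV. \<Prod>B\<in>Pow (C \<inter> e). \<phi> n e c (restrict (glue (B \<union> oc e c) x1 x0) e))"
  for \<phi> :: "nat \<Rightarrow> 'j set \<Rightarrow> bool \<Rightarrow> ('j \<Rightarrow> 'v) \<Rightarrow> real"

lemma finite_L: "finite L" and L_H: "e \<in> L \<Longrightarrow> e \<in> H" and e1_L: "e1 \<notin> L"
  using finite_H by (auto simp: L_def)

lemma fin_e1: "finite e1" using finite_edge e1 .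

lemma e1_J: "e1 \<subseteq> J" using H_J e1 .

lemma L_not_subset: "e \<in> L \<Longrightarrow> e - e1 \<noteq> {}" "e \<in> L \<Longrightarrow> \<not> e1 \<subseteq> e"
  using edge_not_subset e1 by (auto simp: L_def)

text \<open>The vertices \<open>B \<union> oc e c\<close> have to be pairwise different, since a
  weight occurring twice would be outside the linear forms condition. The part inside
  \<open>e1\<close> recovers \<open>B\<close>; the part outside recovers \<open>c\<close>, because
  \<open>e - e1\<close> is not empty.\<close>

lemma block_M:
  assumes "e \<in> L" "C \<subseteq> e1"
  shows "block (M S) n C e x0 x1 =
    (\<Prod>D\<in>(\<lambda>(c, B). B \<union> oc e c) ` ({c. (e, c) \<in> S} \<times> Pow (C \<inter> e)). \<nu> n e (restrict (glue D x1 x0) e))"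
proof -
  have fin: "finite C" using assms fin_e1 finite_subset by auto
  have inj: "inj_on (\<lambda>(c, B). B \<union> oc e c) ({c. (e, c) \<in> S} \<times> Pow (C \<inter> e))"
  proof (rule inj_onI, clarify)
    fix c B c' B' assume *: "B \<subseteq> C \<inter> e" "B' \<subseteq> C \<inter> e" "B \<union> oc e c = B' \<union> oc e c'"
    have oc: "oc e c \<inter> e1 = {}" for c by (auto simp: oc_def)
    have "(B \<union> oc e c) \<inter> e1 = B" "(B' \<union> oc e c') \<inter> e1 = B'"
      using * assms oc[of c] oc[of c'] by blast+
    moreover have "(B \<union> oc e c) - e1 = oc e c" "(B' \<union> oc e c') - e1 = oc e c'"
      using * assms oc[of c] oc[of c'] by blast+
    ultimately have "B = B'" "oc e c = oc e c'" using * by auto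
    then show "c = c' \<and> B = B'" using L_not_subset(1)[OF assms(1)]
      by (auto simp: oc_def split: if_splits)
  qed
  have "block (M S) n C e x0 x1
      = (\<Prod>c\<in>UNIV. if c \<in> {c. (e, c) \<in> S} then \<Prod>B\<in>Pow (C \<inter> e). \<nu> n e (restrict (glue (B \<union> oc e c) x1 x0) e) else 1)"
    unfolding block_def by (rule prod.cong) (auto simp: M_def)
  also have "\<dots> = (\<Prod>c\<in>{c. (e, c) \<in> S}. \<Prod>B\<in>Pow (C \<inter> e). \<nu> n e (restrict (glue (B \<union> oc e c) x1 x0) e))"
    by (subst prod.inter_restrict[symmetric]) auto
  also have "\<dots> = (\<Prod>(c, B)\<in>{c. (e, c) \<in> S} \<times> Pow (C \<inter> e). \<nu> n e (restrict (glue (B \<union> oc e c) x1 x0) e))"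
    using fin by (subst prod.cartesian_product) auto
  finally show ?thesis
    by (subst prod.reindex[OF inj]) (auto simp: split_beta comp_def)
qed

lemma linear_forms_M:
  assumes C: "C \<subseteq> e1" and Y: "Y \<subseteq> Pow e1" and L': "L' \<subseteq> L"
  shows "((\<lambda>n. av n (\<lambda>x0. av n (\<lambda>x1. (\<Prod>B\<in>Y. \<nu> n e1 (restrict (glue B x1 x0) e1)) *
      (\<Prod>e\<in>L'. block (M S) n C e x0 x1)))) \<longlongrightarrow> 1) U"
proof -
  define T where "T e = (if e = e1 then Y else if e \<in> L' then (\<lambda>(c, B). B \<union> oc e c) ` ({c. (e, c) \<in> S} \<times> Pow (C \<inter> e)) else {})" for e
  have T: "T e \<subseteq> Pow e" if "e \<in> H" for e
    using Y by (auto simp: T_def oc_def split: if_splits)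
  have eq: "(\<Prod>e\<in>H. \<Prod>D\<in>T e. \<nu> n e (restrict (glue D x1 x0) e))
     = (\<Prod>B\<in>Y. \<nu> n e1 (restrict (glue B x1 x0) e1)) * (\<Prod>e\<in>L'. block (M S) n C e x0 x1)" for n x0 x1
  proof -
    have "(\<Prod>e\<in>H. \<Prod>D\<in>T e. \<nu> n e (restrict (glue D x1 x0) e))
       = (\<Prod>D\<in>T e1. \<nu> n e1 (restrict (glue D x1 x0) e1)) * (\<Prod>e\<in>L. \<Prod>D\<in>T e. \<nu> n e (restrict (glue D x1 x0) e))"
      unfolding L_def using finite_H e1 by (simp add: prod.remove)
    also have "(\<Prod>e\<in>L. \<Prod>D\<in>T e. \<nu> n e (restrict (glue D x1 x0) e)) = (\<Prod>e\<in>L'. \<Prod>D\<in>T e. \<nu> n e (restrict (glue D x1 x0) e))"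
      using L' finite_L by (intro prod.mono_neutral_right) (auto simp: T_def e1_L)
    also have "\<dots> = (\<Prod>e\<in>L'. block (M S) n C e x0 x1)"
      using L' e1_L C by (intro prod.cong) (auto simp: T_def block_M)
    also have "T e1 = Y" by (simp add: T_def)
    finally show ?thesis .
  qed
  show ?thesis using linear_forms[of T, OF T] unfolding eq by simp
qed

text \<open>The state of the argument when the coordinates in \<open>A\<close> have been doubled:
  \<open>h\<close> sits on every cube vertex over \<open>A\<close>, and the test functions
  \<open>u j\<close> survive only for the coordinates not yet treated.\<close>

definition Q where
  "Q h u \<phi> n A = av n (\<lambda>x0. av n (\<lambda>x1.
     (\<Prod>B\<in>Pow A. h n (glue B x1 x0) * (\<Prod>j\<in>e1 - A. u j n (glue B x1 x0))) *
     (\<Prod>e\<in>L. block \<phi> n A e x0 x1)))"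
  for h :: "nat \<Rightarrow> ('j \<Rightarrow> 'v) \<Rightarrow> real" and u :: "'j \<Rightarrow> nat \<Rightarrow> ('j \<Rightarrow> 'v) \<Rightarrow> real"

definition dominated where
  "dominated S \<phi> \<longleftrightarrow> (\<forall>n. \<forall>e\<in>L. \<forall>c. \<forall>x\<in>PiE e (V n). 0 \<le> \<phi> n e c x \<and> \<phi> n e c x \<le> M S n e c x)"

text \<open>A bounded function independent of coordinate \<open>j\<close> is what a Cauchy-Schwarz
  step in that coordinate removes; the test functions of the argument are products with one such
  factor for each \<open>j\<close> in \<open>e1\<close>.\<close>

definition slot_functions where
  "slot_functions u \<longleftrightarrow> (\<forall>j\<in>e1. \<forall>n. \<forall>x\<in>X n. 0 \<le> u j n x \<and> u j n x \<le> (1::real) \<and>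
      (\<forall>y\<in>X n. u j n (x(j := y j)) = u j n x))"

lemma M_nonneg: "e \<in> H \<Longrightarrow> x \<in> PiE e (V n) \<Longrightarrow> 0 \<le> M S n e c x"
  by (simp add: M_def nu_nonneg)

lemma prod_Pow_insert:
  fixes f :: "'a set \<Rightarrow> real"
  assumes "finite A" "j \<notin> A"
  shows "(\<Prod>B\<in>Pow (insert j A). f B) = (\<Prod>B\<in>Pow A. f B * f (insert j B))"
proof -
  have "inj_on (insert j) (Pow A)" using assms by (auto intro!: inj_onI)
  then show ?thesis unfolding Pow_insert using assms
    by (subst prod.union_disjoint) (auto simp: prod.reindex prod.distrib)
qed

lemma glue_upd_left: "j \<notin> D \<Longrightarrow> glue D (x1(j := a)) x0 = glue D x1 x0"
  and glue_upd_right: "j \<notin> D \<Longrightarrow> glue D x1 (x0(j := a)) = (glue D x1 x0)(j := a)"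
  and glue_upd_insert: "glue D x1 (x0(j := x1 j)) = glue (insert j D) x1 x0"
  by (auto simp: glue_def)

text \<open>The factor pulled out of the inner average consists of \<open>u j\<close> and the blocks
  of the edges missing \<open>j\<close>. It is bounded by the corresponding blocks of
  \<open>M S\<close>, which stay behind as a weight. So edges missing \<open>j\<close> trade
  \<open>\<phi>\<close> for its majorant, while edges through \<open>j\<close> are doubled in that
  coordinate.\<close>

lemma Q_step:
  assumes \<phi>: "dominated S \<phi>" and u: "slot_functions u" and A: "A \<subseteq> e1" "j \<in> e1" "j \<notin> A"
  shows "(Q h u \<phi> n A)\<^sup>2 \<le>
    av n (\<lambda>x0. av n (\<lambda>x1. \<Prod>e\<in>{e\<in>L. j \<notin> e}. block (M S) n A e x0 x1)) *
    Q h u (\<lambda>n e c. if j \<in> e then \<phi> n e c else M S n e c) n (insert j A)"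
proof -
  have finA: "finite A" using A fin_e1 finite_subset by auto
  let ?\<phi> = "\<lambda>n e c. if j \<in> e then \<phi> n e c else M S n e c"
  define W where "W x0 x1 = (\<Prod>B\<in>Pow A. u j n (glue B x1 x0)) * (\<Prod>e\<in>{e\<in>L. j \<notin> e}. block \<phi> n A e x0 x1)" for x0 x1
  define W' where "W' x0 x1 = (\<Prod>e\<in>{e\<in>L. j \<notin> e}. block (M S) n A e x0 x1)" for x0 x1
  define h' where "h' x = h n x * (\<Prod>j\<in>e1 - insert j A. u j n x)" for x
  define K where "K x0 x1 = (\<Prod>B\<in>Pow A. h' (glue B x1 x0)) * (\<Prod>e\<in>{e\<in>L. j \<in> e}. block \<phi> n A e x0 x1)" for x0 x1
  have split: "(\<Prod>e\<in>L. f e) = (\<Prod>e\<in>{e\<in>L. j \<notin> e}. f e) * (\<Prod>e\<in>{e\<in>L. j \<in> e}. f e)" for f :: "'j set \<Rightarrow> real"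
    using finite_L by (subst prod.union_disjoint[symmetric]) (auto intro!: prod.cong)
  have WK: "Q h u \<phi> n A = av n (\<lambda>x0. av n (\<lambda>x1. W x0 x1 * K x0 x1))"
  proof -
    have "(\<Prod>j\<in>e1 - A. u j n x) = u j n x * (\<Prod>j\<in>e1 - insert j A. u j n x)" for x
      using fin_e1 A by (subst prod.remove[of _ j]) (auto simp: Diff_insert[symmetric])
    then show ?thesis unfolding Q_def W_def K_def h'_def
      by (simp add: split prod.distrib mult_ac)
  qed
  have blk_upd: "block \<psi> n A e (x0(j := a)) x1 = block \<psi> n A e x0 x1"
       "block \<psi> n A e x0 (x1(j := a)) = block \<psi> n A e x0 x1" if "j \<notin> e" for \<psi> e x0 x1 a
  proof -
    have "restrict (glue D x1 (x0(j := a))) e = restrict (glue D x1 x0) e"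
       "restrict (glue D (x1(j := a)) x0) e = restrict (glue D x1 x0) e" for D
      using that by (auto simp: restrict_def glue_def)
    then show "block \<psi> n A e (x0(j := a)) x1 = block \<psi> n A e x0 x1"
       "block \<psi> n A e x0 (x1(j := a)) = block \<psi> n A e x0 x1" unfolding block_def by simp_all
  qed
  have blk_upd1: "block \<psi> n A e x0 (x1(j := a)) = block \<psi> n A e x0 x1" if "j \<in> e" for \<psi> e x0 x1 a
    unfolding block_def using A by (intro prod.cong refl) (subst glue_upd_left, auto simp: oc_def)
  have blk_ins: "block \<psi> n (insert j A) e x0 x1 = block \<psi> n A e x0 x1 * block \<psi> n A e (x0(j := x1 j)) x1"
    if "j \<in> e" for \<psi> e x0 x1
  proof -
    have "insert j A \<inter> e = insert j (A \<inter> e)" using that by auto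
    then show ?thesis unfolding block_def
      using prod_Pow_insert[of "A \<inter> e" j] finA A by (simp add: prod.distrib glue_upd_insert)
  qed
  have in_e: "restrict (glue D x1 x0) e \<in> PiE e (V n)" if "x0 \<in> X n" "x1 \<in> X n" "e \<in> L" for D x0 x1 e
    using that L_H H_J by (intro restrict_X glue_X) auto
  have W_bound: "0 \<le> W x0 x1 \<and> W x0 x1 \<le> W' x0 x1" if x: "x0 \<in> X n" "x1 \<in> X n" for x0 x1
  proof -
    have b: "0 \<le> block \<phi> n A e x0 x1 \<and> block \<phi> n A e x0 x1 \<le> block (M S) n A e x0 x1" if "e \<in> L" for e
    proof -
      have "0 \<le> \<phi> n e c (restrict (glue D x1 x0) e)"
        "\<phi> n e c (restrict (glue D x1 x0) e) \<le> M S n e c (restrict (glue D x1 x0) e)" for c D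
        using \<phi> in_e[OF x that] that by (simp_all add: dominated_def)
      then show ?thesis unfolding block_def by (intro conjI prod_nonneg prod_mono) (simp_all add: prod_nonneg prod_mono)
    qed
    have u01: "0 \<le> (\<Prod>B\<in>Pow A. u j n (glue B x1 x0))" "(\<Prod>B\<in>Pow A. u j n (glue B x1 x0)) \<le> 1"
      using u A glue_X[OF x(2,1)] unfolding slot_functions_def by (intro prod_nonneg prod_le_1; simp)+
    have m: "0 \<le> (\<Prod>e\<in>{e\<in>L. j \<notin> e}. block \<phi> n A e x0 x1)" "(\<Prod>e\<in>{e\<in>L. j \<notin> e}. block \<phi> n A e x0 x1) \<le> W' x0 x1"
      unfolding W'_def using b by (auto intro!: prod_nonneg prod_mono)
    show ?thesis unfolding W_def using u01 m mult_mono[OF u01(2) m(2)] by auto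
  qed
  have KK: "W' x0 x1 * (K x0 x1 * K (x0(j := x1 j)) x1) =
     (\<Prod>B\<in>Pow (insert j A). h n (glue B x1 x0) * (\<Prod>j\<in>e1 - insert j A. u j n (glue B x1 x0))) *
     (\<Prod>e\<in>L. block ?\<phi> n (insert j A) e x0 x1)" for x0 x1
  proof -
    have 1: "(\<Prod>B\<in>Pow A. h' (glue B x1 x0)) * (\<Prod>B\<in>Pow A. h' (glue B x1 (x0(j := x1 j)))) = (\<Prod>B\<in>Pow (insert j A). h' (glue B x1 x0))"
      using finA A by (subst prod_Pow_insert) (auto simp: prod.distrib glue_upd_insert)
    have 2: "(\<Prod>e\<in>{e\<in>L. j \<in> e}. block \<phi> n A e x0 x1) * (\<Prod>e\<in>{e\<in>L. j \<in> e}. block \<phi> n A e (x0(j := x1 j)) x1)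
       = (\<Prod>e\<in>{e\<in>L. j \<in> e}. block ?\<phi> n (insert j A) e x0 x1)"
      unfolding prod.distrib[symmetric] by (intro prod.cong) (auto simp: blk_ins, auto simp: block_def)
    have 3: "W' x0 x1 = (\<Prod>e\<in>{e\<in>L. j \<notin> e}. block ?\<phi> n (insert j A) e x0 x1)"
      unfolding W'_def by (intro prod.cong) (auto simp: block_def)
    show ?thesis unfolding K_def split 3 2[symmetric] h'_def[symmetric] 1[symmetric] by (simp add: mult_ac)
  qed
  have "(av n (\<lambda>x0. av n (\<lambda>x1. W x0 x1 * K x0 x1)))\<^sup>2 \<le>
     av n (\<lambda>x0. av n (W' x0)) * av n (\<lambda>x0. av n (\<lambda>x1. W' x0 x1 * (K x0 x1 * K (x0(j := x1 j)) x1)))"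
  proof (rule avg_Cauchy_Schwarz_step)
    show "finite (PiE J (V n))" "PiE J (V n) \<noteq> {}" using finite_X X_nonempty by (auto simp only: X_def)
    show "X n = PiE J (V n)" by (rule X_def)
    show "\<And>x0 x1. x0 \<in> X n \<Longrightarrow> x1 \<in> X n \<Longrightarrow> 0 \<le> W x0 x1 \<and> W x0 x1 \<le> W' x0 x1" by (rule W_bound)
    show "W (x0(j := y j)) x1 = W x0 x1" if "x0 \<in> X n" "x1 \<in> X n" "y \<in> X n" for x0 x1 y
    proof -
      have "u j n (glue B x1 (x0(j := y j))) = u j n (glue B x1 x0)" if "B \<in> Pow A" for B
        using that A u \<open>x0 \<in> X n\<close> \<open>x1 \<in> X n\<close> \<open>y \<in> X n\<close> glue_X[of x1 n x0 B]
        unfolding slot_functions_def by (subst glue_upd_right) auto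
      then show ?thesis unfolding W_def by (simp add: blk_upd)
    qed
    show "W' (x0(j := y j)) x1 = W' x0 x1" "W' x0 (x1(j := y j)) = W' x0 x1" for x0 x1 y
      unfolding W'_def by (simp_all add: blk_upd)
    show "K x0 (x1(j := y j)) = K x0 x1" for x0 x1 y
    proof -
      have "glue B (x1(j := y j)) x0 = glue B x1 x0" if "B \<in> Pow A" for B
        using that A by (intro glue_upd_left) auto
      then show ?thesis unfolding K_def by (simp add: blk_upd1)
    qed
  qed
  then show ?thesis unfolding WK unfolding KK unfolding Q_def W'_def .
qed

text \<open>In the fully doubled configuration every factor is a weight, so that the linear forms
  condition applies to each term of the expansion of \<open>\<Prod>(\<nu> - 1)\<close>.\<close>

lemma Q_full:
  assumes \<phi>: "\<And>n e c. e \<in> L \<Longrightarrow> \<phi> n e c = M S n e c"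
  shows "((\<lambda>n. Q (\<lambda>n x. \<nu> n e1 (restrict x e1) - 1) u \<phi> n e1) \<longlongrightarrow> 0) U"
proof -
  let ?P = "\<lambda>n Y x0 x1. (\<Prod>B\<in>Y. \<nu> n e1 (restrict (glue B x1 x0) e1)) * (\<Prod>e\<in>L. block (M S) n e1 e x0 x1)"
  let ?s = "\<lambda>Y. \<Prod>B\<in>Pow e1 - Y. (-1::real)"
  have fin: "finite (Pow e1)" using fin_e1 by simp
  have blk: "block \<phi> n e1 e x0 x1 = block (M S) n e1 e x0 x1" if "e \<in> L" for n e x0 x1
    unfolding block_def using \<phi>[OF that] by simp
  have "(\<Prod>B\<in>Pow e1. \<nu> n e1 (restrict (glue B x1 x0) e1) - 1) * (\<Prod>e\<in>L. block \<phi> n e1 e x0 x1) =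
     (\<Sum>Y\<in>Pow (Pow e1). ?s Y * ?P n Y x0 x1)" for n x0 x1
    using prod_add[OF fin, of "\<lambda>B. \<nu> n e1 (restrict (glue B x1 x0) e1)" "\<lambda>_. -1"]
    by (simp add: blk sum_distrib_left sum_distrib_right mult_ac)
  then have eq: "Q (\<lambda>n x. \<nu> n e1 (restrict x e1) - 1) u \<phi> n e1 = (\<Sum>Y\<in>Pow (Pow e1). ?s Y * av n (\<lambda>x0. av n (?P n Y x0)))" for n
    unfolding Q_def by (simp add: avg_sum avg_cmult)
  have "((\<lambda>n. \<Sum>Y\<in>Pow (Pow e1). ?s Y * av n (\<lambda>x0. av n (?P n Y x0))) \<longlongrightarrow> (\<Sum>Y\<in>Pow (Pow e1). ?s Y * 1)) U"
    by (intro tendsto_sum tendsto_mult tendsto_const linear_forms_M) auto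
  \<comment> \<open>Each term of the expansion has limit 1 up to sign, and the signs add up to the
    product of 1 - 1 over the cube vertices.\<close>
  moreover have "(\<Sum>Y\<in>Pow (Pow e1). ?s Y * 1) = 0"
  proof -
    have "(\<Prod>B\<in>Pow e1. 1 + (-1::real)) = 0" using fin by (intro prod_zero) auto
    then have "(\<Sum>Y\<in>Pow (Pow e1). (\<Prod>B\<in>Y. 1) * ?s Y) = 0" by (subst (asm) prod_add[OF fin])
    then show ?thesis by simp
  qed
  ultimately show ?thesis unfolding eq by simp
qed

text \<open>Induction on the number of coordinates of \<open>e1\<close> still to be doubled: the
  square of \<open>Q\<close> is at most a quantity tending to 1 times the next \<open>Q\<close>. The
  last hypothesis is the invariant created by \<open>Q_step\<close>: an edge missing some treated
  coordinate already carries its majorant. At \<open>A = e1\<close> this covers all of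
  \<open>L\<close>, as no other edge contains \<open>e1\<close>.\<close>

lemma Q_tendsto_0:
  assumes "A \<subseteq> e1" "dominated S \<phi>" "slot_functions u"
    and "\<And>n e c. e \<in> L \<Longrightarrow> \<not> A \<subseteq> e \<Longrightarrow> \<phi> n e c = M S n e c"
  shows "((\<lambda>n. Q (\<lambda>n x. \<nu> n e1 (restrict x e1) - 1) u \<phi> n A) \<longlongrightarrow> 0) U"
  using assms
proof (induction "card (e1 - A)" arbitrary: A \<phi>)
  case 0
  have "A = e1" using 0 fin_e1 by auto
  show ?case unfolding \<open>A = e1\<close> by (rule Q_full) (use 0 \<open>A = e1\<close> L_not_subset in blast)
next
  case (Suc k)
  let ?h = "\<lambda>n x. \<nu> n e1 (restrict x e1) - 1"
  have "e1 - A \<noteq> {}" using Suc(2) by (intro notI) simp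
  then obtain j where j: "j \<in> e1" "j \<notin> A" by auto
  let ?\<phi> = "\<lambda>n e c. if j \<in> e then \<phi> n e c else M S n e c"
  have "card (e1 - insert j A) = k"
    unfolding Diff_insert[of e1 j A] using Suc(2)[symmetric] j by (subst card_Diff_singleton) auto
  have IH: "((\<lambda>n. Q ?h u ?\<phi> n (insert j A)) \<longlongrightarrow> 0) U"
  proof (rule Suc(1))
    show "dominated S ?\<phi>" using Suc(4) M_nonneg L_H by (simp add: dominated_def)
    show "?\<phi> n e c = M S n e c" if "e \<in> L" "\<not> insert j A \<subseteq> e" for n e c
      using that Suc(6)[of e n c] by auto
  qed (use Suc j \<open>card (e1 - insert j A) = k\<close> in auto)
  have 1: "((\<lambda>n. av n (\<lambda>x0. av n (\<lambda>x1. \<Prod>e\<in>{e\<in>L. j \<notin> e}. block (M S) n A e x0 x1))) \<longlongrightarrow> 1) U"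
    using linear_forms_M[of A "{}" "{e\<in>L. j \<notin> e}" S] Suc by simp
  have "((\<lambda>n. (Q ?h u \<phi> n A)\<^sup>2) \<longlongrightarrow> 0) U"
  proof (rule tendsto_sandwich[OF _ _ tendsto_const])
    show "eventually (\<lambda>n. (Q ?h u \<phi> n A)\<^sup>2 \<le> av n (\<lambda>x0. av n (\<lambda>x1. \<Prod>e\<in>{e\<in>L. j \<notin> e}. block (M S) n A e x0 x1)) * Q ?h u ?\<phi> n (insert j A)) U"
      using Suc j by (intro always_eventually allI Q_step) auto
    show "((\<lambda>n. av n (\<lambda>x0. av n (\<lambda>x1. \<Prod>e\<in>{e\<in>L. j \<notin> e}. block (M S) n A e x0 x1)) * Q ?h u ?\<phi> n (insert j A)) \<longlongrightarrow> 0) U"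
      using tendsto_mult[OF 1 IH] by simp
  qed auto
  then have "((\<lambda>n. sqrt ((Q ?h u \<phi> n A)\<^sup>2)) \<longlongrightarrow> sqrt 0) U" by (rule tendsto_real_sqrt)
  then show ?case by (simp add: tendsto_rabs_zero_iff)
qed

definition fibre where
  "fibre \<phi> n c x = av n (\<lambda>y. \<Prod>e\<in>L. \<phi> n e c (restrict (glue e1 x y) e))"
  for \<phi> :: "nat \<Rightarrow> 'j set \<Rightarrow> bool \<Rightarrow> ('j \<Rightarrow> 'v) \<Rightarrow> real"

lemma fibre_glue: "fibre \<phi> n c (glue e1 x y) = fibre \<phi> n c x"
proof -
  have "glue e1 (glue e1 x y) z = glue e1 x z" for z by (auto simp: glue_def)
  then show ?thesis by (simp add: fibre_def)
qed

text \<open>With nothing doubled inside \<open>e1\<close>, the two copies of the outside coordinates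
  are independent given the coordinates in \<open>e1\<close>, and integrating them out separately
  gives two fibre averages.\<close>

lemma av_block_fibre:
  assumes k: "\<And>x y. x \<in> X n \<Longrightarrow> y \<in> X n \<Longrightarrow> k (glue e1 x y) = k x"
  shows "av n (\<lambda>x0. av n (\<lambda>x1. k x0 * (\<Prod>e\<in>L. block \<phi> n {} e x0 x1))) =
    av n (\<lambda>x. k x * (fibre \<phi> n False x * fibre \<phi> n True x))"
proof -
  let ?P = "\<lambda>x0. \<Prod>e\<in>L. \<phi> n e False (restrict x0 e)"
  have r: "restrict (glue (oc e True) x1 x0) e = restrict (glue e1 x0 x1) e"
     "restrict (glue (oc e False) x1 x0) e = restrict x0 e" for e x0 x1
    by (auto simp: restrict_def glue_def oc_def)
  have "(\<Prod>e\<in>L. block \<phi> n {} e x0 x1) = ?P x0 * (\<Prod>e\<in>L. \<phi> n e True (restrict (glue e1 x0 x1) e))" for x0 x1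
    unfolding block_def prod.distrib[symmetric] by (simp add: UNIV_bool r mult.commute)
  then have "av n (\<lambda>x0. av n (\<lambda>x1. k x0 * (\<Prod>e\<in>L. block \<phi> n {} e x0 x1)))
     = av n (\<lambda>x0. (k x0 * ?P x0) * fibre \<phi> n True x0)"
    by (simp add: fibre_def avg_cmult mult.assoc)
  also have "\<dots> = av n (\<lambda>x0. av n (\<lambda>y. (k (glue e1 x0 y) * ?P (glue e1 x0 y)) * fibre \<phi> n True (glue e1 x0 y)))"
    by (rule av_glue[symmetric])
  also have "\<dots> = av n (\<lambda>x0. av n (\<lambda>y. (k x0 * fibre \<phi> n True x0) * ?P (glue e1 x0 y)))"
    by (intro avg_cong) (simp add: k fibre_glue mult_ac)
  also have "\<dots> = av n (\<lambda>x. k x * (fibre \<phi> n False x * fibre \<phi> n True x))"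
    by (simp add: avg_cmult avg_cmult_right fibre_def mult_ac)
  finally show ?thesis .
qed

lemma glue_0 [simp]: "glue {} x y = y" by (simp add: glue_def)

text \<open>This is the case \<open>A = {}\<close> of the Cauchy-Schwarz argument. Choosing
  \<open>\<phi>\<close> constantly 1 in one of the two copies leaves a single fibre average, and in
  both copies none.\<close>

proposition strong_linear_forms:
  assumes \<phi>: "dominated S \<phi>" and u: "slot_functions u"
    and u1: "\<And>j n x y. j \<in> e1 \<Longrightarrow> x \<in> X n \<Longrightarrow> y \<in> X n \<Longrightarrow> u j n (glue e1 x y) = u j n x"
  shows "((\<lambda>n. av n (\<lambda>x. ((\<nu> n e1 (restrict x e1) - 1) * (\<Prod>j\<in>e1. u j n x)) *
      (fibre \<phi> n False x * fibre \<phi> n True x))) \<longlongrightarrow> 0) U"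
proof -
  have "Q (\<lambda>n x. \<nu> n e1 (restrict x e1) - 1) u \<phi> n {} = av n (\<lambda>x. ((\<nu> n e1 (restrict x e1) - 1) * (\<Prod>j\<in>e1. u j n x)) *
      (fibre \<phi> n False x * fibre \<phi> n True x))" for n
    unfolding Q_def by (subst av_block_fibre[symmetric]) (auto simp: restrict_glue u1)
  then show ?thesis using Q_tendsto_0[of "{}" S \<phi> u] \<phi> u by simp
qed

text \<open>These are moments of the majorant: \<open>S\<close> decides whether one or both copies
  are active, hence first or second moment, and \<open>b\<close> decides between the weighted and
  the uniform measure.\<close>

lemma fibre_M_moment:
  "((\<lambda>n. av n (\<lambda>x. (if b then \<nu> n e1 (restrict x e1) else 1) * (fibre (M S) n False x * fibre (M S) n True x))) \<longlongrightarrow> 1) U"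
proof -
  have "av n (\<lambda>x. (if b then \<nu> n e1 (restrict x e1) else 1) * (fibre (M S) n False x * fibre (M S) n True x))
     = av n (\<lambda>x0. av n (\<lambda>x1. (\<Prod>B\<in>(if b then {{}} else {}). \<nu> n e1 (restrict (glue B x1 x0) e1)) *
      (\<Prod>e\<in>L. block (M S) n {} e x0 x1)))" for n
    by (subst av_block_fibre[symmetric]) (auto simp: restrict_glue)
  then show ?thesis using linear_forms_M[of "{}" "if b then {{}} else {}" L S] by simp
qed

end

section \<open>Loeb measures\<close>

text \<open>The sum counts the thresholds \<open>(i + 1) / K\<close> that are at most
  \<open>t\<close>; there are \<open>\<lfloor>t * K\<rfloor>\<close> of them.\<close>

lemma quantization_error:
  fixes t :: real
  assumes "0 \<le> t" "t \<le> 1" "K > 0"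
  shows "\<bar>t - (\<Sum>i<K. if real (Suc i) / real K \<le> t then 1 else 0) / real K\<bar> \<le> 1 / real K"
proof -
  define m where "m = nat \<lfloor>t * K\<rfloor>"
  have m: "real m \<le> t * K" "t * K < real m + 1"
    using assms by (auto simp: m_def)
  have "t * K \<le> K" using assms by (simp add: mult_left_le_one_le)
  then have mK: "m \<le> K" using m(1) by linarith
  have iff: "real (Suc i) / K \<le> t \<longleftrightarrow> i < m" for i
  proof -
    have "real (Suc i) / K \<le> t \<longleftrightarrow> real (Suc i) \<le> t * K" using assms by (simp add: divide_le_eq)
    also have "\<dots> \<longleftrightarrow> i < m"
    proof
      assume "real (Suc i) \<le> t * K"
      then have "real (Suc i) < real m + 1" using m by linarith
      then show "i < m" by linarith
    next
      assume "i < m"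
      then have "real (Suc i) \<le> real m" by linarith
      then show "real (Suc i) \<le> t * K" using m by linarith
    qed
    finally show ?thesis .
  qed
  have "(\<Sum>i<K. if real (Suc i) / real K \<le> t then 1 else 0::real) = (\<Sum>i\<in>{..<K} \<inter> {i. i < m}. 1)"
    unfolding iff by (simp add: sum.If_cases)
  also have "{..<K} \<inter> {i. i < m} = {..<m}" using mK by auto
  finally have "(\<Sum>i<K. if real (Suc i) / real K \<le> t then 1 else 0::real) = real m" by simp
  then have "t - (\<Sum>i<K. if real (Suc i) / real K \<le> t then 1 else 0) / real K = (t * K - m) / K"
    using assms by (simp add: diff_divide_distrib)
  moreover have "\<bar>t * K - m\<bar> \<le> 1" using m by linarith
  ultimately show ?thesis using assms by (simp add: divide_right_mono)
qed

locale loeb_setting = vertex_system J V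
  for J :: "'j set" and V :: "nat \<Rightarrow> 'j \<Rightarrow> 'v set" +
  fixes U :: "nat filter"
  assumes U_nontrivial: "U \<noteq> bot" and U_seq: "U \<le> sequentially"
    and U_ultra: "eventually P U \<or> eventually (\<lambda>n. \<not> P n) U"
begin

definition ul :: "(nat \<Rightarrow> real) \<Rightarrow> real" where "ul a = Lim U a"

lemma ul_eqI: "(a \<longlongrightarrow> l) U \<Longrightarrow> ul a = l"
  unfolding ul_def by (rule tendsto_Lim[OF U_nontrivial])

text \<open>Compactness of the interval gives a cluster point of the image filter, and along an
  ultrafilter a cluster point is a limit.\<close>

lemma ul_tendsto:
  assumes "eventually (\<lambda>n. \<bar>a n\<bar> \<le> C) U"
  shows "(a \<longlongrightarrow> ul a) U"
proof -
  have "filtermap a U \<noteq> bot" using U_nontrivial by (simp add: filtermap_bot_iff)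
  moreover have "eventually (\<lambda>x. x \<in> {-C..C}) (filtermap a U)"
    using assms by (auto simp: eventually_filtermap abs_le_iff elim!: eventually_mono)
  moreover have "compact {-C..C}" by simp
  ultimately obtain l where l: "inf (nhds l) (filtermap a U) \<noteq> bot"
    unfolding compact_filter by blast
  have "(a \<longlongrightarrow> l) U"
  proof (rule topological_tendstoI)
    fix S assume S: "open S" "l \<in> S"
    show "eventually (\<lambda>n. a n \<in> S) U"
    proof (rule ccontr)
      assume "\<not> ?thesis"
      then have "eventually (\<lambda>n. a n \<notin> S) U" using U_ultra by blast
      then have "eventually (\<lambda>x. x \<notin> S) (filtermap a U)" by (simp add: eventually_filtermap)
      moreover have "eventually (\<lambda>x. x \<in> S) (nhds l)" using S by (auto simp: eventually_nhds)
      ultimately have "eventually (\<lambda>x. False) (inf (nhds l) (filtermap a U))"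
        unfolding eventually_inf by fastforce
      then show False using l by (simp add: trivial_limit_def)
    qed
  qed
  then show ?thesis using ul_eqI by simp
qed

lemma not_eventually_U: "\<not> eventually P U \<longleftrightarrow> eventually (\<lambda>n. \<not> P n) U"
proof -
  have "\<not> (eventually P U \<and> eventually (\<lambda>n. \<not> P n) U)"
  proof
    assume "eventually P U \<and> eventually (\<lambda>n. \<not> P n) U"
    then have "eventually (\<lambda>n. False) U" by (auto elim: eventually_elim2)
    then show False using U_nontrivial by (simp add: trivial_limit_def)
  qed
  then show ?thesis using U_ultra by blast
qed

section \<open>Internal sets and the algebras they generate\<close>

definition Omega :: "(nat \<Rightarrow> 'j \<Rightarrow> 'v) set" where "Omega = {x. \<forall>n. x n \<in> X n}"

text \<open>Sequences are not identified modulo \<open>U\<close>. An internal set contains, with a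
  sequence, every element of \<open>Omega\<close> that agrees with it \<open>U\<close>-often, so
  passing to the quotient would not change the structure of the internal sets.\<close>

definition intl :: "(nat \<Rightarrow> ('j \<Rightarrow> 'v) set) \<Rightarrow> (nat \<Rightarrow> 'j \<Rightarrow> 'v) set" where
  "intl S = {x\<in>Omega. eventually (\<lambda>n. x n \<in> S n) U}"

definition cyl :: "'j set \<Rightarrow> (nat \<Rightarrow> ('j \<Rightarrow> 'v) set) set" where
  "cyl e = {S. \<forall>n. S n \<in> cylAlg J (V n) e}"

text \<open>Membership in the \<open>\<sigma>\<close>-algebra of \<open>e\<close> becomes invariance
  under changing the coordinates outside \<open>e\<close>; this form is stable under all later
  manipulations with \<open>glue\<close>.\<close>

lemma cylAlg_iff:
  assumes "e \<subseteq> J"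
  shows "A \<in> cylAlg J (V n) e \<longleftrightarrow> A \<subseteq> X n \<and> (\<forall>x\<in>A. \<forall>y\<in>X n. glue e x y \<in> A)"
proof
  assume "A \<in> cylAlg J (V n) e"
  then obtain E where A: "A = {x\<in>X n. restrict x e \<in> E}"
    unfolding cylAlg_def X_def by auto
  then show "A \<subseteq> X n \<and> (\<forall>x\<in>A. \<forall>y\<in>X n. glue e x y \<in> A)"
    by (auto simp: restrict_glue glue_X)
next
  assume A: "A \<subseteq> X n \<and> (\<forall>x\<in>A. \<forall>y\<in>X n. glue e x y \<in> A)"
  let ?E = "(\<lambda>x. restrict x e) ` A"
  have "x \<in> A" if "x \<in> X n" "a \<in> A" "restrict x e = restrict a e" for x a
  proof -
    have "x j = a j" if "j \<in> e" for j
      using fun_cong[OF \<open>restrict x e = restrict a e\<close>, of j] that by simp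
    then have "glue e a x = x" by (auto simp: glue_def)
    then show ?thesis using A that by metis
  qed
  then have "A = {x \<in> X n. restrict x e \<in> ?E}" using A by auto
  moreover have "?E \<subseteq> PiE e (V n)" using A restrict_X[OF _ assms] by blast
  ultimately show "A \<in> cylAlg J (V n) e" unfolding cylAlg_def X_def by blast
qed

lemma cyl_iff:
  "e \<subseteq> J \<Longrightarrow> S \<in> cyl e \<longleftrightarrow> (\<forall>n. S n \<subseteq> X n \<and> (\<forall>x\<in>S n. \<forall>y\<in>X n. glue e x y \<in> S n))"
  by (simp add: cyl_def cylAlg_iff)

lemma cyl_subset: "e \<subseteq> J \<Longrightarrow> S \<in> cyl e \<Longrightarrow> x \<in> S n \<Longrightarrow> x \<in> X n"
  by (auto simp: cyl_iff)

lemma glue_J: "x \<in> X n \<Longrightarrow> y \<in> X n \<Longrightarrow> glue J x y = x"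
  by (auto simp: X_def glue_def PiE_iff extensional_def)

lemma cyl_J: "cyl J = {S. \<forall>n. S n \<subseteq> X n}"
proof (intro set_eqI iffI)
  fix S assume "S \<in> cyl J"
  then show "S \<in> {S. \<forall>n. S n \<subseteq> X n}" by (auto dest: cyl_subset[OF order_refl])
next
  fix S assume S: "S \<in> {S. \<forall>n. S n \<subseteq> X n}"
  have "glue J x y \<in> S n" if "x \<in> S n" "y \<in> X n" for n x y
    using that S glue_J[of x n y] by fastforce
  then show "S \<in> cyl J" using S by (simp add: cyl_iff)
qed

lemma cyl_mono: "f \<subseteq> e \<Longrightarrow> e \<subseteq> J \<Longrightarrow> cyl f \<subseteq> cyl e"
proof
  fix S assume *: "f \<subseteq> e" "e \<subseteq> J" "S \<in> cyl f"
  have "glue e x y \<in> S n" if "x \<in> S n" "y \<in> X n" for n x y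
  proof -
    have "glue e x y \<in> X n" using that * by (auto intro!: glue_X simp: cyl_iff[of f] subset_iff)
    moreover have "glue f x (glue e x y) = glue e x y" using * by (auto simp: glue_def fun_eq_iff)
    ultimately show ?thesis using * that by (metis (no_types, lifting) cyl_iff order_trans)
  qed
  then show "S \<in> cyl e" using * by (auto simp: cyl_iff[of f] cyl_iff[of e])
qed

text \<open>The algebra is generated on sequences of sets and not on subsets of
  \<open>Omega\<close>. A member is thus a finite Boolean expression that can be evaluated at every
  finite level with the same generators.\<close>

inductive_set Alg :: "(nat \<Rightarrow> ('j \<Rightarrow> 'v) set) set \<Rightarrow> (nat \<Rightarrow> ('j \<Rightarrow> 'v) set) set"
  for G where
  base: "S \<in> G \<Longrightarrow> S \<in> Alg G"
| full: "X \<in> Alg G"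
| compl: "S \<in> Alg G \<Longrightarrow> (\<lambda>n. X n - S n) \<in> Alg G"
| int: "S \<in> Alg G \<Longrightarrow> T \<in> Alg G \<Longrightarrow> (\<lambda>n. S n \<inter> T n) \<in> Alg G"

lemma Alg_mono: "G \<subseteq> G' \<Longrightarrow> Alg G \<subseteq> Alg G'"
proof
  fix S assume "G \<subseteq> G'" "S \<in> Alg G"
  from this(2) show "S \<in> Alg G'"
    by induction (use \<open>G \<subseteq> G'\<close> in \<open>auto intro: Alg.intros\<close>)
qed

lemma Alg_level:
  assumes "S \<in> Alg G" "\<And>T. T \<in> G \<Longrightarrow> T n \<in> \<B>" "\<B> \<subseteq> Pow (X n)"
  shows "S n \<in> sigma_sets (X n) \<B>"
proof -
  interpret sigma_algebra "X n" "sigma_sets (X n) \<B>" by (rule sigma_algebra_sigma_sets[OF assms(3)])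
  show ?thesis using assms(1)
    by induction (use assms(2) in \<open>auto intro: sigma_sets.Basic\<close>)
qed

lemma sigma_sets_cylAlg:
  assumes e: "e \<subseteq> J" and S: "\<S> \<subseteq> cylAlg J (V n) e"
  shows "sigma_sets (X n) \<S> \<subseteq> cylAlg J (V n) e"
proof
  fix A assume "A \<in> sigma_sets (X n) \<S>"
  then show "A \<in> cylAlg J (V n) e"
  proof (induction rule: sigma_sets.induct)
    case (Basic a)
    then show ?case using S by auto
  next
    case Empty
    show ?case by (simp add: cylAlg_iff[OF e])
  next
    case (Compl a)
    have "glue e x y \<in> X n - a" if "x \<in> X n - a" "y \<in> X n" for x y
    proof -
      have "glue e (glue e x y) x = x" by (auto simp: glue_def)
      moreover have "glue e (glue e x y) x \<in> a" if "glue e x y \<in> a"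
        using Compl that \<open>x \<in> X n - a\<close> by (auto simp: cylAlg_iff[OF e])
      ultimately show ?thesis using that glue_X[of x n y e] by auto
    qed
    then show ?case by (auto simp: cylAlg_iff[OF e])
  next
    case (Union a)
    then show ?case unfolding cylAlg_iff[OF e] by blast
  qed
qed

lemma Alg_cyl:
  assumes "G \<subseteq> cyl e" "e \<subseteq> J"
  shows "Alg G \<subseteq> cyl e"
proof
  fix S assume S: "S \<in> Alg G"
  have "S n \<in> cylAlg J (V n) e" for n
  proof -
    have "cylAlg J (V n) e \<subseteq> Pow (X n)" using cylAlg_iff[OF assms(2)] by blast
    then have "S n \<in> sigma_sets (X n) (cylAlg J (V n) e)"
      using assms(1) by (intro Alg_level[OF S]) (auto simp: cyl_def)
    then show ?thesis using sigma_sets_cylAlg[OF assms(2) order_refl] by blast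
  qed
  then show "S \<in> cyl e" by (simp add: cyl_def)
qed

lemma Alg_subset: "G \<subseteq> cyl J \<Longrightarrow> S \<in> Alg G \<Longrightarrow> S n \<subseteq> X n"
  using Alg_cyl[of G J] cyl_J by auto

lemma intl_subset: "intl S \<subseteq> Omega"
  by (auto simp: intl_def)

lemma intl_X: "intl X = Omega"
  by (auto simp: intl_def Omega_def)

lemma intl_compl: "intl (\<lambda>n. X n - S n) = Omega - intl S"
proof -
  have "eventually (\<lambda>n. x n \<in> X n \<and> x n \<notin> S n) U \<longleftrightarrow> \<not> eventually (\<lambda>n. x n \<in> S n) U" if "x \<in> Omega" for x
    using that by (simp add: not_eventually_U Omega_def)
  then show ?thesis by (auto simp: intl_def)
qed

lemma intl_Int: "intl (\<lambda>n. S n \<inter> T n) = intl S \<inter> intl T"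
  by (auto simp: intl_def eventually_conj_iff)

lemma intl_le_iff: "intl S \<subseteq> intl T \<longleftrightarrow> eventually (\<lambda>n. S n \<inter> X n \<subseteq> T n) U"
proof
  assume *: "intl S \<subseteq> intl T"
  show "eventually (\<lambda>n. S n \<inter> X n \<subseteq> T n) U"
  proof (rule ccontr)
    assume "\<not> ?thesis"
    then have ev: "eventually (\<lambda>n. \<exists>x. x \<in> S n \<inter> X n - T n) U"
      unfolding not_eventually_U by (auto elim!: eventually_mono)
    define x where "x n = (if \<exists>x. x \<in> S n \<inter> X n - T n then SOME x. x \<in> S n \<inter> X n - T n else SOME x. x \<in> X n)" for n
    have x: "x n \<in> S n \<inter> X n - T n" if "\<exists>x. x \<in> S n \<inter> X n - T n" for n
      using someI_ex[OF that] that by (simp add: x_def)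
    have "x n \<in> X n" for n
    proof (cases "\<exists>x. x \<in> S n \<inter> X n - T n")
      case True then show ?thesis using x by auto
    next
      case False
      then show ?thesis using X_nonempty[of n] by (auto simp: x_def some_in_eq)
    qed
    then have "x \<in> Omega" by (simp add: Omega_def)
    moreover have "eventually (\<lambda>n. x n \<in> S n) U" "eventually (\<lambda>n. x n \<notin> T n) U"
      using ev x by (auto elim!: eventually_mono)
    ultimately show False using * not_eventually_U[of "\<lambda>n. x n \<in> T n"] by (auto simp: intl_def)
  qed
next
  assume "eventually (\<lambda>n. S n \<inter> X n \<subseteq> T n) U"
  then show "intl S \<subseteq> intl T"
    unfolding intl_def Omega_def by (auto simp: subset_iff elim: eventually_elim2)
qed

lemma intl_empty_iff: "intl S = {} \<longleftrightarrow> eventually (\<lambda>n. S n \<inter> X n = {}) U"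
proof -
  have "intl (\<lambda>_. {}) = {}" using not_eventually_U[of "\<lambda>_. True"] by (auto simp: intl_def)
  then show ?thesis using intl_le_iff[of S "\<lambda>_. {}"] by auto
qed

text \<open>This is what makes the internal content countably additive.\<close>

lemma saturation:
  fixes S :: "nat \<Rightarrow> nat \<Rightarrow> ('j \<Rightarrow> 'v) set"
  assumes "\<And>k. \<Inter>(intl ` S ` {..k}) \<noteq> {}"
  shows "(\<Inter>k. intl (S k)) \<noteq> {}"
proof -
  define T where "T k n = X n \<inter> (\<Inter>i\<le>k. S i n)" for k n
  have T: "eventually (\<lambda>n. T k n \<noteq> {}) U" for k
  proof -
    obtain x where x: "x \<in> \<Inter>(intl ` S ` {..k})" using assms[of k] by auto
    then have "eventually (\<lambda>n. \<forall>i\<in>{..k}. x n \<in> S i n) U"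
      by (subst eventually_ball_finite_distrib) (auto simp: intl_def)
    moreover have "x \<in> Omega" using x by (auto simp: intl_def)
    ultimately show ?thesis
      by (auto simp: T_def Omega_def elim!: eventually_mono)
  qed
  \<comment> \<open>At level \<open>n\<close> the point is taken from the longest nonempty initial
    intersection with index at most \<open>n\<close>. The bound by \<open>n\<close> makes the
    maximum exist, and for a fixed index it is harmless because \<open>U\<close> refines
    \<open>sequentially\<close>.\<close>
  define k where "k n = Max (insert 0 {k. k \<le> n \<and> T k n \<noteq> {}})" for n
  define x where "x n = (if T (k n) n \<noteq> {} then SOME x. x \<in> T (k n) n else SOME x. x \<in> X n)" for n
  have xT: "x n \<in> T (k n) n" if "T (k n) n \<noteq> {}" for n
    using that some_in_eq by (auto simp: x_def)
  have "x n \<in> X n" for n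
  proof (cases "T (k n) n = {}")
    case True then show ?thesis using X_nonempty[of n] by (simp add: x_def some_in_eq)
  next
    case False then show ?thesis using xT[of n] by (auto simp: T_def)
  qed
  then have \<Omega>: "x \<in> Omega" by (simp add: Omega_def)
  have "x \<in> intl (S i)" for i
  proof -
    have "eventually (\<lambda>n. n \<ge> i) U" using U_seq eventually_ge_at_top filter_leD by blast
    with T[of i] have "eventually (\<lambda>n. x n \<in> S i n) U"
    proof eventually_elim
      case (elim n)
      have "k n \<in> insert 0 {k. k \<le> n \<and> T k n \<noteq> {}}" unfolding k_def by (intro Max_in) auto
      moreover have ik: "i \<le> k n" unfolding k_def using elim by (intro Max_ge) auto
      ultimately have "T (k n) n \<noteq> {}" using elim by auto
      then show ?case using xT[of n] ik by (auto simp: T_def)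
    qed
    then show ?thesis using \<Omega> by (simp add: intl_def)
  qed
  then show ?thesis by auto
qed

section \<open>Loeb measures of weights\<close>

definition weight :: "(nat \<Rightarrow> ('j \<Rightarrow> 'v) \<Rightarrow> real) \<Rightarrow> bool" where
  "weight w \<longleftrightarrow> (\<forall>n. \<forall>x\<in>X n. 0 \<le> w n x) \<and> (\<exists>C. eventually (\<lambda>n. av n (w n) \<le> C) U)"

definition mass where
  "mass w S = ul (\<lambda>n. av n (\<lambda>x. indicator (S n) x * w n x))"
  for w :: "nat \<Rightarrow> ('j \<Rightarrow> 'v) \<Rightarrow> real"

lemma weighted_tendsto:
  assumes w: "weight w" and b: "\<And>n x. x \<in> X n \<Longrightarrow> \<bar>b n x\<bar> \<le> B"
  shows "((\<lambda>n. av n (\<lambda>x. b n x * w n x)) \<longlongrightarrow> ul (\<lambda>n. av n (\<lambda>x. b n x * w n x))) U"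
proof -
  obtain C where C: "eventually (\<lambda>n. av n (w n) \<le> C) U" and nn: "\<And>n x. x \<in> X n \<Longrightarrow> 0 \<le> w n x"
    using w by (auto simp: weight_def)
  obtain x0 where "x0 \<in> X 0" using X_nonempty[of 0] by blast
  then have B: "B \<ge> 0" using b[of x0 0] by auto
  show ?thesis
  proof (rule ul_tendsto[where C = "B * C"])
    show "eventually (\<lambda>n. \<bar>av n (\<lambda>x. b n x * w n x)\<bar> \<le> B * C) U"
      using C
    proof eventually_elim
      case (elim n)
      have "\<bar>av n (\<lambda>x. b n x * w n x)\<bar> \<le> av n (\<lambda>x. B * w n x)"
        using b nn by (intro order_trans[OF avg_abs_le] avg_mono) (auto simp: abs_mult intro!: mult_right_mono)
      also have "\<dots> \<le> B * C" using elim B by (simp add: avg_cmult mult_left_mono)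
      finally show ?case .
    qed
  qed
qed

lemma mass_tendsto: "weight w \<Longrightarrow> ((\<lambda>n. av n (\<lambda>x. indicator (S n) x * w n x)) \<longlongrightarrow> mass w S) U"
  unfolding mass_def by (rule weighted_tendsto[where B=1]) (auto simp: indicator_def)

lemma mass_nonneg: "weight w \<Longrightarrow> 0 \<le> mass w S"
  by (rule tendsto_lowerbound[OF mass_tendsto])
     (auto intro!: always_eventually avg_nonneg simp: weight_def U_nontrivial)

lemma mass_cong:
  assumes "weight w" "intl S = intl T" shows "mass w S = mass w T"
proof -
  have "eventually (\<lambda>n. S n \<inter> X n \<subseteq> T n) U" "eventually (\<lambda>n. T n \<inter> X n \<subseteq> S n) U"
    using assms by (simp_all flip: intl_le_iff)
  then have "eventually (\<lambda>n. av n (\<lambda>x. indicator (S n) x * w n x) = av n (\<lambda>x. indicator (T n) x * w n x)) U"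
    by eventually_elim (intro avg_cong, auto simp: indicator_def)
  then have "mass w T = mass w S"
    unfolding mass_def[of w T] by (rule ul_eqI[OF Lim_transform_eventually[OF mass_tendsto[OF assms(1)]]])
  then show ?thesis by (rule sym)
qed

lemma mass_disjoint_Un:
  assumes w: "weight w" and "intl S \<inter> intl T = {}"
  shows "mass w (\<lambda>n. S n \<union> T n) = mass w S + mass w T"
proof -
  have "eventually (\<lambda>n. (S n \<inter> T n) \<inter> X n = {}) U"
    using assms(2) by (simp flip: intl_Int intl_empty_iff)
  then have "eventually (\<lambda>n. av n (\<lambda>x. indicator (S n) x * w n x) + av n (\<lambda>x. indicator (T n) x * w n x)
      = av n (\<lambda>x. indicator (S n \<union> T n) x * w n x)) U"
    unfolding avg_add[symmetric] by eventually_elim (intro avg_cong, auto simp: indicator_def)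
  then have "((\<lambda>n. av n (\<lambda>x. indicator (S n \<union> T n) x * w n x)) \<longlongrightarrow> mass w S + mass w T) U"
    by (rule Lim_transform_eventually[rotated]) (intro tendsto_add mass_tendsto w)
  then show ?thesis unfolding mass_def by (rule ul_eqI)
qed

lemma intl_Un: "intl (\<lambda>n. S n \<union> T n) = intl S \<union> intl T"
proof -
  have "intl S \<union> intl T \<subseteq> intl (\<lambda>n. S n \<union> T n)"
    by (auto simp: intl_le_iff intro!: always_eventually)
  moreover have "intl (\<lambda>n. S n \<union> T n) \<subseteq> intl S \<union> intl T"
  proof
    fix x assume x: "x \<in> intl (\<lambda>n. S n \<union> T n)"
    show "x \<in> intl S \<union> intl T"
    proof (cases "eventually (\<lambda>n. x n \<in> S n) U")
      case False
      then have "eventually (\<lambda>n. x n \<notin> S n) U" by (simp add: not_eventually_U)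
      moreover have "eventually (\<lambda>n. x n \<in> S n \<union> T n) U" using x by (simp add: intl_def)
      ultimately have "eventually (\<lambda>n. x n \<in> T n) U" by eventually_elim auto
      then show ?thesis using x by (simp add: intl_def)
    qed (use x in \<open>auto simp: intl_def\<close>)
  qed
  ultimately show ?thesis by auto
qed

lemma algebra_intl: "algebra Omega (intl ` cyl J)"
proof (rule algebra_iff_Un[THEN iffD2], intro conjI ballI)
  show "intl ` cyl J \<subseteq> Pow Omega" using intl_subset by auto
  have "intl (\<lambda>_. {}) = {}" by (simp add: intl_empty_iff)
  then show "{} \<in> intl ` cyl J" by (auto simp: cyl_J image_iff intro!: exI[of _ "\<lambda>_. {}"])
  show "Omega - A \<in> intl ` cyl J" if "A \<in> intl ` cyl J" for A
    using that by (auto simp: cyl_J intl_compl[symmetric])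
  show "A \<union> B \<in> intl ` cyl J" if "A \<in> intl ` cyl J" "B \<in> intl ` cyl J" for A B
    using that by (auto simp: cyl_J intl_Un[symmetric] intro!: imageI)
qed

text \<open>Caratheodory's extension from the algebra of internal sets. Continuity at the empty set
  holds in a strong form: by saturation, a decreasing sequence of internal sets with empty
  intersection is eventually empty.\<close>

lemma loeb_exists:
  assumes w: "weight w"
  shows "\<exists>M. space M = Omega \<and> sets M = sigma_sets Omega (intl ` cyl J) \<and>
    (\<forall>S\<in>cyl J. emeasure M (intl S) = ennreal (mass w S))"
proof -
  interpret A: algebra Omega "intl ` cyl J" by (rule algebra_intl)
  \<comment> \<open>A subset of \<open>Omega\<close> can be internal through many sequences;
    \<open>mass_cong\<close> makes the value independent of the representative.\<close>
  define f where "f A = ennreal (mass w (SOME S. S \<in> cyl J \<and> intl S = A))" for A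
  have f: "f (intl S) = ennreal (mass w S)" if "S \<in> cyl J" for S
  proof -
    have "intl (SOME T. T \<in> cyl J \<and> intl T = intl S) = intl S"
      by (rule conjunct2[OF someI[of "\<lambda>T. T \<in> cyl J \<and> intl T = intl S", OF conjI[OF that refl]]])
    then have "mass w (SOME T. T \<in> cyl J \<and> intl T = intl S) = mass w S" by (rule mass_cong[OF w])
    then show ?thesis by (simp only: f_def)
  qed
  have pos: "positive (intl ` cyl J) f"
  proof -
    have "mass w (\<lambda>_. {}) = 0" unfolding mass_def by (rule ul_eqI) simp
    moreover have "intl (\<lambda>_. {}) = {}" by (simp add: intl_empty_iff)
    moreover have "(\<lambda>_. {}) \<in> cyl J" by (simp add: cyl_J)
    ultimately show ?thesis unfolding positive_def using f[of "\<lambda>_. {}"] by simp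
  qed
  have add: "additive (intl ` cyl J) f"
    unfolding additive_def
  proof clarify
    fix S T assume ST: "S \<in> cyl J" "T \<in> cyl J" "intl S \<inter> intl T = {}"
    have "(\<lambda>n. S n \<union> T n) \<in> cyl J" using ST by (auto simp: cyl_J)
    then show "f (intl S \<union> intl T) = f (intl S) + f (intl T)"
      using ST mass_disjoint_Un[OF w ST(3)] mass_nonneg[OF w]
      by (simp add: f intl_Un[symmetric])
  qed
  have cont: "(\<lambda>i. f (A i)) \<longlonglongrightarrow> 0"
    if A: "range A \<subseteq> intl ` cyl J" "decseq A" "(\<Inter>i. A i) = {}" for A
  proof -
    have "\<forall>i. \<exists>S. S \<in> cyl J \<and> A i = intl S" using A(1) by blast
    then obtain S where S: "\<And>i. S i \<in> cyl J" "\<And>i. A i = intl (S i)" by metis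
    have "\<exists>k. \<Inter>(intl ` S ` {..k}) = {}" using saturation[of S] A(3) S by auto
    then obtain k where k: "\<Inter>(intl ` S ` {..k}) = {}" by blast
    moreover have "A k \<subseteq> A i" if "i \<le> k" for i using A(2) that by (simp add: decseqD)
    ultimately have "A k = {}" using S by auto
    then have "A i = {}" if "i \<ge> k" for i using A(2) that by (metis decseqD subset_empty)
    then have "eventually (\<lambda>i. f (A i) = 0) sequentially"
      unfolding eventually_sequentially using pos by (intro exI[of _ k]) (simp add: positive_def)
    then show ?thesis by (rule tendsto_eventually)
  qed
  have "f A \<noteq> \<infinity>" if "A \<in> intl ` cyl J" for A
    using that f by auto
  then obtain \<mu> where \<mu>: "\<forall>s\<in>intl ` cyl J. \<mu> s = f s" "measure_space Omega (sigma_sets Omega (intl ` cyl J)) \<mu>"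
    using A.caratheodory_empty_continuous[OF pos add _ cont] by blast
  let ?M = "measure_of Omega (intl ` cyl J) \<mu>"
  have sub: "intl ` cyl J \<subseteq> Pow Omega" using intl_subset by auto
  have "emeasure ?M (intl S) = ennreal (mass w S)" if "S \<in> cyl J" for S
  proof -
    have "emeasure ?M (intl S) = \<mu> (intl S)"
      using \<mu>(2) sub that unfolding measure_space_def
      by (intro emeasure_measure_of) auto
    then show ?thesis using \<mu>(1) f that by simp
  qed
  then show ?thesis using sub by (intro exI[of _ ?M]) (simp add: space_measure_of)
qed

definition loeb :: "(nat \<Rightarrow> ('j \<Rightarrow> 'v) \<Rightarrow> real) \<Rightarrow> (nat \<Rightarrow> 'j \<Rightarrow> 'v) measure" where
  "loeb w = (SOME M. space M = Omega \<and> sets M = sigma_sets Omega (intl ` cyl J) \<and>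
    (\<forall>S\<in>cyl J. emeasure M (intl S) = ennreal (mass w S)))"

lemma
  assumes w: "weight w"
  shows space_loeb: "space (loeb w) = Omega"
    and sets_loeb: "sets (loeb w) = sigma_sets Omega (intl ` cyl J)"
    and emeasure_loeb: "S \<in> cyl J \<Longrightarrow> emeasure (loeb w) (intl S) = ennreal (mass w S)"
  using someI_ex[OF loeb_exists[OF w]] unfolding loeb_def by blast+

lemma measure_loeb: "weight w \<Longrightarrow> S \<in> cyl J \<Longrightarrow> measure (loeb w) (intl S) = mass w S"
  by (simp add: measure_def emeasure_loeb mass_nonneg)

lemma X_cyl: "X \<in> cyl J" by (simp add: cyl_J)

lemma finite_measure_loeb: "weight w \<Longrightarrow> finite_measure (loeb w)"
  using emeasure_loeb[OF _ X_cyl] by (intro finite_measureI) (simp add: space_loeb intl_X)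

section \<open>Generated sigma-algebras and approximation by internal sets\<close>

definition sg :: "(nat \<Rightarrow> ('j \<Rightarrow> 'v) set) set \<Rightarrow> (nat \<Rightarrow> 'j \<Rightarrow> 'v) measure" where
  "sg G = sigma Omega (intl ` Alg G)"

lemma space_sg [simp]: "space (sg G) = Omega"
  and sets_sg: "sets (sg G) = sigma_sets Omega (intl ` Alg G)"
proof -
  have "intl ` Alg G \<subseteq> Pow Omega" using intl_subset by auto
  then show "space (sg G) = Omega" "sets (sg G) = sigma_sets Omega (intl ` Alg G)"
    by (simp_all add: sg_def)
qed

lemma intl_in_sg: "S \<in> Alg G \<Longrightarrow> intl S \<in> sets (sg G)"
  by (auto simp: sets_sg)

lemma sets_sg_mono: "G \<subseteq> G' \<Longrightarrow> sets (sg G) \<subseteq> sets (sg G')"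
  unfolding sets_sg by (intro sigma_sets_mono') (use Alg_mono in blast)

lemma sets_sg_loeb: "G \<subseteq> cyl J \<Longrightarrow> weight w \<Longrightarrow> sets (sg G) \<subseteq> sets (loeb w)"
  unfolding sets_sg sets_loeb by (intro sigma_sets_mono') (use Alg_cyl[of G J] in blast)

lemma subalgebra_sg: "G \<subseteq> cyl J \<Longrightarrow> weight w \<Longrightarrow> subalgebra (loeb w) (sg G)"
  by (simp add: subalgebra_def space_loeb sets_sg_loeb)

lemma measurable_sg_loeb: "G \<subseteq> cyl J \<Longrightarrow> weight w \<Longrightarrow> f \<in> borel_measurable (sg G) \<Longrightarrow> f \<in> borel_measurable (loeb w)"
  using subalgebra_sg measurable_from_subalg by blast

lemma measurable_sg_mono: "G \<subseteq> G' \<Longrightarrow> f \<in> borel_measurable (sg G) \<Longrightarrow> f \<in> borel_measurable (sg G')"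
  using sets_sg_mono by (intro measurable_from_subalg[of "sg G'" "sg G"]) (simp_all add: subalgebra_def)

lemma Alg_Un: "S \<in> Alg G \<Longrightarrow> T \<in> Alg G \<Longrightarrow> G \<subseteq> cyl J \<Longrightarrow> (\<lambda>n. S n \<union> T n) \<in> Alg G"
proof -
  assume *: "S \<in> Alg G" "T \<in> Alg G" "G \<subseteq> cyl J"
  have "(\<lambda>n. X n - ((X n - S n) \<inter> (X n - T n))) \<in> Alg G"
    by (intro Alg.compl Alg.int *)
  moreover have "(\<lambda>n. X n - ((X n - S n) \<inter> (X n - T n))) = (\<lambda>n. S n \<union> T n)"
    using Alg_subset[OF *(3,1)] Alg_subset[OF *(3,2)] by (intro ext) blast
  ultimately show ?thesis by simp
qed

lemma Alg_empty: "(\<lambda>_. {}) \<in> Alg G"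
  using Alg.compl[OF Alg.full, of G] by simp

text \<open>The approximable sets form a \<open>\<sigma>\<close>-algebra. A countable union is cut
  to finitely many members at the cost of half the error, and the other half is shared among their
  approximations.\<close>

lemma sg_approx:
  assumes fM: "finite_measure M" and sub: "sets (sg G) \<subseteq> sets M" and G: "G \<subseteq> cyl J"
    and A: "A \<in> sets (sg G)" and "\<eta> > 0"
  shows "\<exists>S\<in>Alg G. measure M (sym_diff A (intl S)) < \<eta>"
proof -
  interpret M: finite_measure M by fact
  have "A \<in> sigma_sets Omega (intl ` Alg G)" using A by (simp add: sets_sg)
  then have "\<forall>\<eta>>0. \<exists>S\<in>Alg G. measure M (sym_diff A (intl S)) < \<eta>"
  proof (induction rule: sigma_sets.induct)
    case (Basic a)
    then obtain S where "S \<in> Alg G" "a = intl S" by auto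
    then show ?case by (auto intro!: bexI[of _ S])
  next
    case Empty
    have "intl (\<lambda>_. {}) = {}" by (simp add: intl_empty_iff)
    then show ?case using Alg_empty by (metis Un_Diff_cancel2 measure_empty sup_bot.right_neutral Diff_cancel)
  next
    case (Compl a)
    have eq: "sym_diff (Omega - a) (intl (\<lambda>n. X n - S n)) = sym_diff a (intl S)" for S
    proof -
      have "a \<subseteq> Omega" using sigma_sets_into_sp[OF _ Compl(1)] intl_subset by blast
      then show ?thesis using intl_subset[of S] by (auto simp: intl_compl)
    qed
    show ?case
    proof (intro allI impI)
      fix \<eta> :: real assume "\<eta> > 0"
      then obtain S where "S \<in> Alg G" "measure M (sym_diff a (intl S)) < \<eta>" using Compl(2) by blast
      then show "\<exists>T\<in>Alg G. measure M (sym_diff (Omega - a) (intl T)) < \<eta>"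
        by (intro bexI[of _ "\<lambda>n. X n - S n"] Alg.compl) (simp_all only: eq)
    qed
  next
    case (Union a)
    show ?case
    proof (intro allI impI)
      fix \<eta> :: real assume \<eta>: "\<eta> > 0"
      have aM: "a i \<in> sets M" for i using Union(1) sub by (auto simp: sets_sg)
      have IM: "intl S \<in> sets M" if "S \<in> Alg G" for S using that intl_in_sg sub by auto
      define B where "B k = (\<Union>i<k. a i)" for k
      have "(\<lambda>k. measure M (B k)) \<longlonglongrightarrow> measure M (\<Union>k. B k)"
        using aM by (intro M.finite_Lim_measure_incseq) (auto simp: B_def incseq_def intro: less_le_trans)
      moreover have UB: "(\<Union>k. B k) = (\<Union>i. a i)" by (auto simp: B_def)
      ultimately have "eventually (\<lambda>k. measure M (B k) > measure M (\<Union>i. a i) - \<eta>/2) sequentially"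
        using \<eta> by (intro order_tendstoD) auto
      then obtain k where k: "measure M (B k) > measure M (\<Union>i. a i) - \<eta>/2"
        by (auto simp: eventually_sequentially)
      have "measure M ((\<Union>i. a i) - B k) = measure M (\<Union>i. a i) - measure M (B k)"
        using aM UB by (intro M.finite_measure_Diff) (auto simp: B_def)
      with k have k: "measure M ((\<Union>i. a i) - B k) < \<eta>/2" by simp
      have "\<exists>S\<in>Alg G. measure M (sym_diff (a i) (intl S)) < \<eta> / (2 * (k+1))" for i
        using Union(2) \<eta> by simp
      then obtain S where S: "\<And>i. S i \<in> Alg G" "\<And>i. measure M (sym_diff (a i) (intl (S i))) < \<eta> / (2 * (k+1))"
        by metis
      define T where "T m = (\<lambda>n. \<Union>i<m. S i n)" for m
      have T: "T m \<in> Alg G \<and> intl (T m) = (\<Union>i<m. intl (S i))" for m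
      proof (induction m)
        case 0
        have "intl (\<lambda>_. {}) = {}" by (simp add: intl_empty_iff)
        then show ?case using Alg_empty by (simp add: T_def)
      next
        case (Suc m)
        have "T (Suc m) = (\<lambda>n. T m n \<union> S m n)" by (auto simp: T_def lessThan_Suc)
        then show ?case using Suc S(1) G Alg_Un[of "T m" G "S m"] by (auto simp: intl_Un lessThan_Suc)
      qed
      have SM: "sym_diff (a i) (intl (S i)) \<in> sets M" for i using aM IM S by auto
      have "sym_diff (\<Union>i. a i) (intl (T k)) \<subseteq> ((\<Union>i. a i) - B k) \<union> (\<Union>i<k. sym_diff (a i) (intl (S i)))"
        using T by (auto simp: B_def)
      then have "measure M (sym_diff (\<Union>i. a i) (intl (T k))) \<le> measure M (((\<Union>i. a i) - B k) \<union> (\<Union>i<k. sym_diff (a i) (intl (S i))))"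
        using aM SM by (intro M.finite_measure_mono) (auto simp: B_def)
      also have "\<dots> \<le> measure M ((\<Union>i. a i) - B k) + measure M (\<Union>i<k. sym_diff (a i) (intl (S i)))"
        using aM SM by (intro measure_Un_le) (auto simp: B_def)
      also have "measure M (\<Union>i<k. sym_diff (a i) (intl (S i))) \<le> (\<Sum>i<k. measure M (sym_diff (a i) (intl (S i))))"
        using SM by (intro measure_UNION_le) auto
      also have "\<dots> \<le> (\<Sum>i<k. \<eta> / (2 * (k+1)))" using S(2) by (intro sum_mono) (simp add: less_imp_le)
      also have "\<dots> = (real k / (k + 1)) * (\<eta>/2)" by (simp add: field_simps)
      also have "\<dots> \<le> 1 * (\<eta>/2)" using \<eta> by (intro mult_right_mono) auto
      finally show "\<exists>S\<in>Alg G. measure M (sym_diff (\<Union>i. a i) (intl S)) < \<eta>"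
        using k T by (intro bexI[of _ "T k"]) auto
    qed
  qed
  then show ?thesis using \<open>\<eta> > 0\<close> by blast
qed

end

section \<open>Standard parts and conditional independence\<close>

context loeb_setting
begin

definition i01 :: "(nat \<Rightarrow> ('j \<Rightarrow> 'v) \<Rightarrow> real) \<Rightarrow> bool" where
  "i01 b \<longleftrightarrow> (\<forall>n. \<forall>x\<in>X n. 0 \<le> b n x \<and> b n x \<le> 1)"

definition st :: "(nat \<Rightarrow> ('j \<Rightarrow> 'v) \<Rightarrow> real) \<Rightarrow> (nat \<Rightarrow> 'j \<Rightarrow> 'v) \<Rightarrow> real" where
  "st b x = ul (\<lambda>n. b n (x n))"

lemma i01_mult: "i01 a \<Longrightarrow> i01 b \<Longrightarrow> i01 (\<lambda>n x. a n x * b n x)"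
  by (auto simp: i01_def intro: mult_le_one)

lemma i01_prod: "(\<And>i. i \<in> I \<Longrightarrow> i01 (a i)) \<Longrightarrow> i01 (\<lambda>n x. \<Prod>i\<in>I. a i n x)"
  by (auto simp: i01_def intro!: prod_nonneg prod_le_1)

lemma st_tendsto:
  assumes "i01 b" "x \<in> Omega"
  shows "((\<lambda>n. b n (x n)) \<longlongrightarrow> st b x) U"
  unfolding st_def using assms
  by (intro ul_tendsto[where C=1] always_eventually) (auto simp: i01_def Omega_def)

lemma st_bounds:
  assumes "i01 b" "x \<in> Omega"
  shows "0 \<le> st b x" "st b x \<le> 1"
  using assms U_nontrivial
  by (auto intro!: tendsto_lowerbound[OF st_tendsto] tendsto_upperbound[OF st_tendsto] always_eventually
      simp: i01_def Omega_def)

lemma st_mult: "i01 a \<Longrightarrow> i01 b \<Longrightarrow> x \<in> Omega \<Longrightarrow> st (\<lambda>n x. a n x * b n x) x = st a x * st b x"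
  unfolding st_def[of "\<lambda>n x. a n x * b n x"] by (intro ul_eqI tendsto_mult st_tendsto)

lemma st_prod: "(\<And>i. i \<in> I \<Longrightarrow> i01 (a i)) \<Longrightarrow> x \<in> Omega \<Longrightarrow> st (\<lambda>n x. \<Prod>i\<in>I. a i n x) x = (\<Prod>i\<in>I. st (a i) x)"
  unfolding st_def[of "\<lambda>n x. \<Prod>i\<in>I. a i n x"] by (intro ul_eqI tendsto_prod st_tendsto)

lemma indicator_tendsto:
  assumes "x \<in> Omega"
  shows "((\<lambda>n. indicator (S n) (x n)) \<longlongrightarrow> (indicator (intl S) x :: real)) U"
proof (cases "x \<in> intl S")
  case True
  then have "eventually (\<lambda>n. indicator (S n) (x n) = (1::real)) U"
    unfolding intl_def by (auto simp: indicator_def elim: eventually_mono)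
  then show ?thesis using True by (simp add: tendsto_eventually)
next
  case False
  then have "eventually (\<lambda>n. x n \<notin> S n) U"
    using assms by (simp add: intl_def not_eventually_U)
  then have "eventually (\<lambda>n. indicator (S n) (x n) = (0::real)) U"
    by (auto simp: indicator_def elim: eventually_mono)
  then show ?thesis using False by (simp add: tendsto_eventually)
qed

section \<open>Step functions and transfer of averages to integrals\<close>

definition mkstep :: "nat \<Rightarrow> (nat \<Rightarrow> nat \<Rightarrow> ('j \<Rightarrow> 'v) set) \<Rightarrow> nat \<Rightarrow> ('j \<Rightarrow> 'v) \<Rightarrow> real" where
  "mkstep K S n x = (\<Sum>i<K. indicator (S i n) x) / real K"

text \<open>Equal coefficients \<open>1 / K\<close> are enough: quantization by thresholds brings
  every function with values in [0,1] to this form up to \<open>1 / K\<close>.\<close>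

definition Step :: "(nat \<Rightarrow> ('j \<Rightarrow> 'v) set) set \<Rightarrow> (nat \<Rightarrow> ('j \<Rightarrow> 'v) \<Rightarrow> real) set" where
  "Step G = {mkstep K S |K S. K > 0 \<and> (\<forall>i<K. S i \<in> Alg G)}"

lemma mkstep_bounds: "0 \<le> mkstep K S n x" "mkstep K S n x \<le> 1"
proof -
  have "(\<Sum>i<K. indicator (S i n) x) \<le> (\<Sum>i<K. 1::real)"
    by (intro sum_mono) (simp add: indicator_def)
  then show "mkstep K S n x \<le> 1" by (auto simp: mkstep_def divide_le_eq)
  show "0 \<le> mkstep K S n x" by (auto simp: mkstep_def intro!: divide_nonneg_nonneg sum_nonneg)
qed

lemma i01_Step: "s \<in> Step G \<Longrightarrow> i01 s"
  by (auto simp: Step_def i01_def mkstep_bounds)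

lemma st_mkstep: "x \<in> Omega \<Longrightarrow> st (mkstep K S) x = (\<Sum>i<K. indicator (intl (S i)) x) / real K"
  unfolding st_def mkstep_def
  by (cases "K = 0") (auto intro!: ul_eqI tendsto_divide tendsto_sum indicator_tendsto)

lemma st_Step_measurable:
  assumes "s \<in> Step G"
  shows "st s \<in> borel_measurable (sg G)"
proof -
  obtain K S where s: "s = mkstep K S" "\<And>i. i < K \<Longrightarrow> S i \<in> Alg G"
    using assms by (auto simp: Step_def)
  have "(\<lambda>x. (\<Sum>i<K. indicator (intl (S i)) x) / real K) \<in> borel_measurable (sg G)"
    using s by (intro borel_measurable_divide borel_measurable_sum borel_measurable_indicator intl_in_sg) auto
  then show ?thesis
    by (subst measurable_cong[where g="\<lambda>x. (\<Sum>i<K. indicator (intl (S i)) x) / real K"]) (auto simp: s st_mkstep)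
qed

definition lev :: "nat \<Rightarrow> (nat \<Rightarrow> ('j \<Rightarrow> 'v) \<Rightarrow> real) \<Rightarrow> nat \<Rightarrow> nat \<Rightarrow> ('j \<Rightarrow> 'v) set" where
  "lev K b i n = {x\<in>X n. real (Suc i) / real K \<le> b n x}"

lemma mkstep_lev:
  assumes "i01 b" "K > 0" "x \<in> X n"
  shows "\<bar>b n x - mkstep K (lev K b) n x\<bar> \<le> 1 / K"
proof -
  have "indicator (lev K b i n) x = (if real (Suc i) / real K \<le> b n x then 1 else (0::real))" for i
    using assms by (auto simp: lev_def indicator_def)
  then show ?thesis using quantization_error[of "b n x" K] assms by (simp add: mkstep_def i01_def)
qed

lemma st_lev:
  assumes "i01 b" "K > 0" "x \<in> Omega"
  shows "\<bar>st b x - st (mkstep K (lev K b)) x\<bar> \<le> 1 / K"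
proof (rule tendsto_upperbound)
  show "((\<lambda>n. \<bar>b n (x n) - mkstep K (lev K b) n (x n)\<bar>) \<longlongrightarrow> \<bar>st b x - st (mkstep K (lev K b)) x\<bar>) U"
    using assms by (intro tendsto_rabs tendsto_diff st_tendsto) (auto simp: i01_def mkstep_bounds)
  show "eventually (\<lambda>n. \<bar>b n (x n) - mkstep K (lev K b) n (x n)\<bar> \<le> 1 / K) U"
    using assms by (intro always_eventually allI mkstep_lev) (auto simp: Omega_def)
qed (rule U_nontrivial)

lemma st_measurable:
  assumes "i01 b" "\<And>K i. lev K b i \<in> Alg G"
  shows "st b \<in> borel_measurable (sg G)"
proof (rule borel_measurable_LIMSEQ_real)
  show "st (mkstep (Suc K) (lev (Suc K) b)) \<in> borel_measurable (sg G)" for K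
    using assms by (intro st_Step_measurable) (auto simp: Step_def)
  show "(\<lambda>K. st (mkstep (Suc K) (lev (Suc K) b)) x) \<longlonglongrightarrow> st b x" if "x \<in> space (sg G)" for x
  proof (rule LIM_zero_cancel, rule Lim_null_comparison)
    show "eventually (\<lambda>K. norm (st (mkstep (Suc K) (lev (Suc K) b)) x - st b x) \<le> 1 / real (Suc K)) sequentially"
      using st_lev[OF assms(1), of "Suc _" x] that by (intro always_eventually) (auto simp: abs_minus_commute)
    show "(\<lambda>K. 1 / real (Suc K)) \<longlonglongrightarrow> 0" using LIMSEQ_inverse_real_of_nat by (simp add: inverse_eq_divide)
  qed
qed

lemma lev_cyl:
  assumes "e \<subseteq> J" "\<And>n x y. x \<in> X n \<Longrightarrow> y \<in> X n \<Longrightarrow> b n (glue e x y) = b n x"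
  shows "lev K b i \<in> Alg (cyl e)"
  using assms by (intro Alg.base) (auto simp: cyl_iff lev_def glue_X)

lemma st_measurable_cyl:
  assumes "e \<subseteq> J" "i01 b" "\<And>n x y. x \<in> X n \<Longrightarrow> y \<in> X n \<Longrightarrow> b n (glue e x y) = b n x"
  shows "st b \<in> borel_measurable (sg (cyl e))"
  using assms by (intro st_measurable lev_cyl)

lemma st_measurable_J: "i01 b \<Longrightarrow> st b \<in> borel_measurable (sg (cyl J))"
  by (intro st_measurable_cyl) (auto simp: glue_J)

lemma integrable_bounded:
  fixes f :: "(nat \<Rightarrow> 'j \<Rightarrow> 'v) \<Rightarrow> real"
  assumes "weight w" "f \<in> borel_measurable (loeb w)" "\<And>x. x \<in> Omega \<Longrightarrow> \<bar>f x\<bar> \<le> B"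
  shows "integrable (loeb w) f"
  using assms finite_measure_loeb
  by (intro finite_measure.integrable_const_bound[where B=B]) (auto simp: space_loeb)

lemma integral_le_mass:
  fixes f :: "(nat \<Rightarrow> 'j \<Rightarrow> 'v) \<Rightarrow> real"
  assumes "weight w" "\<And>x. x \<in> Omega \<Longrightarrow> \<bar>f x\<bar> \<le> B" "B \<ge> 0"
  shows "\<bar>integral\<^sup>L (loeb w) f\<bar> \<le> B * mass w X"
proof (cases "integrable (loeb w) f")
  case True
  interpret finite_measure "loeb w" by (rule finite_measure_loeb) fact
  have "\<bar>integral\<^sup>L (loeb w) f\<bar> \<le> (\<integral>x. \<bar>f x\<bar> \<partial>loeb w)" by (rule integral_abs_bound)
  also have "\<dots> \<le> (\<integral>x. B \<partial>loeb w)"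
    using True assms by (intro integral_mono) (auto simp: space_loeb)
  also have "\<dots> = B * mass w X"
    using assms measure_loeb[OF assms(1) X_cyl] by (simp add: space_loeb intl_X)
  finally show ?thesis .
next
  case False
  then show ?thesis using assms mass_nonneg by (simp add: not_integrable_integral_eq)
qed

lemma integral_mkstep:
  assumes w: "weight w" and S: "\<And>i. i < K \<Longrightarrow> S i \<in> cyl J"
  shows "((\<lambda>n. av n (\<lambda>x. mkstep K S n x * w n x)) \<longlongrightarrow> integral\<^sup>L (loeb w) (st (mkstep K S))) U"
proof -
  interpret finite_measure "loeb w" by (rule finite_measure_loeb) fact
  have m: "intl (S i) \<in> sets (loeb w)" if "i < K" for i
    using S[OF that] by (auto simp: sets_loeb w)
  have "integral\<^sup>L (loeb w) (st (mkstep K S)) = (\<integral>x. (\<Sum>i<K. indicator (intl (S i)) x) / real K \<partial>loeb w)"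
    by (intro Bochner_Integration.integral_cong) (auto simp: space_loeb w st_mkstep)
  also have "\<dots> = (\<Sum>i<K. mass w (S i)) / real K"
  proof -
    have "integrable (loeb w) (indicator (intl (S i)) :: _ \<Rightarrow> real)" if "i < K" for i
      using m[OF that] by (simp add: emeasure_eq_measure)
    moreover have "intl T \<inter> Omega = intl T" for T using intl_subset by auto
    ultimately have "(\<integral>x. (\<Sum>i<K. indicator (intl (S i)) x) \<partial>loeb w) = (\<Sum>i<K. mass w (S i))"
      using S by (subst Bochner_Integration.integral_sum) (auto simp: measure_loeb w space_loeb)
    then show ?thesis by simp
  qed
  finally have I: "integral\<^sup>L (loeb w) (st (mkstep K S)) = (\<Sum>i<K. mass w (S i)) / real K" .
  have "av n (\<lambda>x. mkstep K S n x * w n x) = (\<Sum>i<K. av n (\<lambda>x. indicator (S i n) x * w n x)) / real K" for n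
    by (simp add: mkstep_def avg_sum[symmetric] avg_divide[symmetric] sum_distrib_right)
  then show ?thesis unfolding I
    by (cases "K = 0") (auto intro!: tendsto_divide tendsto_sum mass_tendsto w)
qed

lemma eq_if_close:
  fixes a b C :: real
  assumes "\<And>K::nat. K > 0 \<Longrightarrow> \<bar>a - b\<bar> \<le> C / real K"
  shows "a = b"
proof -
  have "(\<lambda>K. C * (1 / real (Suc K))) \<longlonglongrightarrow> C * 0"
    using LIMSEQ_inverse_real_of_nat by (intro tendsto_mult tendsto_const) (simp add: inverse_eq_divide)
  moreover have "\<bar>a - b\<bar> \<le> C * (1 / real (Suc K))" for K using assms[of "Suc K"] by simp
  ultimately have "\<bar>a - b\<bar> \<le> 0" by (intro tendsto_lowerbound[where F=sequentially]) (auto intro: always_eventually)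
  then show ?thesis by simp
qed

text \<open>The bridge from finite averages to the limit space. For step functions it is the
  definition of the Loeb measure, and quantizing \<open>b\<close> changes both sides by at most a
  constant over \<open>K\<close>.\<close>

lemma integral_st:
  assumes w: "weight w" and b: "i01 b"
  shows "((\<lambda>n. av n (\<lambda>x. b n x * w n x)) \<longlongrightarrow> integral\<^sup>L (loeb w) (st b)) U"
proof -
  let ?a = "\<lambda>n. av n (\<lambda>x. b n x * w n x)"
  have conv: "(?a \<longlongrightarrow> ul ?a) U"
    using b by (intro weighted_tendsto[OF w, where B=1]) (auto simp: i01_def)
  have nn: "\<And>n x. x \<in> X n \<Longrightarrow> 0 \<le> w n x" using w by (auto simp: weight_def)
  obtain C where C: "eventually (\<lambda>n. av n (w n) \<le> C) U" using w by (auto simp: weight_def)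
  have "ul ?a = integral\<^sup>L (loeb w) (st b)"
  proof (rule eq_if_close[where C="C + mass w X"])
    fix K :: nat assume K: "K > 0"
    let ?q = "mkstep K (lev K b)"
    have lev: "lev K b i \<in> cyl J" for i by (auto simp: lev_def cyl_J)
    have q: "i01 ?q" by (simp add: i01_def mkstep_bounds)
    have "\<bar>ul ?a - integral\<^sup>L (loeb w) (st ?q)\<bar> \<le> C / K"
    proof (rule tendsto_upperbound)
      show "((\<lambda>n. \<bar>?a n - av n (\<lambda>x. ?q n x * w n x)\<bar>) \<longlongrightarrow> \<bar>ul ?a - integral\<^sup>L (loeb w) (st ?q)\<bar>) U"
        by (intro tendsto_rabs tendsto_diff conv integral_mkstep w lev)
      show "eventually (\<lambda>n. \<bar>?a n - av n (\<lambda>x. ?q n x * w n x)\<bar> \<le> C / K) U"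
        using C
      proof eventually_elim
        case (elim n)
        have "\<bar>?a n - av n (\<lambda>x. ?q n x * w n x)\<bar> = \<bar>av n (\<lambda>x. (b n x - ?q n x) * w n x)\<bar>"
          by (simp add: avg_diff left_diff_distrib)
        also have "\<dots> \<le> av n (\<lambda>x. 1 / K * w n x)"
          using nn mkstep_lev[OF b K]
          by (intro order_trans[OF avg_abs_le] avg_mono) (auto simp: abs_mult simp del: times_divide_eq_left intro!: mult_right_mono)
        also have "\<dots> \<le> C / K" using elim K by (simp add: avg_divide divide_right_mono)
        finally show ?case .
      qed
    qed (rule U_nontrivial)
    moreover have "\<bar>integral\<^sup>L (loeb w) (st ?q) - integral\<^sup>L (loeb w) (st b)\<bar> \<le> 1 / K * mass w X"
    proof -
      have int: "integrable (loeb w) (st f)" if "i01 f" for f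
        using st_bounds[OF that] by (intro integrable_bounded[where B=1] measurable_sg_loeb[OF _ _ st_measurable_J] w that) auto
      have "integral\<^sup>L (loeb w) (st ?q) - integral\<^sup>L (loeb w) (st b) = (\<integral>x. st ?q x - st b x \<partial>loeb w)"
        using int b q by simp
      then show ?thesis
        using st_lev[OF b K] by (simp only:) (intro integral_le_mass w; simp add: abs_minus_commute)
    qed
    ultimately show "\<bar>ul ?a - integral\<^sup>L (loeb w) (st b)\<bar> \<le> (C + mass w X) / K"
      by (simp add: add_divide_distrib)
  qed
  then show ?thesis using conv by simp
qed

text \<open>\<open>g\<close> is quantized by its threshold sets, and each of these is replaced by an
  internal set. The second error is an average of the \<open>K\<close> set errors, so accuracy
  \<open>\<eta>/2\<close> for each set suffices whatever \<open>K\<close> is.\<close>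

lemma step_approx:
  fixes g :: "(nat \<Rightarrow> 'j \<Rightarrow> 'v) \<Rightarrow> real"
  assumes w: "weight w" and G: "G \<subseteq> cyl J"
    and g: "g \<in> borel_measurable (sg G)" "\<And>x. x \<in> Omega \<Longrightarrow> 0 \<le> g x \<and> g x \<le> 1" and "\<eta> > 0"
  shows "\<exists>s\<in>Step G. (\<integral>x. \<bar>g x - st s x\<bar> \<partial>loeb w) \<le> \<eta>"
proof -
  interpret finite_measure "loeb w" by (rule finite_measure_loeb) fact
  obtain K :: nat where K: "K > 0" "mass w X / K \<le> \<eta>/2"
  proof -
    obtain k :: nat where k: "mass w X / (\<eta>/2) < k" using reals_Archimedean2 by blast
    then have "mass w X \<le> (\<eta>/2) * real (Suc k)" using \<open>\<eta> > 0\<close> by (simp add: field_simps)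
    then show ?thesis by (intro that[of "Suc k"]) (auto simp: divide_le_eq mult.commute)
  qed
  define A where "A i = {x\<in>Omega. real (Suc i) / K \<le> g x}" for i
  have A: "A i \<in> sets (sg G)" for i
    using borel_measurable_le[OF borel_measurable_const g(1), of "real (Suc i) / K"] by (simp add: A_def)
  have "\<exists>S\<in>Alg G. measure (loeb w) (sym_diff (A i) (intl S)) < \<eta>/2" for i
    using \<open>\<eta> > 0\<close> by (intro sg_approx finite_measure_axioms sets_sg_loeb G w A) auto
  then obtain S where S: "\<And>i. S i \<in> Alg G" "\<And>i. measure (loeb w) (sym_diff (A i) (intl (S i))) < \<eta>/2"
    by metis
  have sets: "A i \<in> sets (loeb w)" "intl (S i) \<in> sets (loeb w)" for i
    using A intl_in_sg[OF S(1)] sets_sg_loeb[OF G w] by blast+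
  let ?s = "mkstep K S"
  have s: "?s \<in> Step G" using K S by (auto simp: Step_def)
  let ?D = "\<lambda>i x. indicator (sym_diff (A i) (intl (S i))) x :: real"
  have bound: "\<bar>g x - st ?s x\<bar> \<le> 1 / K + (\<Sum>i<K. ?D i x) / K" if x: "x \<in> Omega" for x
  proof -
    have "(if real (Suc i) / real K \<le> g x then 1 else 0) = (indicator (A i) x :: real)" for i
      using x by (auto simp: A_def indicator_def)
    then have "\<bar>g x - (\<Sum>i<K. indicator (A i) x) / K\<bar> \<le> 1 / K"
      using quantization_error[of "g x" K] g(2)[OF x] K by simp
    moreover have "\<bar>(\<Sum>i<K. indicator (A i) x) / K - st ?s x\<bar> \<le> (\<Sum>i<K. ?D i x) / K"
    proof -
      have "\<bar>(\<Sum>i<K. indicator (A i) x) - (\<Sum>i<K. indicator (intl (S i)) x)\<bar> \<le> (\<Sum>i<K. \<bar>indicator (A i) x - indicator (intl (S i)) x :: real\<bar>)"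
        unfolding sum_subtractf[symmetric] by (rule sum_abs)
      also have "\<dots> = (\<Sum>i<K. ?D i x)" by (intro sum.cong) (auto simp: indicator_def)
      finally show ?thesis using K x by (simp add: st_mkstep diff_divide_distrib[symmetric] divide_right_mono)
    qed
    ultimately show ?thesis by linarith
  qed
  have "(\<integral>x. \<bar>g x - st ?s x\<bar> \<partial>loeb w) \<le> (\<integral>x. 1 / K + (\<Sum>i<K. ?D i x) / K \<partial>loeb w)"
  proof (rule integral_mono)
    have meas: "(\<lambda>x. \<bar>g x - st ?s x\<bar>) \<in> borel_measurable (loeb w)"
      using measurable_sg_loeb[OF G w g(1)] measurable_sg_loeb[OF G w st_Step_measurable[OF s]] by measurable
    show "integrable (loeb w) (\<lambda>x. \<bar>g x - st ?s x\<bar>)"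
    proof (rule integrable_bounded[where B=1, OF w meas])
      fix x assume "x \<in> Omega"
      then show "\<bar>\<bar>g x - st ?s x\<bar>\<bar> \<le> 1" using g(2)[of x] st_bounds[OF i01_Step[OF s], of x] by auto
    qed
    show "integrable (loeb w) (\<lambda>x. 1 / K + (\<Sum>i<K. ?D i x) / K)"
      using sets by (intro Bochner_Integration.integrable_add integrable_divide Bochner_Integration.integrable_sum)
        (auto simp: emeasure_eq_measure)
  qed (use bound in \<open>simp add: space_loeb w\<close>)
  also have "\<dots> = mass w X / K + (\<Sum>i<K. measure (loeb w) (sym_diff (A i) (intl (S i)))) / K"
  proof -
    have m: "measure (loeb w) (space (loeb w)) = mass w X"
      using measure_loeb[OF w X_cyl] by (simp add: space_loeb w intl_X)
    have i: "integrable (loeb w) (?D i)" for i using sets by (auto simp: emeasure_eq_measure)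
    have "sym_diff (A i) (intl (S i)) \<inter> space (loeb w) = sym_diff (A i) (intl (S i))" for i
      using intl_subset by (auto simp: A_def space_loeb w)
    then show ?thesis using i by (simp add: m Bochner_Integration.integral_sum)
  qed
  also have "(\<Sum>i<K. measure (loeb w) (sym_diff (A i) (intl (S i)))) \<le> (\<Sum>i<K. \<eta>/2)"
    using S(2) by (intro sum_mono less_imp_le)
  also have "(\<Sum>i<K. \<eta>/2) / K = \<eta>/2" using K by simp
  finally have "(\<integral>x. \<bar>g x - st ?s x\<bar> \<partial>loeb w) \<le> mass w X / K + \<eta>/2"
    using K by (simp add: divide_right_mono)
  then have "(\<integral>x. \<bar>g x - st ?s x\<bar> \<partial>loeb w) \<le> \<eta>" using K(2) by linarith
  then show ?thesis using s by blast
qed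

section \<open>Conditional expectations and slices\<close>

definition is_ce where
  "is_ce w G h g \<longleftrightarrow> g \<in> borel_measurable (sg G) \<and> (\<forall>x\<in>Omega. 0 \<le> g x \<and> g x \<le> (1::real)) \<and>
    (\<forall>k\<in>borel_measurable (sg G). (\<forall>x\<in>Omega. 0 \<le> k x \<and> k x \<le> (1::real)) \<longrightarrow>
      (\<integral>x. h x * k x \<partial>loeb w) = (\<integral>x. g x * k x \<partial>loeb w))"

lemma is_ce_integral:
  "is_ce w G h g \<Longrightarrow> k \<in> borel_measurable (sg G) \<Longrightarrow> (\<And>x. x \<in> Omega \<Longrightarrow> 0 \<le> k x \<and> k x \<le> 1) \<Longrightarrow>
    (\<integral>x. h x * k x \<partial>loeb w) = (\<integral>x. g x * k x \<partial>loeb w)"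
  by (simp add: is_ce_def)

text \<open>The real conditional expectation lies in [0,1] only almost everywhere and is clipped,
  because the approximation by step functions asks for bounds at every point of
  \<open>Omega\<close>.\<close>

lemma ce_exists:
  assumes w: "weight w" and G: "G \<subseteq> cyl J"
    and h: "h \<in> borel_measurable (loeb w)" "\<And>x. x \<in> Omega \<Longrightarrow> 0 \<le> h x \<and> h x \<le> 1"
  shows "\<exists>g. is_ce w G h g"
proof -
  interpret finite_measure "loeb w" by (rule finite_measure_loeb) fact
  interpret finite_measure_subalgebra "loeb w" "sg G"
    by unfold_locales (rule subalgebra_sg[OF G w])
  define c where "c = real_cond_exp (loeb w) (sg G) h"
  define g where "g x = min 1 (max 0 (c x))" for x
  have c: "c \<in> borel_measurable (sg G)" by (simp add: c_def)
  then have g: "g \<in> borel_measurable (sg G)" unfolding g_def by measurable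
  have int: "integrable (loeb w) h" using h by (intro integrable_bounded[where B=1] w) auto
  have "AE x in loeb w. c x \<ge> 0" "AE x in loeb w. c x \<le> 1"
    unfolding c_def using h by (intro real_cond_exp_ge_c real_cond_exp_le_c int; auto simp: space_loeb w)+
  then have gc: "AE x in loeb w. c x = g x" by eventually_elim (simp add: g_def)
  have "(\<integral>x. h x * k x \<partial>loeb w) = (\<integral>x. g x * k x \<partial>loeb w)"
    if k: "k \<in> borel_measurable (sg G)" "\<forall>x\<in>Omega. 0 \<le> k x \<and> k x \<le> 1" for k
  proof -
    have kM: "k \<in> borel_measurable (loeb w)" using measurable_sg_loeb[OF G w k(1)] .
    have "integrable (loeb w) (\<lambda>x. k x * h x)"
      using h k kM by (intro integrable_bounded[where B=1] w borel_measurable_times) (auto simp: abs_mult intro!: mult_le_one)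
    then have "(\<integral>x. k x * c x \<partial>loeb w) = (\<integral>x. k x * h x \<partial>loeb w)"
      unfolding c_def using k h by (intro real_cond_exp_intg) auto
    moreover have "(\<integral>x. k x * c x \<partial>loeb w) = (\<integral>x. k x * g x \<partial>loeb w)"
      using gc kM measurable_sg_loeb[OF G w c] measurable_sg_loeb[OF G w g] by (intro integral_cong_AE) auto
    ultimately show ?thesis by (simp add: mult.commute)
  qed
  then have "is_ce w G h g" using g by (auto simp: is_ce_def g_def)
  then show ?thesis by blast
qed

lemma L1_mult_diff:
  fixes f g k :: "(nat \<Rightarrow> 'j \<Rightarrow> 'v) \<Rightarrow> real"
  assumes w: "weight w"
    and f: "f \<in> borel_measurable (loeb w)" "\<And>x. x \<in> Omega \<Longrightarrow> 0 \<le> f x \<and> f x \<le> 1"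
    and g: "g \<in> borel_measurable (loeb w)" "\<And>x. x \<in> Omega \<Longrightarrow> 0 \<le> g x \<and> g x \<le> 1"
    and k: "k \<in> borel_measurable (loeb w)" "\<And>x. x \<in> Omega \<Longrightarrow> 0 \<le> k x \<and> k x \<le> 1"
  shows "\<bar>(\<integral>x. f x * k x \<partial>loeb w) - (\<integral>x. g x * k x \<partial>loeb w)\<bar> \<le> (\<integral>x. \<bar>f x - g x\<bar> \<partial>loeb w)"
proof -
  have int: "integrable (loeb w) (\<lambda>x. f x * k x)" "integrable (loeb w) (\<lambda>x. g x * k x)"
    using f g k by (intro integrable_bounded[where B=1] w borel_measurable_times; auto simp: abs_mult intro!: mult_le_one)+
  have d: "\<bar>f x - g x\<bar> \<le> 1" if "x \<in> Omega" for x using f(2)[OF that] g(2)[OF that] by auto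
  have "\<bar>(\<integral>x. f x * k x \<partial>loeb w) - (\<integral>x. g x * k x \<partial>loeb w)\<bar> = \<bar>\<integral>x. (f x - g x) * k x \<partial>loeb w\<bar>"
    using int by (simp add: left_diff_distrib)
  also have "\<dots> \<le> (\<integral>x. \<bar>(f x - g x) * k x\<bar> \<partial>loeb w)" by (rule integral_abs_bound)
  also have "\<dots> \<le> (\<integral>x. \<bar>f x - g x\<bar> \<partial>loeb w)"
  proof (rule integral_mono)
    show "integrable (loeb w) (\<lambda>x. \<bar>(f x - g x) * k x\<bar>)" using int by (simp add: left_diff_distrib)
    show "integrable (loeb w) (\<lambda>x. \<bar>f x - g x\<bar>)"
      using f g d by (intro integrable_bounded[where B=1] w) auto
    show "\<bar>(f x - g x) * k x\<bar> \<le> \<bar>f x - g x\<bar>" if "x \<in> space (loeb w)" for x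
      using k(2)[of x] that by (auto simp: abs_mult space_loeb w intro!: mult_right_le_one_le)
  qed
  finally show ?thesis .
qed

abbreviation unit_weight :: "nat \<Rightarrow> ('j \<Rightarrow> 'v) \<Rightarrow> real" where "unit_weight \<equiv> \<lambda>_ _. 1"
abbreviation P :: "(nat \<Rightarrow> 'j \<Rightarrow> 'v) measure" where "P \<equiv> loeb unit_weight"

lemma weight_1: "weight unit_weight"
  by (auto simp: weight_def intro!: exI[of _ 1])

lemma cyl_glue_iff:
  assumes "e \<subseteq> J" "S \<in> cyl e" "x \<in> X n" "y \<in> X n"
  shows "glue e x y \<in> S n \<longleftrightarrow> x \<in> S n"
proof
  assume "glue e x y \<in> S n"
  then have "glue e (glue e x y) x \<in> S n" using assms by (auto simp: cyl_iff)
  moreover have "glue e (glue e x y) x = x" by (auto simp: glue_def)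
  ultimately show "x \<in> S n" by simp
qed (use assms in \<open>auto simp: cyl_iff\<close>)

lemma Step_glue:
  assumes "s \<in> Step G" "G \<subseteq> cyl e" "e \<subseteq> J" "x \<in> X n" "y \<in> X n"
  shows "s n (glue e x y) = s n x"
proof -
  obtain K S where s: "s = mkstep K S" "\<And>i. i < K \<Longrightarrow> S i \<in> cyl e"
    using assms(1) Alg_cyl[OF assms(2,3)] unfolding Step_def by blast
  then show ?thesis using assms by (auto simp: mkstep_def indicator_def cyl_glue_iff intro!: sum.cong)
qed

definition slice :: "'j set \<Rightarrow> (nat \<Rightarrow> 'j \<Rightarrow> 'v) \<Rightarrow> (nat \<Rightarrow> ('j \<Rightarrow> 'v) set) \<Rightarrow> nat \<Rightarrow> ('j \<Rightarrow> 'v) set" where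
  "slice e y S n = {x\<in>X n. glue e x (y n) \<in> S n}"

lemma slice_Alg:
  assumes "S \<in> Alg G" and G: "\<And>S. S \<in> G \<Longrightarrow> slice e y S \<in> Alg G'" and y: "y \<in> Omega"
  shows "slice e y S \<in> Alg G'"
  using assms(1)
proof induction
  case full
  have "slice e y X = X" using y by (auto simp: slice_def Omega_def glue_X)
  then show ?case by (simp add: Alg.full)
next
  case (compl S)
  have "slice e y (\<lambda>n. X n - S n) = (\<lambda>n. X n - slice e y S n)"
    using y by (auto simp: slice_def Omega_def glue_X)
  then show ?case using compl by (simp add: Alg.compl)
next
  case (int S T)
  have "slice e y (\<lambda>n. S n \<inter> T n) = (\<lambda>n. slice e y S n \<inter> slice e y T n)"
    by (auto simp: slice_def)
  then show ?case using int by (simp add: Alg.int)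
qed (use G in auto)

definition ub :: "((nat \<Rightarrow> 'j \<Rightarrow> 'v) \<Rightarrow> real) \<Rightarrow> bool" where
  "ub f \<longleftrightarrow> f \<in> borel_measurable P \<and> (\<forall>x\<in>Omega. 0 \<le> f x \<and> f x \<le> 1)"

lemma ub_st: "i01 b \<Longrightarrow> ub (st b)"
  using measurable_sg_loeb[OF order_refl weight_1 st_measurable_J] st_bounds by (simp add: ub_def)

lemma ub_sg: "G \<subseteq> cyl J \<Longrightarrow> f \<in> borel_measurable (sg G) \<Longrightarrow> (\<And>x. x \<in> Omega \<Longrightarrow> 0 \<le> f x \<and> f x \<le> 1) \<Longrightarrow> ub f"
  using measurable_sg_loeb[OF _ weight_1] by (simp add: ub_def)

lemma ub_mult: "ub f \<Longrightarrow> ub g \<Longrightarrow> ub (\<lambda>x. f x * g x)"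
  by (auto simp: ub_def intro: mult_le_one)

lemma ub_integrable: "ub f \<Longrightarrow> integrable P f"
  by (intro integrable_bounded[where B=1] weight_1) (auto simp: ub_def)

lemma ub_L1:
  assumes "ub f" "ub g" "ub k" "(\<integral>x. \<bar>f x - g x\<bar> \<partial>P) \<le> \<eta>"
  shows "\<bar>(\<integral>x. f x * k x \<partial>P) - (\<integral>x. g x * k x \<partial>P)\<bar> \<le> \<eta>"
    "\<bar>(\<integral>x. k x * f x \<partial>P) - (\<integral>x. k x * g x \<partial>P)\<bar> \<le> \<eta>"
  using L1_mult_diff[OF weight_1, of f g k] assms by (auto simp: ub_def mult.commute)

lemma ub_lim:
  assumes "i01 u" "i01 v"
  shows "((\<lambda>n. av n (\<lambda>x. u n x * v n x)) \<longlongrightarrow> (\<integral>x. st u x * st v x \<partial>P)) U"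
proof -
  have "(\<integral>x. st u x * st v x \<partial>P) = (\<integral>x. st (\<lambda>n x. u n x * v n x) x \<partial>P)"
    using assms by (intro Bochner_Integration.integral_cong) (auto simp: space_loeb weight_1 st_mult)
  then show ?thesis using integral_st[OF weight_1 i01_mult[OF assms]] by simp
qed

text \<open>Fixing the coordinates outside \<open>e\<close> turns a test function into one
  measurable with respect to the slices; the worst choice of these coordinates is again internal.\<close>

proposition ce_slices:
  fixes h g k :: "(nat \<Rightarrow> 'j \<Rightarrow> 'v) \<Rightarrow> real"
  assumes e: "e \<subseteq> J" and G: "G \<subseteq> cyl e" and GJ: "GJ \<subseteq> cyl J"
    and sl: "\<And>S y. S \<in> GJ \<Longrightarrow> y \<in> Omega \<Longrightarrow> slice e y S \<in> Alg G"
    and h: "h \<in> borel_measurable (sg (cyl e))" "\<And>x. x \<in> Omega \<Longrightarrow> 0 \<le> h x \<and> h x \<le> 1"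
    and g: "is_ce unit_weight G h g"
    and k: "k \<in> borel_measurable (sg GJ)" "\<And>x. x \<in> Omega \<Longrightarrow> 0 \<le> k x \<and> k x \<le> 1"
  shows "(\<integral>x. h x * k x \<partial>P) = (\<integral>x. g x * k x \<partial>P)"
\<comment> \<open>Six errors of size \<open>1 / K\<close>: one each for replacing \<open>h\<close>
  and \<open>g\<close> by step functions, two for replacing \<open>k\<close>, and two for comparing
  the step functions against the sliced test function.\<close>
proof (rule eq_if_close[where C=6])
  fix K :: nat assume K: "K > 0"
  define \<eta> where "\<eta> = 1 / real K"
  have \<eta>: "\<eta> > 0" using K by (simp add: \<eta>_def)
  have eJ: "cyl e \<subseteq> cyl J" using e by (simp add: cyl_mono)
  then have GcJ: "G \<subseteq> cyl J" using G by auto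
  have g': "g \<in> borel_measurable (sg G)" "\<And>x. x \<in> Omega \<Longrightarrow> 0 \<le> g x \<and> g x \<le> 1"
    using g by (auto simp: is_ce_def)
  obtain a where a: "a \<in> Step (cyl e)" "(\<integral>x. \<bar>h x - st a x\<bar> \<partial>P) \<le> \<eta>"
    using step_approx[OF weight_1 eJ h \<eta>] by blast
  obtain s where s: "s \<in> Step G" "(\<integral>x. \<bar>g x - st s x\<bar> \<partial>P) \<le> \<eta>"
    using step_approx[OF weight_1 GcJ g' \<eta>] by blast
  obtain t where t: "t \<in> Step GJ" "(\<integral>x. \<bar>k x - st t x\<bar> \<partial>P) \<le> \<eta>"
    using step_approx[OF weight_1 GJ k \<eta>] by blast
  note i = i01_Step[OF a(1)] i01_Step[OF s(1)] i01_Step[OF t(1)]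
  have u: "ub h" "ub g" "ub k" "ub (st a)" "ub (st s)" "ub (st t)"
    using ub_sg[OF eJ h] ub_sg[OF GcJ g'] ub_sg[OF GJ k] i ub_st by blast+
  define F where "F n y = av n (\<lambda>x. (a n x - s n x) * t n (glue e x y))" for n y
  have "\<exists>y. \<forall>n. y n \<in> X n \<and> \<bar>av n (\<lambda>x. (a n x - s n x) * t n x)\<bar> \<le> \<bar>F n (y n)\<bar>"
  proof (intro choice allI)
    fix n
    have "av n (\<lambda>x. (a n x - s n x) * t n x) = av n (\<lambda>x. av n (\<lambda>y. (a n (glue e x y) - s n (glue e x y)) * t n (glue e x y)))"
      by (rule av_glue[symmetric])
    also have "\<dots> = av n (\<lambda>x. av n (\<lambda>y. (a n x - s n x) * t n (glue e x y)))"
      using Step_glue[OF a(1) order_refl e] Step_glue[OF s(1) G e] by (intro avg_cong) simp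
    also have "\<dots> = av n (F n)" unfolding F_def by (rule avg_swap)
    finally have "\<bar>av n (\<lambda>x. (a n x - s n x) * t n x)\<bar> \<le> av n (\<lambda>y. \<bar>F n y\<bar>)" by (simp add: avg_abs_le)
    then show "\<exists>y. y \<in> X n \<and> \<bar>av n (\<lambda>x. (a n x - s n x) * t n x)\<bar> \<le> \<bar>F n y\<bar>"
      using avg_le_ex[of "X n" "\<lambda>y. \<bar>F n y\<bar>"] by (auto intro: order_trans)
  qed
  then obtain y where y: "\<And>n. y n \<in> X n" "\<And>n. \<bar>av n (\<lambda>x. (a n x - s n x) * t n x)\<bar> \<le> \<bar>F n (y n)\<bar>" by blast
  have y\<Omega>: "y \<in> Omega" using y by (simp add: Omega_def)
  obtain m S where tm: "t = mkstep m S" "m > 0" "\<And>i. i < m \<Longrightarrow> S i \<in> Alg GJ" using t(1) by (auto simp: Step_def)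
  \<comment> \<open>With the outside coordinates frozen at the worst \<open>y\<close>, the test
    function is a step function over slices, hence over \<open>G\<close>; against it the integrals
    of \<open>h\<close> and \<open>g\<close> agree.\<close>
  define t' where "t' = mkstep m (\<lambda>i. slice e y (S i))"
  have t': "t' \<in> Step G" unfolding t'_def Step_def using tm slice_Alg[OF _ sl[OF _ y\<Omega>] y\<Omega>] by blast
  have tt': "t n (glue e x (y n)) = t' n x" if "x \<in> X n" for n x
    using that by (simp add: tm t'_def mkstep_def slice_def indicator_def)
  have F: "F n (y n) = av n (\<lambda>x. a n x * t' n x) - av n (\<lambda>x. s n x * t' n x)" for n
    unfolding F_def avg_diff[symmetric] by (intro avg_cong) (simp add: tt' left_diff_distrib)
  have le: "\<bar>(\<integral>x. st a x * st t x \<partial>P) - (\<integral>x. st s x * st t x \<partial>P)\<bar> \<le> \<bar>(\<integral>x. st a x * st t' x \<partial>P) - (\<integral>x. st s x * st t' x \<partial>P)\<bar>"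
  proof (rule tendsto_le[OF U_nontrivial])
    show "((\<lambda>n. \<bar>av n (\<lambda>x. a n x * t n x) - av n (\<lambda>x. s n x * t n x)\<bar>) \<longlongrightarrow> \<bar>(\<integral>x. st a x * st t x \<partial>P) - (\<integral>x. st s x * st t x \<partial>P)\<bar>) U"
      by (intro tendsto_rabs tendsto_diff ub_lim i)
    show "((\<lambda>n. \<bar>F n (y n)\<bar>) \<longlongrightarrow> \<bar>(\<integral>x. st a x * st t' x \<partial>P) - (\<integral>x. st s x * st t' x \<partial>P)\<bar>) U"
      unfolding F by (intro tendsto_rabs tendsto_diff ub_lim i i01_Step[OF t'])
    show "eventually (\<lambda>n. \<bar>av n (\<lambda>x. a n x * t n x) - av n (\<lambda>x. s n x * t n x)\<bar> \<le> \<bar>F n (y n)\<bar>) U"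
      using y(2) by (intro always_eventually) (simp add: left_diff_distrib avg_diff)
  qed
  have eq: "(\<integral>x. h x * st t' x \<partial>P) = (\<integral>x. g x * st t' x \<partial>P)"
    using g st_Step_measurable[OF t'] st_bounds[OF i01_Step[OF t']] unfolding is_ce_def by simp
  have ut': "ub (st t')" using ub_st i01_Step[OF t'] by blast
  have "\<bar>(\<integral>x. st a x * st t x \<partial>P) - (\<integral>x. st s x * st t x \<partial>P)\<bar> \<le> 2 * \<eta>"
    using le eq ub_L1(1)[OF u(1,4) ut' a(2)] ub_L1(1)[OF u(2,5) ut' s(2)] by linarith
  moreover note ub_L1(1)[OF u(1,4,3) a(2)] ub_L1(1)[OF u(2,5,3) s(2)]
    ub_L1(2)[OF u(3,6,4) t(2)] ub_L1(2)[OF u(3,6,5) t(2)]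
  ultimately have "\<bar>(\<integral>x. h x * k x \<partial>P) - (\<integral>x. g x * k x \<partial>P)\<bar> \<le> 6 * \<eta>"
    unfolding abs_le_iff by linarith
  then show "\<bar>(\<integral>x. h x * k x \<partial>P) - (\<integral>x. g x * k x \<partial>P)\<bar> \<le> 6 / K" by (simp add: \<eta>_def)
qed

end

section \<open>Removal for null intersections\<close>

context loeb_setting
begin

text \<open>A Boolean expression is finite; this is the origin of the bound on the sizes of the
  \<open>\<sigma>\<close>-algebras.\<close>

lemma Alg_finite_generators:
  assumes "S \<in> Alg G"
  shows "\<exists>G0\<subseteq>G. finite G0 \<and> S \<in> Alg G0"
  using assms
proof induction
  case (base S)
  then show ?case by (intro exI[of _ "{S}"]) (auto intro: Alg.base)
next
  case full
  then show ?case by (intro exI[of _ "{}"]) (auto intro: Alg.full)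
next
  case (compl S)
  then obtain G0 where "G0 \<subseteq> G" "finite G0" "S \<in> Alg G0" by blast
  then show ?case by (intro exI[of _ G0]) (simp add: Alg.compl)
next
  case (int S T)
  then obtain G1 G2 where "G1 \<subseteq> G" "finite G1" "S \<in> Alg G1" "G2 \<subseteq> G" "finite G2" "T \<in> Alg G2" by blast
  then show ?case using Alg_mono[of G1 "G1 \<union> G2"] Alg_mono[of G2 "G1 \<union> G2"]
    by (intro exI[of _ "G1 \<union> G2"]) (auto intro!: Alg.int)
qed

lemma Alg_Alg: "S \<in> Alg G \<Longrightarrow> (\<And>T. T \<in> G \<Longrightarrow> T \<in> Alg G') \<Longrightarrow> S \<in> Alg G'"
  by (induction rule: Alg.induct) (auto intro: Alg.intros)

lemma Alg_finite_Inter: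
  assumes "finite I" "\<And>i. i \<in> I \<Longrightarrow> S i \<in> Alg G"
  shows "(\<lambda>n. {x\<in>X n. \<forall>i\<in>I. x \<in> S i n}) \<in> Alg G"
  using assms
proof (induction I rule: finite_induct)
  case empty
  then show ?case using Alg.full[of G] by simp
next
  case (insert i I)
  have "(\<lambda>n. {x\<in>X n. \<forall>i\<in>insert i I. x \<in> S i n}) = (\<lambda>n. S i n \<inter> {x\<in>X n. \<forall>i\<in>I. x \<in> S i n})" by auto
  then show ?case using insert by (simp add: Alg.int)
qed

lemma intl_finite_Inter:
  assumes "finite I"
  shows "intl (\<lambda>n. {x\<in>X n. \<forall>i\<in>I. x \<in> S i n}) = {x\<in>Omega. \<forall>i\<in>I. x \<in> intl (S i)}"
  using assms
proof (induction I rule: finite_induct)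
  case empty
  then show ?case using intl_X by simp
next
  case (insert i I)
  have "(\<lambda>n. {x\<in>X n. \<forall>i\<in>insert i I. x \<in> S i n}) = (\<lambda>n. S i n \<inter> {x\<in>X n. \<forall>i\<in>I. x \<in> S i n})" by auto
  then show ?case using insert by (auto simp: intl_Int)
qed

section \<open>Cylinders of bounded order\<close>

definition gens :: "nat \<Rightarrow> 'j set \<Rightarrow> (nat \<Rightarrow> ('j \<Rightarrow> 'v) set) set" where
  "gens k e = (\<Union>g\<in>{g. g \<subseteq> e \<and> card g \<le> k}. cyl g)"

lemma gens_cyl: "e \<subseteq> J \<Longrightarrow> gens k e \<subseteq> cyl e"
  using cyl_mono unfolding gens_def by blast

lemma gens_cyl_J: "e \<subseteq> J \<Longrightarrow> gens k e \<subseteq> cyl J"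
  using gens_cyl cyl_mono[of e J] by blast

lemma gens_mono: "e \<subseteq> e' \<Longrightarrow> k \<le> k' \<Longrightarrow> gens k e \<subseteq> gens k' e'"
  unfolding gens_def by (rule UN_mono) auto

text \<open>Freezing the coordinates outside \<open>e\<close> leaves a condition on
  \<open>g \<inter> e\<close> only. If \<open>g\<close> is not contained in \<open>e\<close> the
  order drops, and this is what conditional independence of cylinders amounts to here.\<close>

lemma slice_cyl:
  assumes "g \<subseteq> J" "S \<in> cyl g" "y \<in> Omega"
  shows "slice e y S \<in> cyl (g \<inter> e)"
proof -
  have "glue (g \<inter> e) x z \<in> slice e y S n" if x: "x \<in> slice e y S n" and z: "z \<in> X n" for n x z
  proof -
    have y: "y n \<in> X n" using assms by (simp add: Omega_def)
    have xX: "x \<in> X n" and xS: "glue e x (y n) \<in> S n" using x by (auto simp: slice_def)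
    have "glue e (glue (g \<inter> e) x z) (y n) = glue g (glue e x (y n)) (glue e (glue (g \<inter> e) x z) (y n))"
      by (auto simp: glue_def)
    moreover have "glue e (glue (g \<inter> e) x z) (y n) \<in> X n" using xX y z by (intro glue_X)
    ultimately have "glue e (glue (g \<inter> e) x z) (y n) \<in> S n" using assms xS by (metis cyl_iff)
    then show ?thesis using xX z by (auto simp: slice_def intro: glue_X)
  qed
  moreover have "g \<inter> e \<subseteq> J" using assms by auto
  ultimately show ?thesis by (auto simp: cyl_iff slice_def)
qed

lemma slice_id:
  assumes "e \<subseteq> J" "S \<in> cyl e" "y \<in> Omega"
  shows "slice e y S = S"
proof
  fix n
  have "y n \<in> X n" using assms by (simp add: Omega_def)
  then show "slice e y S n = S n"
    using assms cyl_subset[OF assms(1,2)] by (auto simp: slice_def cyl_glue_iff)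
qed

lemma slice_gens:
  assumes "S \<in> gens k J" "y \<in> Omega"
  shows "slice e y S \<in> gens k e"
proof -
  obtain g where g: "g \<subseteq> J" "card g \<le> k" "S \<in> cyl g" using assms by (auto simp: gens_def)
  have "card (g \<inter> e) \<le> k" using g finite_J by (meson card_mono finite_subset inf_le1 order_trans)
  then show ?thesis using slice_cyl[OF g(1,3) assms(2), of e] by (auto simp: gens_def)
qed

lemma slice_cyl_gens:
  assumes "f \<subseteq> J" "S \<in> cyl f" "card f = Suc k" "\<not> f \<subseteq> e" "y \<in> Omega"
  shows "slice e y S \<in> gens k e"
proof -
  have "f \<inter> e \<subset> f" using assms by auto
  then have "card (f \<inter> e) < card f" using assms finite_J by (meson finite_subset psubset_card_mono)
  then show ?thesis using slice_cyl[OF assms(1,2,5), of e] assms by (auto simp: gens_def)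
qed

text \<open>Only the intersection of \<open>\<phi>\<close> with \<open>C\<close> matters, so a
  single \<open>\<phi>\<close> prescribes compatible atoms of many families \<open>C\<close> at
  once.\<close>

definition atom :: "(nat \<Rightarrow> ('j \<Rightarrow> 'v) set) set \<Rightarrow> (nat \<Rightarrow> ('j \<Rightarrow> 'v) set) set \<Rightarrow> nat \<Rightarrow> ('j \<Rightarrow> 'v) set" where
  "atom C \<phi> n = {x\<in>X n. \<forall>S\<in>C. x \<in> (if S \<in> \<phi> then S n else X n - S n)}"

lemma atom_Alg:
  assumes "finite C"
  shows "atom C \<phi> \<in> Alg C"
proof -
  have "(\<lambda>n. if S \<in> \<phi> then S n else X n - S n) \<in> Alg C" if "S \<in> C" for S
    using that by (cases "S \<in> \<phi>") (simp_all add: Alg.base Alg.compl)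
  from Alg_finite_Inter[of C "\<lambda>S n. if S \<in> \<phi> then S n else X n - S n", OF assms this]
  show ?thesis unfolding atom_def .
qed

lemma intl_atom:
  assumes "finite C"
  shows "intl (atom C \<phi>) = {x\<in>Omega. \<forall>S\<in>C. x \<in> intl S \<longleftrightarrow> S \<in> \<phi>}"
proof -
  have "intl (\<lambda>n. if S \<in> \<phi> then S n else X n - S n) = (if S \<in> \<phi> then intl S else Omega - intl S)" for S
    by (simp add: intl_compl)
  then show ?thesis unfolding atom_def
    using intl_finite_Inter[OF assms, of "\<lambda>S n. if S \<in> \<phi> then S n else X n - S n"] by auto
qed

text \<open>On an atom each generator in \<open>C\<close> is either everything or empty, so its
  trace is already that of a set built from \<open>G\<close>.\<close>

lemma trace_sg:
  assumes C: "finite C" and D: "D \<in> sets (sg (G \<union> C))"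
  shows "\<exists>S\<in>sets (sg G). D \<inter> intl (atom C \<phi>) = S \<inter> intl (atom C \<phi>)"
proof -
  let ?A = "intl (atom C \<phi>)"
  have A\<Omega>: "?A \<subseteq> Omega" by (rule intl_subset)
  have base: "\<exists>S\<in>sets (sg G). intl T \<inter> ?A = S \<inter> ?A" if "T \<in> Alg (G \<union> C)" for T
    using that
  proof induction
    case (base S)
    show ?case
    proof (cases "S \<in> G")
      case True
      then show ?thesis using intl_in_sg[OF Alg.base] by blast
    next
      case False
      then have "S \<in> C" using base by auto
      then have "intl S \<inter> ?A = (if S \<in> \<phi> then Omega else {}) \<inter> ?A"
        using intl_subset[of S] by (auto simp: intl_atom[OF C])
      moreover have "(if S \<in> \<phi> then Omega else {}) \<in> sets (sg G)"
        using sets.top[of "sg G"] by auto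
      ultimately show ?thesis by blast
    qed
  next
    case full
    then show ?case using sets.top[of "sg G"] by (auto simp: intl_X)
  next
    case (compl S)
    then obtain T where T: "T \<in> sets (sg G)" "intl S \<inter> ?A = T \<inter> ?A" by blast
    then have "(Omega - intl S) \<inter> ?A = (Omega - T) \<inter> ?A" by blast
    moreover have "Omega - T \<in> sets (sg G)" using sets.compl_sets[OF T(1)] by simp
    ultimately show ?case unfolding intl_compl by blast
  next
    case (int S T)
    then obtain S' T' where *: "S' \<in> sets (sg G)" "intl S \<inter> ?A = S' \<inter> ?A" "T' \<in> sets (sg G)" "intl T \<inter> ?A = T' \<inter> ?A" by blast
    then have "(intl S \<inter> intl T) \<inter> ?A = (S' \<inter> T') \<inter> ?A" by blast
    then show ?case unfolding intl_Int using * by blast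
  qed
  have "D \<in> sigma_sets Omega (intl ` Alg (G \<union> C))" using D by (simp add: sets_sg)
  then show ?thesis
  proof (induction rule: sigma_sets.induct)
    case (Basic a)
    then show ?case using base by auto
  next
    case Empty
    then show ?case by blast
  next
    case (Compl a)
    then obtain T where T: "T \<in> sets (sg G)" "a \<inter> ?A = T \<inter> ?A" by blast
    then have "(Omega - a) \<inter> ?A = (Omega - T) \<inter> ?A" by blast
    moreover have "Omega - T \<in> sets (sg G)" using sets.compl_sets[OF T(1)] by simp
    ultimately show ?case by blast
  next
    case (Union a)
    then obtain T where T: "\<And>i. T i \<in> sets (sg G)" "\<And>i. a i \<inter> ?A = T i \<inter> ?A" by metis
    then have "(\<Union>i. a i) \<inter> ?A = (\<Union>i. T i) \<inter> ?A" by blast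
    moreover have "(\<Union>i. T i) \<in> sets (sg G)" using T(1) by blast
    ultimately show ?case by blast
  qed
qed

lemma prob_P: "measure P Omega = 1"
proof -
  have "mass unit_weight X = 1" unfolding mass_def by (rule ul_eqI) (auto intro!: tendsto_eventually always_eventually trans[OF avg_cong av_const])
  then show ?thesis using measure_loeb[OF weight_1 X_cyl] by (simp add: intl_X)
qed

sublocale P: finite_measure P by (rule finite_measure_loeb[OF weight_1])

lemma sets_sg_P: "G \<subseteq> cyl J \<Longrightarrow> A \<in> sets (sg G) \<Longrightarrow> A \<in> sets P"
  using sets_sg_loeb[OF _ weight_1] by blast

lemma ub_indicator: "A \<in> sets P \<Longrightarrow> ub (indicator A)"
  by (auto simp: ub_def indicator_def)

lemma integral_indicator_mult: "A \<in> sets P \<Longrightarrow> B \<in> sets P \<Longrightarrow> (\<integral>x. indicator A x * indicator B x \<partial>P) = measure P (A \<inter> B)"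
  by (simp add: indicator_inter_arith[symmetric] sets.sets_into_space Int_absorb2)

lemma ce_null_support:
  assumes q: "ub q" and R: "R \<in> sets P" and z: "(\<integral>x. q x * indicator R x \<partial>P) = 0"
  shows "measure P ({x\<in>Omega. q x > 0} \<inter> R) = 0"
proof -
  have int: "integrable P (\<lambda>x. q x * indicator R x)"
    using ub_integrable[OF ub_mult[OF q ub_indicator[OF R]]] .
  have qm: "q \<in> borel_measurable P" using q by (simp add: ub_def)
  have "AE x in P. q x * indicator R x = 0"
    using z int q by (subst (asm) integral_nonneg_eq_0_iff_AE) (auto simp: ub_def space_loeb weight_1 intro!: AE_I2)
  then have "AE x in P. x \<notin> {x\<in>Omega. q x > 0} \<inter> R" by eventually_elim auto
  moreover have "{x\<in>Omega. q x > 0} \<in> sets P"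
    using borel_measurable_less[OF borel_measurable_const qm, of 0] by (simp add: space_loeb weight_1)
  ultimately have "{x\<in>Omega. q x > 0} \<inter> R \<in> null_sets P"
    using R by (subst AE_iff_null_sets) auto
  then show ?thesis by (rule measure_eq_0_null_sets)
qed

lemma superlevel_sg: "q \<in> borel_measurable (sg G) \<Longrightarrow> {x\<in>Omega. q x > (c::real)} \<in> sets (sg G)"
  using borel_measurable_less[OF borel_measurable_const, of q "sg G" c] by simp

lemma ce_ub: "is_ce unit_weight G h g \<Longrightarrow> G \<subseteq> cyl J \<Longrightarrow> ub g"
  by (auto simp: is_ce_def intro: ub_sg)

lemma ce_indicator_eq:
  assumes "is_ce unit_weight G h g" "D \<in> sets (sg G)"
  shows "(\<integral>x. h x * indicator D x \<partial>P) = (\<integral>x. g x * indicator D x \<partial>P)"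
proof -
  have "(indicator D :: _ \<Rightarrow> real) \<in> borel_measurable (sg G)" using assms by simp
  then show ?thesis using assms unfolding is_ce_def by (auto simp: indicator_def)
qed

lemma ce_slices_indicator:
  assumes "e \<subseteq> J" "G \<subseteq> cyl e" "GJ \<subseteq> cyl J"
    and "\<And>S y. S \<in> GJ \<Longrightarrow> y \<in> Omega \<Longrightarrow> slice e y S \<in> Alg G"
    and A: "A \<in> sets (sg (cyl e))" and g: "is_ce unit_weight G (indicator A) g" and D: "D \<in> sets (sg GJ)"
  shows "(\<integral>x. indicator A x * indicator D x \<partial>P) = (\<integral>x. g x * indicator D x \<partial>P)"
proof (rule ce_slices[OF assms(1-4) _ _ g])
  show "indicator A \<in> borel_measurable (sg (cyl e))" using A by (rule borel_measurable_indicator)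
  show "indicator D \<in> borel_measurable (sg GJ)" using D by (rule borel_measurable_indicator)
qed (simp_all add: indicator_def)

text \<open>With \<open>ce_null_support\<close> this permits exchanging a set for the support of its
  conditional expectation: the support contains the set up to measure 0, and it meets
  \<open>R\<close> in measure 0 as soon as \<open>q\<close> has integral 0 over
  \<open>R\<close>.\<close>

lemma ce_support:
  assumes A: "A \<in> sets P" and G: "G \<subseteq> cyl J" and q: "is_ce unit_weight G (indicator A) q"
  shows "measure P (A - {x\<in>Omega. q x > 0}) = 0"
proof -
  let ?Z = "Omega - {x\<in>Omega. q x > 0}"
  have Z: "?Z \<in> sets (sg G)"
    using q superlevel_sg sets.compl_sets[of "{x\<in>Omega. q x > 0}" "sg G"] by (auto simp: is_ce_def)
  have "measure P (A \<inter> ?Z) = (\<integral>x. q x * indicator ?Z x \<partial>P)"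
    using ce_indicator_eq[OF q Z] integral_indicator_mult[OF A sets_sg_P[OF G Z]] by simp
  also have "\<dots> = (\<integral>x. 0 \<partial>P)"
    using q by (intro Bochner_Integration.integral_cong) (auto simp: is_ce_def indicator_def space_loeb weight_1 not_less intro: antisym)
  also have "A \<inter> ?Z = A - {x\<in>Omega. q x > 0}"
    using sets.sets_into_space[OF A] by (auto simp: space_loeb weight_1)
  finally show ?thesis by simp
qed

text \<open>Comparing \<open>E\<close> with the internal set of \<open>F\<close>, over which
  \<open>g\<close> and the indicator of \<open>E\<close> have equal integrals, shows that
  \<open>1 - g\<close> has integral at most \<open>2 * \<eta>\<close> over \<open>E\<close>. On the
  unpopular part of \<open>E\<close> the integrand is at least \<open>c\<close>.\<close>

lemma popular_set_approx:
  assumes E: "E \<in> sets P" and G: "G \<subseteq> cyl J" and F: "F \<in> Alg G"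
    and EF: "measure P (sym_diff E (intl F)) \<le> \<eta>" and g: "is_ce unit_weight G (indicator E) g" and c: "c > 0"
  shows "measure P (E - {x\<in>Omega. g x > 1 - c}) * c \<le> 2 * \<eta>"
proof -
  let ?F = "intl F" and ?D = "E - {x\<in>Omega. g x > 1 - c}"
  have FG: "?F \<in> sets (sg G)" using F by (rule intl_in_sg)
  then have FP: "?F \<in> sets P" using sets_sg_P G by blast
  have gG: "g \<in> borel_measurable (sg G)" and g01: "\<And>x. x \<in> Omega \<Longrightarrow> 0 \<le> g x \<and> g x \<le> 1" using g by (auto simp: is_ce_def)
  have ug: "ub g" using ub_sg[OF G gG g01] .
  note uE = ub_indicator[OF E] and uF = ub_indicator[OF FP]
  have DP: "?D \<in> sets P" using E superlevel_sg[OF gG] sets_sg_P[OF G] by blast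
  have "(\<integral>x. \<bar>indicator E x - indicator ?F x :: real\<bar> \<partial>P) = (\<integral>x. indicator (sym_diff E ?F) x \<partial>P)"
    by (intro Bochner_Integration.integral_cong) (auto simp: indicator_def)
  also have "\<dots> = measure P (sym_diff E ?F)"
    using sets.sets_into_space[of "sym_diff E ?F" P] E FP by (simp add: Int_absorb2)
  finally have L: "(\<integral>x. \<bar>indicator E x - indicator ?F x :: real\<bar> \<partial>P) \<le> \<eta>" using EF by simp
  have "(\<integral>x. indicator E x * indicator ?F x \<partial>P) = (\<integral>x. g x * indicator ?F x \<partial>P)"
    by (rule ce_indicator_eq[OF g FG])
  with ub_L1(2)[OF uE uF ug L] ub_L1(2)[OF uE uF uE L]
  have *: "(\<integral>x. indicator E x * indicator E x \<partial>P) - (\<integral>x. g x * indicator E x \<partial>P) \<le> 2 * \<eta>" by linarith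
  have iE: "integrable P (\<lambda>x. indicator E x * indicator E x :: real)" "integrable P (\<lambda>x. g x * indicator E x)"
    using ub_integrable ub_mult uE ug by blast+
  have "(\<integral>x. c * indicator ?D x \<partial>P) \<le> (\<integral>x. indicator E x * indicator E x - g x * indicator E x \<partial>P)"
  proof (rule integral_mono)
    show "integrable P (\<lambda>x. c * indicator ?D x)" using ub_integrable[OF ub_indicator[OF DP]] by simp
    show "integrable P (\<lambda>x. indicator E x * indicator E x - g x * indicator E x)" using iE by simp
    show "c * indicator ?D x \<le> indicator E x * indicator E x - g x * indicator E x" if "x \<in> space P" for x
      using that g01[of x] by (auto simp: indicator_def space_loeb weight_1)
  qed
  also have "\<dots> \<le> 2 * \<eta>" using iE * by simp
  also have "(\<integral>x. c * indicator ?D x \<partial>P) = measure P ?D * c"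
    using DP sets.sets_into_space[OF DP] by (simp add: Int_absorb2)
  finally show ?thesis .
qed

text \<open>A cylinder over the empty set is empty or full at each level, and the ultrafilter
  decides between the two. This is where null becomes empty.\<close>

lemma gens_0: "e \<subseteq> J \<Longrightarrow> S \<in> Alg (gens 0 e) \<Longrightarrow> intl S = {} \<or> intl S = Omega"
proof -
  assume e: "e \<subseteq> J" and S: "S \<in> Alg (gens 0 e)"
  have "g = {}" if "g \<subseteq> e" "card g \<le> 0" for g
    using that e finite_J by (metis card_eq_0_iff finite_subset le_zero_eq)
  then have "gens 0 e \<subseteq> cyl {}" by (auto simp: gens_def)
  then have "S \<in> cyl {}" using S Alg_cyl[of "gens 0 e" "{}"] by auto
  then have *: "S n = {} \<or> S n = X n" for n
    by (auto simp: cyl_iff glue_def)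
  show ?thesis
  proof (cases "eventually (\<lambda>n. S n = {}) U")
    case True
    then have "intl S = {}" unfolding intl_empty_iff by eventually_elim auto
    then show ?thesis by simp
  next
    case False
    then have "eventually (\<lambda>n. S n \<noteq> {}) U" by (simp add: not_eventually_U)
    then have "eventually (\<lambda>n. X n \<inter> X n \<subseteq> S n) U" using * by (auto elim!: eventually_mono)
    then have "intl X \<subseteq> intl S" by (simp add: intl_le_iff)
    then show ?thesis using intl_subset[of S] by (auto simp: intl_X)
  qed
qed

lemma sg_gens_0: "e \<subseteq> J \<Longrightarrow> A \<in> sets (sg (gens 0 e)) \<Longrightarrow> A = {} \<or> A = Omega"
proof -
  assume e: "e \<subseteq> J" and "A \<in> sets (sg (gens 0 e))"
  then have "A \<in> sigma_sets Omega (intl ` Alg (gens 0 e))" by (simp add: sets_sg)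
  then show ?thesis
  proof (induction rule: sigma_sets.induct)
    case (Basic a)
    then show ?case using gens_0[OF e] by auto
  next
    case (Union a)
    then show ?case by (cases "\<exists>i. a i = Omega") blast+
  qed auto
qed

lemma ce_exists_P:
  assumes "A \<in> sets P" "G \<subseteq> cyl J"
  obtains g where "is_ce unit_weight G (indicator A) g"
  using ce_exists[OF weight_1 assms(2), of "indicator A"] assms(1) by (auto simp: indicator_def)

text \<open>The step from \<open>k\<close> to \<open>k + 1\<close>: pass from \<open>E\<close> to the points where it is popular relative to finitely
  many cylinders of order \<open>k + 1\<close> and all cylinders of order \<open>k\<close>; on each atom of the former, replace
  the atom by its support, which has order \<open>k\<close>.\<close>

proposition null_removal:
  assumes HH: "finite HH" "HH \<noteq> {}" "\<And>e. e \<in> HH \<Longrightarrow> e \<subseteq> J" "\<And>e f. e \<in> HH \<Longrightarrow> f \<subseteq> e \<Longrightarrow> f \<in> HH"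
    and E: "\<And>e. e \<in> HH \<Longrightarrow> E e \<in> sets (sg (gens k e))"
    and null: "measure P (\<Inter>e\<in>HH. E e) = 0" and "\<epsilon> > 0"
  shows "\<exists>E'. (\<forall>e\<in>HH. E' e \<in> Alg (gens k e)) \<and> (\<forall>e\<in>HH. measure P (E e - intl (E' e)) \<le> \<epsilon>) \<and>
    (\<Inter>e\<in>HH. intl (E' e)) = {}"
  using E null \<open>\<epsilon> > 0\<close>
proof (induction k arbitrary: E \<epsilon>)
  case 0
  have E0: "E e = {} \<or> E e = Omega" if "e \<in> HH" for e using sg_gens_0[OF HH(3)] 0(1) that by blast
  have "\<exists>e\<in>HH. E e = {}"
  proof (rule ccontr)
    assume "\<not> ?thesis"
    then have "(\<Inter>e\<in>HH. E e) = Omega" using E0 HH(2) by auto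
    then show False using 0(2) prob_P by simp
  qed
  then obtain e0 where e0: "e0 \<in> HH" "E e0 = {}" by blast
  have i0: "intl (\<lambda>_. {}) = {}" by (simp add: intl_empty_iff)
  let ?E' = "\<lambda>e. if E e = {} then (\<lambda>_. {}) else X"
  have "measure P (E e - intl (?E' e)) \<le> \<epsilon>" if "e \<in> HH" for e
  proof -
    have "E e - intl (?E' e) = {}" using E0[OF that] by (auto simp: intl_X)
    then show ?thesis using 0(3) by (simp only: measure_empty less_imp_le)
  qed
  moreover have "(\<Inter>e\<in>HH. intl (?E' e)) = {}" using e0 i0 by auto
  ultimately show ?case by (intro exI[of _ ?E']) (auto intro: Alg.full Alg_empty)
next
  case (Suc k)
  define m where "m = card HH"
  \<comment> \<open>Each of the \<open>m\<close> sets may lose a proportion \<open>c\<close> of the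
    intersection of the popular sets; as \<open>m * c = 1 - c\<close> is below 1, this intersection
    has to be null. The choice of \<open>\<eta>\<close> makes \<open>2 * \<eta> / c\<close> equal to
    \<open>\<epsilon> / 2\<close>.\<close>
  define c where "c = 1 / (real m + 1)"
  define \<eta> where "\<eta> = \<epsilon> * c / 4"
  have c: "c > 0" by (simp add: c_def)
  then have \<eta>: "\<eta> > 0" using Suc(4) by (simp add: \<eta>_def)
  define Fk where "Fk = {f\<in>HH. card f = Suc k}"
  have FkJ: "f \<subseteq> J" if "f \<in> Fk" for f using that HH(3) by (auto simp: Fk_def)
  have finFk: "finite Fk" using HH(1) by (simp add: Fk_def)
  have EP: "E e \<in> sets P" if "e \<in> HH" for e
    using Suc(2)[OF that] gens_cyl_J[OF HH(3)[OF that]] sets_sg_P by blast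
  have "\<exists>F\<in>Alg (gens (Suc k) e). measure P (sym_diff (E e) (intl F)) < \<eta>" if "e \<in> HH" for e
    using sg_approx[OF P.finite_measure_axioms sets_sg_loeb[OF _ weight_1] _ Suc(2)[OF that] \<eta>] gens_cyl_J[OF HH(3)[OF that]] by blast
  then obtain F where F: "\<And>e. e \<in> HH \<Longrightarrow> F e \<in> Alg (gens (Suc k) e)" "\<And>e. e \<in> HH \<Longrightarrow> measure P (sym_diff (E e) (intl (F e))) < \<eta>"
    by metis
  have "\<exists>G0\<subseteq>gens (Suc k) e. finite G0 \<and> F e \<in> Alg G0" if "e \<in> HH" for e
    using F(1)[OF that] by (rule Alg_finite_generators)
  then obtain G0 where G0: "\<And>e. e \<in> HH \<Longrightarrow> G0 e \<subseteq> gens (Suc k) e" "\<And>e. e \<in> HH \<Longrightarrow> finite (G0 e)" "\<And>e. e \<in> HH \<Longrightarrow> F e \<in> Alg (G0 e)"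
    by metis
  define GG where "GG = (\<Union>e\<in>HH. G0 e)"
  have finGG: "finite GG" using G0(2) HH(1) by (auto simp: GG_def)
  define gf where "gf f = GG \<inter> cyl f" for f
  define ge where "ge e = (\<Union>f\<in>{f\<in>Fk. f \<subseteq> e}. gf f)" for e
  \<comment> \<open>All cylinders of order \<open>k\<close> in \<open>e\<close>, but only finitely
    many over sets of size \<open>k + 1\<close>, namely those occurring in the approximations
    \<open>F\<close>: finiteness is what makes atoms available.\<close>
  define B where "B e = gens k e \<union> ge e" for e
  have fin: "finite (gf f)" "finite (ge e)" for f e
    using finGG finFk by (auto simp: gf_def ge_def)
  have ge_cyl: "ge e \<subseteq> cyl e" if "e \<subseteq> J" for e
    using cyl_mono that unfolding ge_def gf_def by blast
  have B_cyl: "B e \<subseteq> cyl e" if "e \<subseteq> J" for e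
    using gens_cyl[OF that] ge_cyl[OF that] by (auto simp: B_def)
  have B_J: "B e \<subseteq> cyl J" if "e \<subseteq> J" for e
    using B_cyl[OF that] cyl_mono[of e J] that by blast
  have FB: "F e \<in> Alg (B e)" if e: "e \<in> HH" for e
  proof (rule Alg_Alg[OF G0(3)[OF e]], rule Alg.base)
    fix S assume S: "S \<in> G0 e"
    then obtain g where g: "g \<subseteq> e" "card g \<le> Suc k" "S \<in> cyl g" using G0(1)[OF e] by (auto simp: gens_def)
    show "S \<in> B e"
    proof (cases "card g \<le> k")
      case True then show ?thesis using g by (auto simp: B_def gens_def)
    next
      case False
      then have "g \<in> Fk" using g HH(4)[OF e] by (auto simp: Fk_def)
      moreover have "S \<in> GG" using S e by (auto simp: GG_def)
      ultimately show ?thesis using g by (auto simp: B_def ge_def gf_def)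
    qed
  qed
  have "\<exists>g. is_ce unit_weight (B e) (indicator (E e)) g" if "e \<in> HH" for e
    using ce_exists_P[OF EP[OF that] B_J[OF HH(3)[OF that]]] by blast
  then obtain g where g: "\<And>e. e \<in> HH \<Longrightarrow> is_ce unit_weight (B e) (indicator (E e)) (g e)" by metis
  define Gs where "Gs e = {x\<in>Omega. g e x > 1 - c}" for e
  have Gs_B: "Gs e \<in> sets (sg (B e))" if "e \<in> HH" for e
    using superlevel_sg g[OF that] unfolding Gs_def is_ce_def by blast
  have EGs: "measure P (E e - Gs e) \<le> \<epsilon> / 2" if "e \<in> HH" for e
  proof -
    have "measure P (E e - Gs e) * c \<le> 2 * \<eta>"
      unfolding Gs_def using popular_set_approx[OF EP[OF that] B_J[OF HH(3)[OF that]] FB[OF that] less_imp_le[OF F(2)[OF that]] g[OF that] c] .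
    also have "2 * \<eta> = \<epsilon> / 2 * c" by (simp add: \<eta>_def)
    finally show ?thesis using c by simp
  qed
  define BJ where "BJ = gens k J \<union> (\<Union>f\<in>Fk. gf f)"
  have BJ_cyl: "BJ \<subseteq> cyl J"
    using gens_cyl_J[OF order_refl] cyl_mono FkJ unfolding BJ_def gf_def by blast
  have B_BJ: "B e \<subseteq> BJ" if "e \<subseteq> J" for e
    using gens_mono[OF that order_refl] by (auto simp: B_def BJ_def ge_def)
  \<comment> \<open>The slices along \<open>e\<close> of the sets generating \<open>?D\<close> lie
    in the algebra of \<open>B e\<close>, so \<open>g e\<close> computes the share of
    \<open>E e\<close> in \<open>?D\<close>; it exceeds \<open>1 - c\<close> on \<open>?D\<close>.
    Hence \<open>?D\<close> loses at most a proportion \<open>c\<close> to the complement of each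
    \<open>E e\<close>. As the \<open>E e\<close> have null intersection, these losses cover
    \<open>?D\<close> up to measure 0.\<close>
  have null_Gs: "measure P (\<Inter>e\<in>HH. Gs e) = 0"
  proof -
    let ?D = "\<Inter>e\<in>HH. Gs e"
    have DB: "?D \<in> sets (sg BJ)"
      using Gs_B sets_sg_mono[OF B_BJ[OF HH(3)]] HH(1,2) by (intro sets.finite_INT) blast+
    have DP: "?D \<in> sets P" using sets_sg_P[OF BJ_cyl DB] .
    have D\<Omega>: "?D \<subseteq> Omega" using HH(2) by (auto simp: Gs_def)
    have le: "measure P (?D - E e) \<le> c * measure P ?D" if e: "e \<in> HH" for e
    proof -
      have sl: "slice e y S \<in> Alg (B e)" if S: "S \<in> BJ" and y: "y \<in> Omega" for S y
      proof (cases "S \<in> gens k J")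
        case True
        then show ?thesis using slice_gens[OF True y] by (auto simp: B_def intro: Alg.base)
      next
        case False
        then obtain f where f: "f \<in> Fk" "S \<in> gf f" using S by (auto simp: BJ_def)
        show ?thesis
        proof (cases "f \<subseteq> e")
          case True
          then have "S \<in> ge e" using f by (auto simp: ge_def)
          then have "slice e y S = S" "S \<in> B e"
            using slice_id[OF HH(3)[OF e] _ y] ge_cyl[OF HH(3)[OF e]] by (auto simp: B_def)
          then show ?thesis by (simp add: Alg.base)
        next
          case False
          then show ?thesis using slice_cyl_gens[OF FkJ[OF f(1)] _ _ False y, of S k] f
            by (auto simp: B_def gf_def Fk_def intro!: Alg.base)
        qed
      qed
      have "E e \<in> sets (sg (cyl e))"
        using Suc(2)[OF e] sets_sg_mono[OF gens_cyl[OF HH(3)[OF e]], of "Suc k"] by blast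
      then have "(\<integral>x. indicator (E e) x * indicator ?D x \<partial>P) = (\<integral>x. g e x * indicator ?D x \<partial>P)"
        using DB sl g[OF e] B_cyl[OF HH(3)[OF e]] HH(3)[OF e] BJ_cyl
        by (intro ce_slices_indicator[where e=e and G="B e" and GJ=BJ])
      then have "measure P (E e \<inter> ?D) = (\<integral>x. g e x * indicator ?D x \<partial>P)"
        using integral_indicator_mult[OF EP[OF e] DP] by simp
      also have "\<dots> \<ge> (\<integral>x. (1 - c) * indicator ?D x \<partial>P)"
      proof (rule integral_mono)
        show "integrable P (\<lambda>x. (1 - c) * indicator ?D x)" using ub_integrable[OF ub_indicator[OF DP]] by simp
        show "integrable P (\<lambda>x. g e x * indicator ?D x)"
          using ub_integrable[OF ub_mult[OF ce_ub[OF g[OF e] B_J[OF HH(3)[OF e]]] ub_indicator[OF DP]]] .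
        show "(1 - c) * indicator ?D x \<le> g e x * indicator ?D x" for x
          using e by (auto simp: indicator_def Gs_def)
      qed
      finally have "measure P (E e \<inter> ?D) \<ge> (1 - c) * measure P ?D"
        using DP D\<Omega> by (simp add: space_loeb weight_1 Int_absorb2)
      moreover have "measure P (?D - E e) = measure P ?D - measure P (?D \<inter> E e)"
        using DP EP[OF e] by (intro P.finite_measure_Diff')
      ultimately show ?thesis by (simp add: Int_commute algebra_simps)
    qed
    have IP: "(\<Inter>e\<in>HH. E e) \<in> sets P" using EP HH(1,2) by (intro sets.finite_INT)
    have "measure P ?D \<le> measure P ((\<Inter>e\<in>HH. E e) \<union> (\<Union>e\<in>HH. ?D - E e))"
      using DP EP IP HH(1) by (intro P.finite_measure_mono) auto
    also have "\<dots> \<le> measure P (\<Inter>e\<in>HH. E e) + measure P (\<Union>e\<in>HH. ?D - E e)"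
      using DP EP IP HH(1) by (intro measure_Un_le) auto
    also have "measure P (\<Union>e\<in>HH. ?D - E e) \<le> (\<Sum>e\<in>HH. measure P (?D - E e))"
      using DP EP HH(1) by (intro measure_UNION_le) auto
    also have "\<dots> \<le> (\<Sum>e\<in>HH. c * measure P ?D)" using le by (intro sum_mono)
    also have "\<dots> = (real m * c) * measure P ?D" by (simp add: m_def)
    finally have "measure P ?D \<le> (real m * c) * measure P ?D" using Suc(3) by simp
    moreover have "real m * c = 1 - c" by (simp add: c_def field_simps)
    ultimately have "measure P ?D \<le> (1 - c) * measure P ?D" by simp
    then have "c * measure P ?D \<le> 0" by (simp add: left_diff_distrib)
    then have "measure P ?D \<le> 0" using c by (simp add: mult_le_0_iff)
    then show ?thesis using measure_nonneg[of P ?D] by linarith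
  qed
  have "\<exists>S\<in>sets (sg (gens k e)). Gs e \<inter> intl (atom (ge e) \<phi>) = S \<inter> intl (atom (ge e) \<phi>)" if "e \<in> HH" for e \<phi>
    using trace_sg[OF fin(2)[of e]] Gs_B[OF that] unfolding B_def by blast
  then obtain S where S: "\<And>e \<phi>. e \<in> HH \<Longrightarrow> S e \<phi> \<in> sets (sg (gens k e))"
      "\<And>e \<phi>. e \<in> HH \<Longrightarrow> Gs e \<inter> intl (atom (ge e) \<phi>) = S e \<phi> \<inter> intl (atom (ge e) \<phi>)" by metis
  let ?at = "\<lambda>f \<phi>. intl (atom (gf f) \<phi>)"
  have at_P: "?at f \<phi> \<in> sets P" if "f \<in> Fk" for f \<phi>
    using intl_in_sg[OF atom_Alg[OF fin(1)]] sets_sg_P[of "gf f"] cyl_mono[OF FkJ[OF that] order_refl] by (auto simp: gf_def)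
  have "\<exists>q. is_ce unit_weight (gens k f) (indicator (?at f \<phi>)) q" if "f \<in> Fk" for f \<phi>
    using ce_exists_P[OF at_P[OF that] gens_cyl_J[OF FkJ[OF that]]] by blast
  then obtain q where q: "\<And>f \<phi>. f \<in> Fk \<Longrightarrow> is_ce unit_weight (gens k f) (indicator (?at f \<phi>)) (q f \<phi>)" by metis
  define supp where "supp f \<phi> = {x\<in>Omega. q f \<phi> x > 0}" for f \<phi>
  have supp_sg: "supp f \<phi> \<in> sets (sg (gens k f))" if "f \<in> Fk" for f \<phi>
    using superlevel_sg q[OF that] unfolding supp_def is_ce_def by blast
  \<comment> \<open>As \<open>HH\<close> is closed under subsets, every \<open>f\<close> of size
    \<open>k + 1\<close> is itself an index, and the support belonging to \<open>f\<close> is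
    charged to the entry at \<open>f\<close>.\<close>
  define E2 where "E2 \<phi> e = S e \<phi> \<inter> (if e \<in> Fk then supp e \<phi> else Omega)" for \<phi> e
  have E2_sg: "E2 \<phi> e \<in> sets (sg (gens k e))" if "e \<in> HH" for \<phi> e
    using S(1)[OF that] supp_sg sets.top[of "sg (gens k e)"] by (auto simp: E2_def)
  have E2_null: "measure P (\<Inter>e\<in>HH. E2 \<phi> e) = 0" for \<phi>
  proof -
    define I where "I = (\<Inter>e\<in>HH. S e \<phi>)"
    have S\<Omega>: "S e \<phi> \<subseteq> Omega" if "e \<in> HH" for e using sets.sets_into_space[OF S(1)[OF that]] by simp
    have I_sg: "I \<in> sets (sg (gens k J))"
      unfolding I_def using S(1) sets_sg_mono[OF gens_mono[OF HH(3) order_refl]] HH(1,2) by (intro sets.finite_INT) blast+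
    \<comment> \<open>Hybrids: the atoms of members of \<open>T\<close> have been exchanged for
      supports, the others not yet. \<open>N {}\<close> lies in the null intersection of the popular
      sets. One exchange preserves nullity, because the remaining conditions have slices of order
      \<open>k\<close> along \<open>f\<close>.\<close>
    define N where "N T = {x\<in>I. (\<forall>f\<in>T. x \<in> supp f \<phi>) \<and> (\<forall>f\<in>Fk - T. x \<in> ?at f \<phi>)}" for T
    have "measure P (N T) = 0" if "T \<subseteq> Fk" for T
      using finite_subset[OF that finFk] that
    proof (induction T rule: finite_induct)
      case empty
      have "N {} \<subseteq> (\<Inter>e\<in>HH. Gs e)"
      proof
        fix x assume x: "x \<in> N {}"
        then have "x \<in> Omega" using S\<Omega> HH(2) by (auto simp: N_def I_def)
        show "x \<in> (\<Inter>e\<in>HH. Gs e)"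
        proof
          fix e assume e: "e \<in> HH"
          have "x \<in> intl (atom (ge e) \<phi>)"
            unfolding intl_atom[OF fin(2)] using x \<open>x \<in> Omega\<close>
            by (auto simp: intl_atom[OF fin(1)] N_def ge_def)
          then show "x \<in> Gs e" using S(2)[OF e, of \<phi>] x e by (auto simp: N_def I_def)
        qed
      qed
      moreover have "(\<Inter>e\<in>HH. Gs e) \<in> sets P"
        using Gs_B sets_sg_P[OF B_J[OF HH(3)]] HH(1,2) by (intro sets.finite_INT) blast+
      ultimately show ?case
        using null_Gs P.finite_measure_mono[of "N {}" "\<Inter>e\<in>HH. Gs e"] measure_nonneg[of P "N {}"] by auto
    next
      case (insert f T)
      then have f: "f \<in> Fk" "f \<notin> T" "T \<subseteq> Fk" by auto
      define R where "R = {x\<in>I. (\<forall>f\<in>T. x \<in> supp f \<phi>) \<and> (\<forall>f\<in>Fk - T - {f}. x \<in> ?at f \<phi>)}"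
      define GJ where "GJ = gens k J \<union> (\<Union>f'\<in>Fk - {f}. gf f')"
      have GJ_cyl: "GJ \<subseteq> cyl J" using BJ_cyl by (auto simp: GJ_def BJ_def)
      have R_sg: "R \<in> sets (sg GJ)"
      proof -
        have s: "supp f' \<phi> \<in> sets (sg GJ)" if "f' \<in> T" for f'
          using supp_sg[of f' \<phi>] f that sets_sg_mono[of "gens k f'" GJ] gens_mono[OF FkJ[of f'] order_refl, of k] by (auto simp: GJ_def)
        have a: "?at f' \<phi> \<in> sets (sg GJ)" if "f' \<in> Fk - T - {f}" for f'
          using intl_in_sg[OF atom_Alg[OF fin(1)], of f' \<phi>] that sets_sg_mono[of "gf f'" GJ] by (auto simp: GJ_def)
        have I: "I \<in> sets (sg GJ)" using I_sg sets_sg_mono[of "gens k J" GJ] by (auto simp: GJ_def)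
        have "R = I \<inter> ((\<Inter>f\<in>T. supp f \<phi>) \<inter> Omega) \<inter> ((\<Inter>f\<in>Fk - T - {f}. ?at f \<phi>) \<inter> Omega)"
          using sets.sets_into_space[OF I] by (auto simp: R_def)
        moreover have "(\<Inter>f\<in>T. supp f \<phi>) \<inter> Omega \<in> sets (sg GJ)"
        proof (cases "T = {}")
          case True then show ?thesis using sets.top[of "sg GJ"] by simp
        next
          case False
          then have "(\<Inter>f\<in>T. supp f \<phi>) \<in> sets (sg GJ)" using s insert(1) by (intro sets.finite_INT) auto
          then show ?thesis using sets.top[of "sg GJ"] by auto
        qed
        moreover have "(\<Inter>f\<in>Fk - T - {f}. ?at f \<phi>) \<inter> Omega \<in> sets (sg GJ)"
        proof (cases "Fk - T - {f} = {}")
          case True then show ?thesis using sets.top[of "sg GJ"] by (simp only: True) simp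
        next
          case False
          then have "(\<Inter>f\<in>Fk - T - {f}. ?at f \<phi>) \<in> sets (sg GJ)" using a finFk by (intro sets.finite_INT) auto
          then show ?thesis using sets.top[of "sg GJ"] by auto
        qed
        ultimately show ?thesis using I by auto
      qed
      have RP: "R \<in> sets P" using sets_sg_P[OF GJ_cyl R_sg] .
      have sl: "slice f y S \<in> Alg (gens k f)" if S: "S \<in> GJ" and y: "y \<in> Omega" for S y
      proof (cases "S \<in> gens k J")
        case True
        then show ?thesis using slice_gens[OF True y] by (auto intro: Alg.base)
      next
        case False
        then obtain f' where f': "f' \<in> Fk" "f' \<noteq> f" "S \<in> gf f'" using S by (auto simp: GJ_def)
        have "\<not> f' \<subseteq> f"
          using f' f card_subset_eq[of f f'] finite_subset[OF FkJ[OF f(1)] finite_J] by (auto simp: Fk_def)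
        then show ?thesis using slice_cyl_gens[OF FkJ[OF f'(1)] _ _ _ y, of S k f] f'
          by (auto simp: gf_def Fk_def intro!: Alg.base)
      qed
      have at_cyl: "?at f \<phi> \<in> sets (sg (cyl f))"
        using intl_in_sg[OF atom_Alg[OF fin(1)], of f \<phi>] sets_sg_mono[of "gf f" "cyl f"] by (auto simp: gf_def)
      have "N T = ?at f \<phi> \<inter> R" using f by (auto simp: N_def R_def)
      then have "0 = measure P (?at f \<phi> \<inter> R)" using insert by simp
      also have "\<dots> = (\<integral>x. indicator (?at f \<phi>) x * indicator R x \<partial>P)"
        using integral_indicator_mult[OF at_P[OF f(1)] RP] by simp
      also have "\<dots> = (\<integral>x. q f \<phi> x * indicator R x \<partial>P)"
        using R_sg sl q[OF f(1), of \<phi>] gens_cyl[OF FkJ[OF f(1)]] FkJ[OF f(1)] GJ_cyl at_cyl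
        by (intro ce_slices_indicator[where e=f and G="gens k f" and GJ=GJ])
      finally have "measure P (supp f \<phi> \<inter> R) = 0"
        unfolding supp_def using ce_ub[OF q[OF f(1)] gens_cyl_J[OF FkJ[OF f(1)]]] RP by (intro ce_null_support) auto
      moreover have "N (insert f T) = supp f \<phi> \<inter> R" by (auto simp: N_def R_def)
      ultimately show ?case by simp
    qed
    then have "measure P (N Fk) = 0" by simp
    moreover have "N Fk = (\<Inter>e\<in>HH. E2 \<phi> e)"
    proof (intro set_eqI iffI)
      fix x assume "x \<in> N Fk"
      moreover from this have "x \<in> Omega" using S\<Omega> HH(2) by (auto simp: N_def I_def)
      ultimately show "x \<in> (\<Inter>e\<in>HH. E2 \<phi> e)" by (auto simp: N_def I_def E2_def)
    next
      fix x assume x: "x \<in> (\<Inter>e\<in>HH. E2 \<phi> e)"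
      have "x \<in> supp f \<phi>" if "f \<in> Fk" for f
      proof -
        have "x \<in> E2 \<phi> f" using x that by (auto simp: Fk_def)
        then show ?thesis using that by (simp add: E2_def)
      qed
      then show "x \<in> N Fk" using x by (auto simp: N_def I_def E2_def)
    qed
    ultimately show ?thesis by simp
  qed
  \<comment> \<open>One exceptional set arises for each sign pattern
    \<open>\<phi> \<subseteq> GG\<close>; together they may use \<open>\<epsilon> / 2\<close>, the
    other half having gone into the popular sets.\<close>
  define \<epsilon>' where "\<epsilon>' = \<epsilon> / (2 * real (card (Pow GG)))"
  have cpos: "real (card (Pow GG)) > 0" using finGG by (auto simp: card_gt_0_iff simp del: card_Pow)
  then have \<epsilon>': "\<epsilon>' > 0" using Suc(4) unfolding \<epsilon>'_def by (intro divide_pos_pos mult_pos_pos) auto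
  have "\<exists>E'. (\<forall>e\<in>HH. E' e \<in> Alg (gens k e)) \<and> (\<forall>e\<in>HH. measure P (E2 \<phi> e - intl (E' e)) \<le> \<epsilon>') \<and>
    (\<Inter>e\<in>HH. intl (E' e)) = {}" for \<phi>
    using Suc(1)[OF E2_sg E2_null \<epsilon>'] .
  then obtain E3 where E3: "\<And>\<phi> e. e \<in> HH \<Longrightarrow> E3 \<phi> e \<in> Alg (gens k e)"
      "\<And>\<phi> e. e \<in> HH \<Longrightarrow> measure P (E2 \<phi> e - intl (E3 \<phi> e)) \<le> \<epsilon>'" "\<And>\<phi>. (\<Inter>e\<in>HH. intl (E3 \<phi> e)) = {}"
    by metis
  \<comment> \<open>On the atom of \<open>\<phi>\<close> the set is cut down to the solution for
    \<open>\<phi>\<close>. Patterns live on all of \<open>GG\<close> and are shared by all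
    \<open>e\<close>, so a common point of the \<open>E' e\<close> determines a single pattern and
    would lie in every \<open>E3 \<phi> e\<close>, which is impossible.\<close>
  define E' where "E' e = (\<lambda>n. {x\<in>X n. \<forall>\<phi>\<in>Pow GG. x \<in> (X n - atom (ge e) \<phi> n) \<union> E3 \<phi> e n})" for e
  have gens_Suc: "gens k e \<subseteq> gens (Suc k) e" for e by (rule gens_mono) auto
  have E'_Alg: "E' e \<in> Alg (gens (Suc k) e)" if e: "e \<in> HH" for e
  proof -
    have "ge e \<subseteq> gens (Suc k) e" by (auto simp: ge_def gf_def gens_def Fk_def)
    then have "atom (ge e) \<phi> \<in> Alg (gens (Suc k) e)" for \<phi>
      using atom_Alg[OF fin(2)] Alg_mono by blast
    moreover have "E3 \<phi> e \<in> Alg (gens (Suc k) e)" for \<phi> using E3(1)[OF e] Alg_mono[OF gens_Suc] by blast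
    ultimately show ?thesis unfolding E'_def using finGG gens_cyl_J[OF HH(3)[OF e]]
      by (intro Alg_finite_Inter Alg_Un Alg.compl) auto
  qed
  have intl_E': "intl (E' e) = {x\<in>Omega. \<forall>\<phi>\<in>Pow GG. x \<in> intl (atom (ge e) \<phi>) \<longrightarrow> x \<in> intl (E3 \<phi> e)}" for e
    unfolding E'_def using finGG by (subst intl_finite_Inter) (auto simp: intl_Un intl_compl)
  have "measure P (E e - intl (E' e)) \<le> \<epsilon>" if e: "e \<in> HH" for e
  proof -
    let ?Z = "\<lambda>\<phi>. if e \<in> Fk then ?at e \<phi> - supp e \<phi> else {}"
    let ?D = "\<lambda>\<phi>. (E2 \<phi> e - intl (E3 \<phi> e)) \<union> ?Z \<phi>"
    have eJ: "gens k e \<subseteq> cyl J" using gens_cyl_J[OF HH(3)[OF e]] .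
    have sP: "?Z \<phi> \<in> sets P" "E2 \<phi> e - intl (E3 \<phi> e) \<in> sets P" "Gs e \<in> sets P" for \<phi>
      using sets_sg_P[OF eJ supp_sg] at_P sets_sg_P[OF eJ E2_sg[OF e]] sets_sg_P[OF eJ intl_in_sg[OF E3(1)[OF e]]]
        sets_sg_P[OF B_J[OF HH(3)[OF e]] Gs_B[OF e]] by auto
    have "measure P (?D \<phi>) \<le> \<epsilon>'" for \<phi>
    proof -
      have "measure P (?Z \<phi>) = 0"
        using ce_support[OF at_P eJ q] by (auto simp: supp_def)
      then show ?thesis using measure_Un_le[OF sP(2,1), of \<phi> \<phi>] E3(2)[OF e, of \<phi>] by linarith
    qed
    then have "(\<Sum>\<phi>\<in>Pow GG. measure P (?D \<phi>)) \<le> real (card (Pow GG)) * \<epsilon>'" by (intro sum_bounded_above)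
    also have "\<dots> = \<epsilon> / 2" using cpos unfolding \<epsilon>'_def by (simp add: field_simps)
    finally have 1: "measure P (\<Union>\<phi>\<in>Pow GG. ?D \<phi>) \<le> \<epsilon> / 2"
      using measure_UNION_le[of "Pow GG" ?D P] finGG sP by (auto intro: order_trans)
    have "E e - intl (E' e) \<subseteq> (E e - Gs e) \<union> (\<Union>\<phi>\<in>Pow GG. ?D \<phi>)"
    proof
      fix x assume x: "x \<in> E e - intl (E' e)"
      show "x \<in> (E e - Gs e) \<union> (\<Union>\<phi>\<in>Pow GG. ?D \<phi>)"
      proof (cases "x \<in> Gs e")
        case False then show ?thesis using x by auto
      next
        case True
        then have "x \<in> Omega" by (simp add: Gs_def)
        then obtain \<phi> where \<phi>: "\<phi> \<in> Pow GG" "x \<in> intl (atom (ge e) \<phi>)" "x \<notin> intl (E3 \<phi> e)"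
          using x by (auto simp: intl_E')
        then have "x \<in> S e \<phi>" using S(2)[OF e, of \<phi>] True by auto
        moreover have "x \<in> ?at e \<phi>" if "e \<in> Fk"
          using \<phi>(2) that unfolding intl_atom[OF fin(2)] intl_atom[OF fin(1)] by (auto simp: ge_def)
        ultimately have "x \<in> ?D \<phi>" using \<phi> \<open>x \<in> Omega\<close> by (auto simp: E2_def)
        then show ?thesis using \<phi>(1) by blast
      qed
    qed
    moreover have UP: "(\<Union>\<phi>\<in>Pow GG. ?D \<phi>) \<in> sets P"
      using sP(1,2) finGG by (intro sets.finite_UN sets.Un) auto
    moreover have DP: "E e - Gs e \<in> sets P" using EP[OF e] sP(3) by (rule sets.Diff)
    ultimately have "measure P (E e - intl (E' e)) \<le> measure P ((E e - Gs e) \<union> (\<Union>\<phi>\<in>Pow GG. ?D \<phi>))"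
      by (intro P.finite_measure_mono sets.Un)
    also have "\<dots> \<le> measure P (E e - Gs e) + measure P (\<Union>\<phi>\<in>Pow GG. ?D \<phi>)"
      using DP UP by (rule measure_Un_le)
    finally show ?thesis using 1 EGs[OF e] by linarith
  qed
  moreover have "(\<Inter>e\<in>HH. intl (E' e)) = {}"
  proof (rule ccontr)
    assume "(\<Inter>e\<in>HH. intl (E' e)) \<noteq> {}"
    then obtain x where x: "\<And>e. e \<in> HH \<Longrightarrow> x \<in> intl (E' e)" by blast
    define \<phi> where "\<phi> = {S\<in>GG. x \<in> intl S}"
    have "x \<in> intl (E3 \<phi> e)" if "e \<in> HH" for e
    proof -
      have "x \<in> Omega" using x[OF that] intl_subset by auto
      then have "x \<in> intl (atom (ge e) \<phi>)" unfolding intl_atom[OF fin(2)] by (auto simp: \<phi>_def ge_def gf_def)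
      moreover have "\<phi> \<in> Pow GG" by (auto simp: \<phi>_def)
      ultimately show ?thesis using x[OF that] by (auto simp: intl_E')
    qed
    then have "x \<in> (\<Inter>e\<in>HH. intl (E3 \<phi> e))" by blast
    then show False unfolding E3(3) by simp
  qed
  ultimately show ?case using E'_Alg by blast
qed

end

section \<open>Relative counting\<close>

locale relative_edge = linear_forms_edge J V H d \<nu> U e1 + loeb_setting J V U
  for J :: "'j set" and V :: "nat \<Rightarrow> 'j \<Rightarrow> 'v set" and H d \<nu> U e1
begin

abbreviation w1 :: "nat \<Rightarrow> ('j \<Rightarrow> 'v) \<Rightarrow> real" where "w1 \<equiv> \<lambda>n x. \<nu> n e1 (restrict x e1)"
abbreviation low where "low \<equiv> gens (d - 1) e1"

lemma low_cyl: "low \<subseteq> cyl e1" and low_J: "low \<subseteq> cyl J"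
  using gens_cyl gens_cyl_J e1_J by auto

lemma w1_nonneg: "x \<in> X n \<Longrightarrow> 0 \<le> w1 n x"
  using nu_nonneg[OF e1] restrict_X[OF _ e1_J] by blast

lemma w1_glue: "w1 n (glue e1 x y) = w1 n x"
  by (simp add: restrict_glue)

lemma fibre_1: "(\<And>e. e \<in> L \<Longrightarrow> \<phi> n e c = (\<lambda>_. 1)) \<Longrightarrow> fibre \<phi> n c x = 1"
  unfolding fibre_def by simp

lemma av_w1: "((\<lambda>n. av n (w1 n)) \<longlongrightarrow> 1) U"
proof -
  have "fibre (M {}) n c x = 1" for n c x by (rule fibre_1) (simp add: M_def fun_eq_iff)
  then show ?thesis using fibre_M_moment[of True "{}"] by simp
qed

lemma weight_w1: "weight w1"
proof -
  have "eventually (\<lambda>n. av n (w1 n) < 2) U" using av_w1 by (rule order_tendstoD) simp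
  then show ?thesis unfolding weight_def using w1_nonneg by (auto elim!: eventually_mono intro!: exI[of _ 2])
qed

text \<open>The linear span of products of slot functions; by linearity it inherits the
  orthogonality to \<open>w1 - 1\<close>. It is closed under multiplication and contains the
  indicators of all sets of lower order. Identities are asked only on \<open>X n\<close>, which is
  all that averages see.\<close>

inductive_set Span :: "(nat \<Rightarrow> ('j \<Rightarrow> 'v) \<Rightarrow> real) set" where
  box: "slot_functions u \<Longrightarrow> (\<And>j n x y. j \<in> e1 \<Longrightarrow> x \<in> X n \<Longrightarrow> y \<in> X n \<Longrightarrow> u j n (glue e1 x y) = u j n x) \<Longrightarrow>
    (\<And>n x. x \<in> X n \<Longrightarrow> v n x = (\<Prod>j\<in>e1. u j n x)) \<Longrightarrow> v \<in> Span"
| add: "a \<in> Span \<Longrightarrow> b \<in> Span \<Longrightarrow> (\<And>n x. x \<in> X n \<Longrightarrow> v n x = a n x + b n x) \<Longrightarrow> v \<in> Span"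
| scale: "a \<in> Span \<Longrightarrow> (\<And>n x. x \<in> X n \<Longrightarrow> v n x = c * a n x) \<Longrightarrow> v \<in> Span"

lemma strong_linear_forms_Span:
  assumes v: "v \<in> Span" and \<phi>: "dominated S \<phi>"
  shows "((\<lambda>n. av n (\<lambda>x. (w1 n x - 1) * v n x * (fibre \<phi> n False x * fibre \<phi> n True x))) \<longlongrightarrow> 0) U"
  using v
proof induction
  case (box u v)
  have eq: "av n (\<lambda>x. (w1 n x - 1) * v n x * (fibre \<phi> n False x * fibre \<phi> n True x)) =
    av n (\<lambda>x. ((w1 n x - 1) * (\<Prod>j\<in>e1. u j n x)) * (fibre \<phi> n False x * fibre \<phi> n True x))" for n
    using box(3) by (intro avg_cong) simp
  show ?case unfolding eq by (rule strong_linear_forms[OF \<phi> box(1) box(2)])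
next
  case (add a b v)
  have eq: "av n (\<lambda>x. (w1 n x - 1) * v n x * (fibre \<phi> n False x * fibre \<phi> n True x)) =
    av n (\<lambda>x. (w1 n x - 1) * a n x * (fibre \<phi> n False x * fibre \<phi> n True x)) +
    av n (\<lambda>x. (w1 n x - 1) * b n x * (fibre \<phi> n False x * fibre \<phi> n True x))" for n
    unfolding avg_add[symmetric] using add(3) by (intro avg_cong) (simp add: algebra_simps)
  show ?case unfolding eq by (rule tendsto_add_zero[OF add(4,5)])
next
  case (scale a v c)
  have eq: "av n (\<lambda>x. (w1 n x - 1) * v n x * (fibre \<phi> n False x * fibre \<phi> n True x)) =
    c * av n (\<lambda>x. (w1 n x - 1) * a n x * (fibre \<phi> n False x * fibre \<phi> n True x))" for n
    unfolding avg_cmult[symmetric] using scale(2) by (intro avg_cong) (simp add: algebra_simps)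
  show ?case unfolding eq by (rule tendsto_mult_right_zero[OF scale(3)])
qed

lemma Span_1: "(\<lambda>_ _. 1) \<in> Span"
  by (rule Span.box[where u="\<lambda>_ _ _. 1"]) (auto simp: slot_functions_def)

lemma Span_mult:
  assumes "a \<in> Span" "b \<in> Span"
  shows "(\<lambda>n x. a n x * b n x) \<in> Span"
  using assms(1)
proof induction
  case (box u v)
  note u = this
  show ?case using assms(2)
  proof induction
    case (box u' v')
    show ?case
    proof (rule Span.box[where u="\<lambda>j n x. u j n x * u' j n x"])
      show "slot_functions (\<lambda>j n x. u j n x * u' j n x)"
        using u(1) box(1) by (auto simp: slot_functions_def mult_le_one)
    qed (use u box in \<open>simp_all add: prod.distrib\<close>)
  next
    case (add a b w)
    show ?case by (rule Span.add[OF add(4,5)]) (simp add: add(3) algebra_simps)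
  next
    case (scale a w c)
    show ?case by (rule Span.scale[OF scale(3), where c=c]) (simp add: scale(2) algebra_simps)
  qed
next
  case (add a' b' w)
  show ?case by (rule Span.add[OF add(4,5)]) (simp add: add(3) algebra_simps)
next
  case (scale a' w c)
  show ?case by (rule Span.scale[OF scale(3), where c=c]) (simp add: scale(2) algebra_simps)
qed

lemma low_proper: "g \<subseteq> e1 \<Longrightarrow> card g \<le> d - 1 \<Longrightarrow> \<exists>j\<in>e1. j \<notin> g"
  using H_card[OF e1] d_pos by (metis Suc_diff_1 Suc_n_not_le_n less_eq_Suc_le subset_antisym subsetI One_nat_def)

text \<open>A cylinder of order below \<open>d\<close> misses some coordinate \<open>j0\<close> of
  \<open>e1\<close>, so its indicator can occupy the slot of \<open>j0\<close>. Complements and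
  intersections turn into \<open>1 - a\<close> and \<open>a * b\<close>.\<close>

lemma Span_indicator:
  assumes "S \<in> Alg low"
  shows "(\<lambda>n. indicator (S n)) \<in> Span"
  using assms
proof induction
  case (base S)
  then obtain g where g: "g \<subseteq> e1" "card g \<le> d - 1" "S \<in> cyl g" by (auto simp: gens_def)
  obtain j0 where j0: "j0 \<in> e1" "j0 \<notin> g" using low_proper[OF g(1,2)] by blast
  have gJ: "g \<subseteq> J" using g e1_J by auto
  define u where "u j n = (if j = j0 then indicator (S n) else (\<lambda>_. 1::real))" for j n
  have upd: "x(j0 := y j0) \<in> S n \<longleftrightarrow> x \<in> S n" if "x \<in> X n" "y \<in> X n" for x y n
  proof -
    have "glue g x (x(j0 := y j0)) = x(j0 := y j0)" using j0 by (auto simp: glue_def)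
    then show ?thesis using cyl_glue_iff[OF gJ g(3) that(1) upd_X[OF that, of j0]] by simp
  qed
  show ?case
  proof (rule Span.box[where u=u])
    show "slot_functions u" unfolding slot_functions_def u_def using upd by (auto simp: indicator_def)
    show "u j n (glue e1 x y) = u j n x" if "x \<in> X n" "y \<in> X n" for j n x y
      using that cyl_glue_iff[OF e1_J _ that, of S] cyl_mono[OF g(1) e1_J] g(3) by (auto simp: u_def indicator_def)
    show "indicator (S n) x = (\<Prod>j\<in>e1. u j n x)" for n x
      using j0 fin_e1 by (simp add: u_def if_distrib[of "\<lambda>f. f x"] prod.If_cases Int_absorb1 cong: if_cong)
  qed
next
  case full
  show ?case by (rule Span.scale[OF Span_1, where c=1]) simp
next
  case (compl S)
  show ?case
  proof (rule Span.add[OF Span_1])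
    show "(\<lambda>n x. - 1 * indicator (S n) x) \<in> Span" by (rule Span.scale[OF compl(2), where c="-1"]) simp
  qed (auto simp: indicator_def)
next
  case (int S T)
  show ?case by (rule Span.scale[OF Span_mult[OF int(3,4)], where c=1]) (auto simp: indicator_def)
qed

lemma Span_sum: "(\<And>i. i < (K::nat) \<Longrightarrow> a i \<in> Span) \<Longrightarrow> (\<lambda>n x. \<Sum>i<K. a i n x) \<in> Span"
proof (induction K)
  case 0
  show ?case by (rule Span.scale[OF Span_1, where c=0]) simp
next
  case (Suc K)
  have "(\<lambda>n x. \<Sum>i<K. a i n x) \<in> Span" by (rule Suc(1)) (simp add: Suc(2))
  moreover have "a K \<in> Span" by (simp add: Suc(2))
  ultimately show ?case by (rule Span.add) simp
qed

lemma Span_Step: "s \<in> Step low \<Longrightarrow> s \<in> Span"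
proof -
  assume "s \<in> Step low"
  then obtain K S where s: "s = mkstep K S" "\<forall>i<K. S i \<in> Alg low" by (auto simp: Step_def)
  have "(\<lambda>n x. \<Sum>i<K. indicator (S i n) x) \<in> Span"
    using Span_sum[of K "\<lambda>i n. indicator (S i n)"] Span_indicator s(2) by simp
  then show ?thesis by (rule Span.scale[where c="1 / real K"]) (simp add: s mkstep_def)
qed

lemma dominated_1: "dominated {} (\<lambda>_ _ _ _. 1)"
  by (simp add: dominated_def M_def)

lemma Span_weight:
  assumes "v \<in> Span"
  shows "((\<lambda>n. av n (\<lambda>x. (w1 n x - 1) * v n x)) \<longlongrightarrow> 0) U"
  using strong_linear_forms_Span[OF assms dominated_1] by (simp add: fibre_1)

lemma mass_low:
  assumes "S \<in> Alg low"
  shows "mass w1 S = mass unit_weight S"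
proof -
  have "((\<lambda>n. av n (\<lambda>x. indicator (S n) x * w1 n x) - av n (\<lambda>x. indicator (S n) x * 1)) \<longlongrightarrow> mass w1 S - mass unit_weight S) U"
    by (intro tendsto_diff mass_tendsto weight_1 weight_w1)
  moreover have "av n (\<lambda>x. indicator (S n) x * w1 n x) - av n (\<lambda>x. indicator (S n) x * 1) = av n (\<lambda>x. (w1 n x - 1) * indicator (S n) x)" for n
    unfolding avg_diff[symmetric] by (simp add: algebra_simps)
  ultimately have "((\<lambda>n. av n (\<lambda>x. (w1 n x - 1) * indicator (S n) x)) \<longlongrightarrow> mass w1 S - mass unit_weight S) U" by simp
  then have "mass w1 S - mass unit_weight S = 0"
    by (rule tendsto_unique[OF U_nontrivial _ Span_weight[OF Span_indicator[OF assms]]])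
  then show ?thesis by simp
qed

text \<open>By \<open>mass_low\<close> the two Loeb measures agree on the internal sets of lower
  order, a generator stable under intersection, hence on the generated
  \<open>\<sigma>\<close>-algebra.\<close>

lemma integral_low:
  fixes k :: "(nat \<Rightarrow> 'j \<Rightarrow> 'v) \<Rightarrow> real"
  assumes k: "k \<in> borel_measurable (sg low)"
  shows "integral\<^sup>L (loeb w1) k = integral\<^sup>L P k"
proof -
  let ?M = "restr_to_subalg (loeb w1) (sg low)" and ?N = "restr_to_subalg P (sg low)"
  note sub = subalgebra_sg[OF low_J weight_w1] subalgebra_sg[OF low_J weight_1]
  have em: "emeasure ?M (intl S) = emeasure (loeb w1) (intl S)" "emeasure ?N (intl S) = emeasure P (intl S)" if "S \<in> Alg low" for S
    using emeasure_restr_to_subalg[OF sub(1) intl_in_sg[OF that]] emeasure_restr_to_subalg[OF sub(2) intl_in_sg[OF that]] by auto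
  have cJ: "S \<in> cyl J" if "S \<in> Alg low" for S using Alg_cyl[OF low_J] that by auto
  have "?M = ?N"
  proof (rule measure_eqI_generator_eq)
    show "Int_stable (intl ` Alg low)"
      unfolding Int_stable_def by (auto simp: intl_Int[symmetric] intro!: imageI Alg.int)
    show "intl ` Alg low \<subseteq> Pow Omega" using intl_subset by auto
    show "emeasure ?M A = emeasure ?N A" if "A \<in> intl ` Alg low" for A
      using that em cJ by (auto simp: emeasure_loeb weight_w1 weight_1 mass_low)
    show "sets ?M = sigma_sets Omega (intl ` Alg low)" "sets ?N = sigma_sets Omega (intl ` Alg low)"
      using sub by (simp_all add: sets_restr_to_subalg sets_sg)
    show "range (\<lambda>_::nat. Omega) \<subseteq> intl ` Alg low" using Alg.full[of low] intl_X by auto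
    show "emeasure ?M Omega \<noteq> \<infinity>"
      using em(1)[OF Alg.full] emeasure_loeb[OF weight_w1 X_cyl] by (simp add: intl_X)
  qed simp
  then show ?thesis using integral_subalgebra2[OF sub(1) k] integral_subalgebra2[OF sub(2) k] by simp
qed

end

text \<open>One replacement step. The fibre average \<open>G\<close> of the other factors is unbounded and is compared
  with its truncation \<open>\<beta>\<close>; its majorant \<open>N\<close> is close to 1 in L2 by the linear forms condition.\<close>

locale counting_edge = relative_edge J V H d \<nu> U e1
  for J :: "'j set" and V :: "nat \<Rightarrow> 'j \<Rightarrow> 'v set" and H d \<nu> U e1 +
  fixes S :: "'j set set" and \<phi> :: "nat \<Rightarrow> 'j set \<Rightarrow> ('j \<Rightarrow> 'v) \<Rightarrow> real"
  assumes phi: "e \<in> L \<Longrightarrow> x \<in> PiE e (V n) \<Longrightarrow> 0 \<le> \<phi> n e x \<and> \<phi> n e x \<le> (if e \<in> S then \<nu> n e x else 1)"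
begin

definition F where "F n x = (\<Prod>e\<in>L. \<phi> n e (restrict x e))"
definition G where "G n x = av n (\<lambda>y. F n (glue e1 x y))"
definition N where "N n x = fibre (M (S \<times> UNIV)) n True x"
definition \<beta> where "\<beta> n x = min (G n x) 1"

text \<open>\<open>C\<close> is the set of active copies: both copies produce the square of
  \<open>G\<close>, one copy \<open>G\<close> itself.\<close>

lemma G_fibre: "fibre (\<lambda>n e c x. if c \<in> C then \<phi> n e x else 1) n c x = (if c \<in> C then G n x else 1)"
  by (simp add: fibre_def G_def F_def)

lemma N_fibre: "fibre (M (S \<times> C)) n c x = (if c \<in> C then N n x else 1)"
proof (cases "c \<in> C")
  case True
  then have "M (S \<times> C) n e c z = M (S \<times> UNIV) n e True z" for e z by (simp add: M_def)
  then show ?thesis using True unfolding fibre_def N_def by (simp only: if_True)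
next
  case False
  then have "M (S \<times> C) n e c z = 1" for e z by (simp add: M_def)
  then show ?thesis using False unfolding fibre_def by simp
qed

lemma L_restrict: "e \<in> L \<Longrightarrow> x \<in> X n \<Longrightarrow> restrict x e \<in> PiE e (V n)"
  by (rule restrict_X[OF _ H_J[OF L_H]])

lemma F_nonneg: "x \<in> X n \<Longrightarrow> 0 \<le> F n x"
  unfolding F_def using phi L_restrict by (intro prod_nonneg) blast

lemma G_bounds: assumes x: "x \<in> X n" shows "0 \<le> G n x" "G n x \<le> N n x"
proof -
  show "0 \<le> G n x" unfolding G_def using x by (intro avg_nonneg F_nonneg glue_X)
  show "G n x \<le> N n x" unfolding G_def F_def N_def fibre_def
  proof (intro avg_mono prod_mono conjI)
    fix y e assume y: "y \<in> X n" and e: "e \<in> L"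
    have r: "restrict (glue e1 x y) e \<in> PiE e (V n)" using L_restrict[OF e glue_X[OF x y]] .
    show "0 \<le> \<phi> n e (restrict (glue e1 x y) e)" "\<phi> n e (restrict (glue e1 x y) e) \<le> M (S \<times> UNIV) n e True (restrict (glue e1 x y) e)"
      using phi[OF e r] by (auto simp: M_def)
  qed
qed

lemma G_glue: "G n (glue e1 x y) = G n x"
proof -
  have "glue e1 (glue e1 x y) z = glue e1 x z" for z by (auto simp: glue_def)
  then show ?thesis by (simp add: G_def)
qed

lemma beta_glue: "\<beta> n (glue e1 x y) = \<beta> n x"
  by (simp add: \<beta>_def G_glue)

lemma i01_beta: "i01 \<beta>"
  using G_bounds by (auto simp: i01_def \<beta>_def)

lemma av_G:
  assumes "\<And>x y. x \<in> X n \<Longrightarrow> y \<in> X n \<Longrightarrow> k (glue e1 x y) = k x"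
  shows "av n (\<lambda>x. k x * F n x) = av n (\<lambda>x. k x * G n x)"
proof -
  have "av n (\<lambda>x. k x * F n x) = av n (\<lambda>x. av n (\<lambda>y. k (glue e1 x y) * F n (glue e1 x y)))"
    by (rule av_glue[symmetric])
  also have "\<dots> = av n (\<lambda>x. av n (\<lambda>y. k x * F n (glue e1 x y)))"
    using assms by (intro avg_cong) auto
  finally show ?thesis by (simp add: avg_cmult G_def)
qed

definition wb :: "bool \<Rightarrow> nat \<Rightarrow> ('j \<Rightarrow> 'v) \<Rightarrow> real" where "wb b n x = (if b then w1 n x else 1)"

lemma wb_nonneg: "x \<in> X n \<Longrightarrow> 0 \<le> wb b n x"
  using w1_nonneg by (simp add: wb_def)

lemma wb_1: "((\<lambda>n. av n (wb b n)) \<longlongrightarrow> 1) U"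
proof -
  have "wb True = w1" "wb False = (\<lambda>_ _. 1)" by (simp_all add: wb_def fun_eq_iff)
  then show ?thesis using av_w1 by (cases b) simp_all
qed

text \<open>Expanding the square, the three averages all tend to 1 and cancel as 1 - 2 + 1.\<close>

lemma N_variance: "((\<lambda>n. av n (\<lambda>x. wb b n x * (N n x - 1)\<^sup>2)) \<longlongrightarrow> 0) U"
proof -
  have 1: "((\<lambda>n. av n (\<lambda>x. wb b n x * N n x)) \<longlongrightarrow> 1) U"
    using fibre_M_moment[of b "S \<times> {False}"] unfolding N_fibre by (simp add: wb_def)
  have 2: "((\<lambda>n. av n (\<lambda>x. wb b n x * (N n x * N n x))) \<longlongrightarrow> 1) U"
    using fibre_M_moment[of b "S \<times> UNIV"] unfolding N_fibre by (simp add: wb_def)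
  have "((\<lambda>n. av n (\<lambda>x. wb b n x * (N n x * N n x)) - 2 * av n (\<lambda>x. wb b n x * N n x) + av n (wb b n)) \<longlongrightarrow> 1 - 2 * 1 + 1) U"
    by (intro tendsto_intros wb_1 1 2)
  moreover have "av n (\<lambda>x. wb b n x * (N n x * N n x)) - 2 * av n (\<lambda>x. wb b n x * N n x) + av n (wb b n)
      = av n (\<lambda>x. wb b n x * (N n x - 1)\<^sup>2)" for n
    unfolding avg_cmult[symmetric] avg_diff[symmetric] avg_add[symmetric]
    by (intro avg_cong) (simp add: power2_eq_square algebra_simps)
  ultimately show ?thesis by simp
qed

lemma N_deviation: "((\<lambda>n. av n (\<lambda>x. wb b n x * \<bar>N n x - 1\<bar>)) \<longlongrightarrow> 0) U"
proof -
  have "((\<lambda>n. sqrt (av n (wb b n) * av n (\<lambda>x. wb b n x * (N n x - 1)\<^sup>2))) \<longlongrightarrow> sqrt (1 * 0)) U"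
    by (intro tendsto_intros wb_1 N_variance)
  then have lim: "((\<lambda>n. sqrt (av n (wb b n) * av n (\<lambda>x. wb b n x * (N n x - 1)\<^sup>2))) \<longlongrightarrow> 0) U" by simp
  have bound: "norm (av n (\<lambda>x. wb b n x * \<bar>N n x - 1\<bar>)) \<le> sqrt (av n (wb b n) * av n (\<lambda>x. wb b n x * (N n x - 1)\<^sup>2))" for n
  proof -
    have "(av n (\<lambda>x. wb b n x * \<bar>N n x - 1\<bar>))\<^sup>2 \<le> av n (wb b n) * av n (\<lambda>x. wb b n x * \<bar>N n x - 1\<bar>\<^sup>2)"
      by (rule avg_Cauchy_Schwarz) (rule wb_nonneg)
    then show ?thesis by (intro real_le_rsqrt) simp
  qed
  show ?thesis by (rule Lim_null_comparison[OF always_eventually lim]) (intro allI bound)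
qed

text \<open>\<open>G\<close> exceeds 1 by at most \<open>\<bar>N - 1\<bar>\<close>, which is small
  in the mean by \<open>N_deviation\<close>.\<close>

lemma truncation: "((\<lambda>n. av n (\<lambda>x. wb b n x * \<bar>G n x - \<beta> n x\<bar>)) \<longlongrightarrow> 0) U"
proof (rule Lim_null_comparison[OF always_eventually N_deviation[of b]], intro allI)
  fix n
  have "av n (\<lambda>x. wb b n x * \<bar>G n x - \<beta> n x\<bar>) \<le> av n (\<lambda>x. wb b n x * \<bar>N n x - 1\<bar>)"
    using wb_nonneg G_bounds by (intro avg_mono mult_left_mono) (force simp: \<beta>_def min_def)+
  moreover have "0 \<le> av n (\<lambda>x. wb b n x * \<bar>G n x - \<beta> n x\<bar>)" using wb_nonneg by (intro avg_nonneg) auto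
  ultimately show "norm (av n (\<lambda>x. wb b n x * \<bar>G n x - \<beta> n x\<bar>)) \<le> av n (\<lambda>x. wb b n x * \<bar>N n x - 1\<bar>)" by simp
qed

text \<open>Where \<open>G\<close> exceeds 1, the difference is at most
  \<open>N\<^sup>2 - 1 = (N - 1)\<^sup>2 + 2 * (N - 1)\<close>, so control of the second moment of
  \<open>N\<close> suffices.\<close>

lemma truncation_sq: "((\<lambda>n. av n (\<lambda>x. wb b n x * \<bar>(G n x)\<^sup>2 - (\<beta> n x)\<^sup>2\<bar>)) \<longlongrightarrow> 0) U"
proof -
  let ?r = "\<lambda>n. av n (\<lambda>x. wb b n x * (N n x - 1)\<^sup>2) + 2 * av n (\<lambda>x. wb b n x * \<bar>N n x - 1\<bar>)"
  have r: "(?r \<longlongrightarrow> 0 + 2 * 0) U" by (intro tendsto_intros N_variance N_deviation)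
  have pt: "\<bar>(G n x)\<^sup>2 - (\<beta> n x)\<^sup>2\<bar> \<le> (N n x - 1)\<^sup>2 + 2 * \<bar>N n x - 1\<bar>" if x: "x \<in> X n" for n x
  proof (cases "G n x \<le> 1")
    case True then show ?thesis by (simp add: \<beta>_def)
  next
    case False
    then have "1 \<le> (G n x)\<^sup>2" "(G n x)\<^sup>2 \<le> (N n x)\<^sup>2" using G_bounds[OF x] by (auto intro: power_mono)
    moreover have "(N n x)\<^sup>2 = (N n x - 1)\<^sup>2 + 2 * (N n x - 1) + 1" by (simp add: power2_eq_square algebra_simps)
    moreover have "\<beta> n x = 1" using False by (simp add: \<beta>_def)
    moreover have "\<bar>g - 1\<bar> \<le> p + 2 * \<bar>q\<bar>" if "1 \<le> g" "g \<le> p + 2 * q + 1" for g p q :: real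
      using that by linarith
    ultimately show ?thesis by simp
  qed
  show ?thesis
  proof (rule Lim_null_comparison[OF always_eventually], intro allI)
    fix n
    have "av n (\<lambda>x. wb b n x * \<bar>(G n x)\<^sup>2 - (\<beta> n x)\<^sup>2\<bar>) \<le> av n (\<lambda>x. wb b n x * ((N n x - 1)\<^sup>2 + 2 * \<bar>N n x - 1\<bar>))"
      using wb_nonneg pt by (intro avg_mono mult_left_mono) auto
    also have "\<dots> = ?r n" unfolding avg_cmult[symmetric] avg_add[symmetric] by (intro avg_cong) (simp add: algebra_simps)
    finally show "norm (av n (\<lambda>x. wb b n x * \<bar>(G n x)\<^sup>2 - (\<beta> n x)\<^sup>2\<bar>)) \<le> ?r n"
      using wb_nonneg by (subst real_norm_def, subst abs_of_nonneg) (auto intro!: avg_nonneg)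
    show "(?r \<longlongrightarrow> 0) U" using r by simp
  qed
qed

text \<open>Since \<open>\<bar>w1 - 1\<bar> \<le> w1 + 1\<close>, smallness is required under the
  weighted and the uniform measure together; this explains the switch \<open>b\<close> in the
  preceding estimates.\<close>

lemma w1_bound_tendsto:
  assumes "\<And>b. ((\<lambda>n. av n (\<lambda>x. wb b n x * \<bar>f n x\<bar>)) \<longlongrightarrow> 0) U"
    and "\<And>n x. x \<in> X n \<Longrightarrow> \<bar>g n x\<bar> \<le> \<bar>f n x\<bar>"
  shows "((\<lambda>n. av n (\<lambda>x. (w1 n x - 1) * g n x)) \<longlongrightarrow> 0) U"
proof (rule Lim_null_comparison[OF always_eventually], intro allI)
  show "((\<lambda>n. av n (\<lambda>x. wb True n x * \<bar>f n x\<bar>) + av n (\<lambda>x. wb False n x * \<bar>f n x\<bar>)) \<longlongrightarrow> 0) U"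
    using tendsto_add[OF assms(1)[of True] assms(1)[of False]] by simp
  fix n
  have "\<bar>av n (\<lambda>x. (w1 n x - 1) * g n x)\<bar> \<le> av n (\<lambda>x. \<bar>w1 n x - 1\<bar> * \<bar>g n x\<bar>)"
    using avg_abs_le[of "X n" "\<lambda>x. (w1 n x - 1) * g n x"] by (simp add: abs_mult)
  also have "\<dots> \<le> av n (\<lambda>x. wb True n x * \<bar>f n x\<bar> + wb False n x * \<bar>f n x\<bar>)"
  proof (rule avg_mono)
    fix x assume x: "x \<in> X n"
    have "\<bar>w1 n x - 1\<bar> * \<bar>g n x\<bar> \<le> (w1 n x + 1) * \<bar>f n x\<bar>"
      using w1_nonneg[OF x] assms(2)[OF x] by (intro mult_mono) auto
    then show "\<bar>w1 n x - 1\<bar> * \<bar>g n x\<bar> \<le> wb True n x * \<bar>f n x\<bar> + wb False n x * \<bar>f n x\<bar>"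
      by (simp add: wb_def algebra_simps)
  qed
  finally show "norm (av n (\<lambda>x. (w1 n x - 1) * g n x)) \<le> av n (\<lambda>x. wb True n x * \<bar>f n x\<bar>) + av n (\<lambda>x. wb False n x * \<bar>f n x\<bar>)"
    by (simp add: avg_add)
qed

lemma dominated_phi: "dominated (S \<times> C) (\<lambda>n e c x. if c \<in> C then \<phi> n e x else 1)"
  unfolding dominated_def
proof clarify
  fix n e c x assume "e \<in> L" "x \<in> PiE e (V n)"
  from phi[OF this] show "0 \<le> (if c \<in> C then \<phi> n e x else 1) \<and> (if c \<in> C then \<phi> n e x else 1) \<le> M (S \<times> C) n e c x"
    by (auto simp: M_def split: if_splits)
qed

text \<open>\<open>\<nu> - 1\<close> does not correlate with \<open>(\<beta> - s)\<^sup>2\<close>: this transfers L2 approximations of \<open>\<beta>\<close> from the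
  uniform to the weighted measure.\<close>

lemma weighted_L2:
  assumes s: "s \<in> Step low"
  shows "((\<lambda>n. av n (\<lambda>x. (w1 n x - 1) * (\<beta> n x - s n x)\<^sup>2)) \<longlongrightarrow> 0) U"
proof -
  have s01: "\<And>n x. x \<in> X n \<Longrightarrow> 0 \<le> s n x \<and> s n x \<le> 1" using i01_Step[OF s] by (simp add: i01_def)
  \<comment> \<open>The square expands into \<open>\<beta>\<^sup>2\<close>,
    \<open>s * \<beta>\<close> and \<open>s\<^sup>2\<close>. In the first two terms
    \<open>\<beta>\<close> is exchanged for \<open>G\<close> at the cost of a truncation error,
    since orthogonality to \<open>w1 - 1\<close> is known for genuine fibre averages.\<close>
  have 1: "((\<lambda>n. av n (\<lambda>x. (w1 n x - 1) * (G n x)\<^sup>2)) \<longlongrightarrow> 0) U"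
    using strong_linear_forms_Span[OF Span_1 dominated_phi[of UNIV]] unfolding G_fibre
    by (simp add: power2_eq_square)
  have 2: "((\<lambda>n. av n (\<lambda>x. (w1 n x - 1) * ((\<beta> n x)\<^sup>2 - (G n x)\<^sup>2))) \<longlongrightarrow> 0) U"
    by (rule w1_bound_tendsto[OF truncation_sq]) (simp add: abs_minus_commute)
  have 3: "((\<lambda>n. av n (\<lambda>x. (w1 n x - 1) * s n x * G n x)) \<longlongrightarrow> 0) U"
    using strong_linear_forms_Span[OF Span_Step[OF s] dominated_phi[of "{False}"]] unfolding G_fibre by simp
  have 4: "((\<lambda>n. av n (\<lambda>x. (w1 n x - 1) * (s n x * (\<beta> n x - G n x)))) \<longlongrightarrow> 0) U"
    using s01 by (intro w1_bound_tendsto[OF truncation]) (auto simp: abs_mult abs_minus_commute intro!: mult_left_le_one_le)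
  have 5: "((\<lambda>n. av n (\<lambda>x. (w1 n x - 1) * (s n x * s n x))) \<longlongrightarrow> 0) U"
    using Span_weight[OF Span_mult[OF Span_Step[OF s] Span_Step[OF s]]] .
  have "((\<lambda>n. av n (\<lambda>x. (w1 n x - 1) * (G n x)\<^sup>2) + av n (\<lambda>x. (w1 n x - 1) * ((\<beta> n x)\<^sup>2 - (G n x)\<^sup>2))
      - 2 * (av n (\<lambda>x. (w1 n x - 1) * s n x * G n x) + av n (\<lambda>x. (w1 n x - 1) * (s n x * (\<beta> n x - G n x))))
      + av n (\<lambda>x. (w1 n x - 1) * (s n x * s n x))) \<longlongrightarrow> 0 + 0 - 2 * (0 + 0) + 0) U"
    by (intro tendsto_intros 1 2 3 4 5)
  moreover have "av n (\<lambda>x. (w1 n x - 1) * (G n x)\<^sup>2) + av n (\<lambda>x. (w1 n x - 1) * ((\<beta> n x)\<^sup>2 - (G n x)\<^sup>2))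
      - 2 * (av n (\<lambda>x. (w1 n x - 1) * s n x * G n x) + av n (\<lambda>x. (w1 n x - 1) * (s n x * (\<beta> n x - G n x))))
      + av n (\<lambda>x. (w1 n x - 1) * (s n x * s n x)) = av n (\<lambda>x. (w1 n x - 1) * (\<beta> n x - s n x)\<^sup>2)" for n
    unfolding avg_add[symmetric] avg_cmult[symmetric] avg_diff[symmetric]
    by (intro avg_cong) (simp add: power2_eq_square algebra_simps)
  ultimately show ?thesis by simp
qed

definition GJ where "GJ = (\<Union>e\<in>L. cyl e)"

lemma GJ_cyl: "GJ \<subseteq> cyl J"
  using cyl_mono L_H H_J unfolding GJ_def by blast

lemma slice_GJ:
  assumes "T \<in> GJ" "y \<in> Omega" shows "slice e1 y T \<in> Alg low"
proof -
  obtain e where e: "e \<in> L" "T \<in> cyl e" using assms by (auto simp: GJ_def)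
  have "e \<inter> e1 \<subset> e1" using L_not_subset(2)[OF e(1)] by auto
  then have "card (e \<inter> e1) < d" using psubset_card_mono[OF fin_e1] H_card[OF e1] by simp
  then have "cyl (e \<inter> e1) \<subseteq> low" unfolding gens_def by (intro UN_upper) auto
  then show ?thesis using slice_cyl[OF H_J[OF L_H[OF e(1)]] e(2) assms(2), of e1] by (auto intro: Alg.base)
qed

text \<open>By \<open>hyp\<close>, \<open>st \<beta>\<close> acts as the conditional expectation of
  \<open>\<Psi>\<close> on the coordinates in \<open>e1\<close>. Slicing shows that it has lower
  order up to a null set, so a step function \<open>s\<close> of lower order approximates it, first
  in uniform and then in weighted L2. Against \<open>s\<close>, the weight and the indicator of
  \<open>E\<close> may be exchanged for \<open>f\<close>.\<close>

proposition counting_step: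
  assumes \<Psi>: "\<Psi> \<in> borel_measurable (sg GJ)" "\<And>x. x \<in> Omega \<Longrightarrow> 0 \<le> \<Psi> x \<and> \<Psi> x \<le> (1::real)"
    and hyp: "\<And>b. i01 b \<Longrightarrow> (\<And>n x y. x \<in> X n \<Longrightarrow> y \<in> X n \<Longrightarrow> b n (glue e1 x y) = b n x) \<Longrightarrow>
      ((\<lambda>n. av n (\<lambda>x. b n x * F n x)) \<longlongrightarrow> (\<integral>x. st b x * \<Psi> x \<partial>P)) U"
    and E: "E \<in> cyl e1" and f: "is_ce w1 low (indicator (intl E)) f"
  shows "((\<lambda>n. av n (\<lambda>x. (w1 n x * indicator (E n) x) * F n x)) \<longlongrightarrow> (\<integral>x. f x * \<Psi> x \<partial>P)) U"
proof -
  have u\<Psi>: "ub \<Psi>" using ub_sg[OF GJ_cyl \<Psi>] .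
  have u\<beta>: "ub (st \<beta>)" using ub_st[OF i01_beta] .
  have ff: "f \<in> borel_measurable (sg low)" "\<And>x. x \<in> Omega \<Longrightarrow> 0 \<le> f x \<and> f x \<le> 1" using f by (auto simp: is_ce_def)
  have uf: "ub f" using ub_sg[OF low_J ff] .
  have \<beta>_int: "(\<integral>x. st b x * st \<beta> x \<partial>P) = (\<integral>x. st b x * \<Psi> x \<partial>P)"
    if b: "i01 b" "\<And>n x y. x \<in> X n \<Longrightarrow> y \<in> X n \<Longrightarrow> b n (glue e1 x y) = b n x" for b
  proof -
    have "((\<lambda>n. av n (\<lambda>x. b n x * F n x) - av n (\<lambda>x. b n x * \<beta> n x)) \<longlongrightarrow> (\<integral>x. st b x * \<Psi> x \<partial>P) - (\<integral>x. st b x * st \<beta> x \<partial>P)) U"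
      by (rule tendsto_diff[OF hyp[OF b] ub_lim[OF b(1) i01_beta]])
    moreover have "((\<lambda>n. av n (\<lambda>x. b n x * F n x) - av n (\<lambda>x. b n x * \<beta> n x)) \<longlongrightarrow> 0) U"
    proof (rule Lim_null_comparison[OF always_eventually truncation[of False]], intro allI)
      fix n
      have "av n (\<lambda>x. b n x * F n x) - av n (\<lambda>x. b n x * \<beta> n x) = av n (\<lambda>x. b n x * (G n x - \<beta> n x))"
        using av_G[of n "b n"] b(2) by (simp add: right_diff_distrib avg_diff)
      also have "\<bar>\<dots>\<bar> \<le> av n (\<lambda>x. \<bar>G n x - \<beta> n x\<bar>)"
        using b(1) by (intro order_trans[OF avg_abs_le] avg_mono) (auto simp: abs_mult i01_def intro!: mult_left_le_one_le)
      finally show "norm (av n (\<lambda>x. b n x * F n x) - av n (\<lambda>x. b n x * \<beta> n x)) \<le> av n (\<lambda>x. wb False n x * \<bar>G n x - \<beta> n x\<bar>)"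
        by (simp add: wb_def)
    qed
    ultimately have "(\<integral>x. st b x * \<Psi> x \<partial>P) - (\<integral>x. st b x * st \<beta> x \<partial>P) = 0" by (rule tendsto_unique[OF U_nontrivial])
    then show ?thesis by simp
  qed
  have low_int: "(\<integral>x. k x * st \<beta> x \<partial>P) = (\<integral>x. k x * \<Psi> x \<partial>P)"
    if k: "k \<in> borel_measurable (sg low)" "\<And>x. x \<in> Omega \<Longrightarrow> 0 \<le> k x \<and> k x \<le> 1" for k
  proof (rule eq_if_close[where C=2])
    fix K :: nat assume K: "K > 0"
    then have "1 / real K > 0" by simp
    then obtain s where s: "s \<in> Step low" "(\<integral>x. \<bar>k x - st s x\<bar> \<partial>P) \<le> 1 / real K"
      using step_approx[OF weight_1 low_J k] by blast
    note us = ub_st[OF i01_Step[OF s(1)]] and uk = ub_sg[OF low_J k]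
    have "(\<integral>x. st s x * st \<beta> x \<partial>P) = (\<integral>x. st s x * \<Psi> x \<partial>P)"
      by (rule \<beta>_int[OF i01_Step[OF s(1)] Step_glue[OF s(1) low_cyl e1_J]])
    then show "\<bar>(\<integral>x. k x * st \<beta> x \<partial>P) - (\<integral>x. k x * \<Psi> x \<partial>P)\<bar> \<le> 2 / K"
      using ub_L1(1)[OF uk us u\<beta> s(2)] ub_L1(1)[OF uk us u\<Psi> s(2)] by linarith
  qed
  have \<beta>_meas: "st \<beta> \<in> borel_measurable (sg (cyl e1))"
    by (rule st_measurable_cyl[OF e1_J i01_beta]) (rule beta_glue)
  have \<beta>01: "\<And>x. x \<in> Omega \<Longrightarrow> 0 \<le> st \<beta> x \<and> st \<beta> x \<le> 1" using st_bounds[OF i01_beta] by blast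
  obtain g where g: "is_ce unit_weight low (st \<beta>) g"
    using ce_exists[OF weight_1 low_J measurable_sg_loeb[OF _ weight_1 \<beta>_meas] \<beta>01] cyl_mono[OF e1_J order_refl] by blast
  have gg: "g \<in> borel_measurable (sg low)" "\<And>x. x \<in> Omega \<Longrightarrow> 0 \<le> g x \<and> g x \<le> 1" using g by (auto simp: is_ce_def)
  have ug: "ub g" using ub_sg[OF low_J gg] .
  \<comment> \<open>The following identities equate the integrals of
    \<open>st \<beta> * st \<beta>\<close>, \<open>g * st \<beta>\<close> and \<open>g * g\<close>,
    so the square of \<open>st \<beta> - g\<close> integrates to 0. This first link is the decisive
    one: the other edges meet \<open>e1\<close> in proper subsets.\<close>
  have "(\<integral>x. st \<beta> x * \<Psi> x \<partial>P) = (\<integral>x. g x * \<Psi> x \<partial>P)"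
    by (rule ce_slices[OF e1_J low_cyl GJ_cyl slice_GJ \<beta>_meas \<beta>01 g \<Psi>])
  moreover have "(\<integral>x. st \<beta> x * st \<beta> x \<partial>P) = (\<integral>x. st \<beta> x * \<Psi> x \<partial>P)" by (rule \<beta>_int[OF i01_beta]) (rule beta_glue)
  moreover have "(\<integral>x. g x * st \<beta> x \<partial>P) = (\<integral>x. g x * \<Psi> x \<partial>P)" by (rule low_int[OF gg])
  moreover have "(\<integral>x. st \<beta> x * g x \<partial>P) = (\<integral>x. g x * g x \<partial>P)" using g gg unfolding is_ce_def by simp
  moreover have "(\<integral>x. st \<beta> x * g x \<partial>P) = (\<integral>x. g x * st \<beta> x \<partial>P)" by (simp add: mult.commute)
  ultimately have e: "(\<integral>x. st \<beta> x * st \<beta> x \<partial>P) = (\<integral>x. g x * g x \<partial>P)" "(\<integral>x. g x * st \<beta> x \<partial>P) = (\<integral>x. g x * g x \<partial>P)" by auto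
  have i: "integrable P (\<lambda>x. st \<beta> x * st \<beta> x)" "integrable P (\<lambda>x. g x * st \<beta> x)" "integrable P (\<lambda>x. g x * g x)"
    using ub_integrable ub_mult ug u\<beta> by blast+
  have sq: "(\<lambda>x. (st \<beta> x - g x)\<^sup>2) = (\<lambda>x. st \<beta> x * st \<beta> x - 2 * (g x * st \<beta> x) + g x * g x)"
    by (simp add: power2_eq_square algebra_simps fun_eq_iff)
  have "(\<integral>x. (st \<beta> x - g x)\<^sup>2 \<partial>P) = 0" "integrable P (\<lambda>x. (st \<beta> x - g x)\<^sup>2)"
    unfolding sq using i e by simp_all
  then have "AE x in P. (st \<beta> x - g x)\<^sup>2 = 0"
    by (subst (asm) integral_nonneg_eq_0_iff_AE) auto
  then have AE: "AE x in P. st \<beta> x = g x" by eventually_elim simp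
  have f\<beta>: "(\<integral>x. f x * st \<beta> x \<partial>P) = (\<integral>x. f x * \<Psi> x \<partial>P)" by (rule low_int[OF ff])
  let ?a = "\<lambda>n. av n (\<lambda>x. (w1 n x * indicator (E n) x) * F n x)" and ?l = "\<integral>x. f x * \<Psi> x \<partial>P"
  have Ei: "indicator (E n) (glue e1 x y) = (indicator (E n) x :: real)" if "x \<in> X n" "y \<in> X n" for n x y
    using cyl_glue_iff[OF e1_J E that] by (simp add: indicator_def)
  show ?thesis
  proof (rule tendstoI)
    fix \<epsilon> :: real assume \<epsilon>: "\<epsilon> > 0"
    \<comment> \<open>In the limit the error is at most \<open>sqrt \<eta> + \<eta>\<close>. The
      square gives \<open>sqrt \<eta> \<le> \<epsilon> / 3\<close>, and the bound by 1 gives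
      \<open>\<eta> \<le> sqrt \<eta>\<close>.\<close>
    define \<eta> where "\<eta> = min 1 ((\<epsilon> / 3)\<^sup>2)"
    have \<eta>: "\<eta> > 0" "\<eta> \<le> 1" using \<epsilon> by (auto simp: \<eta>_def)
    have "sqrt \<eta> \<le> sqrt ((\<epsilon> / 3)\<^sup>2)" by (intro real_sqrt_le_mono) (simp add: \<eta>_def)
    then have sq\<eta>: "sqrt \<eta> \<le> \<epsilon> / 3" using \<epsilon> by simp
    have \<eta>sq: "\<eta> \<le> sqrt \<eta>" using \<eta> by (intro real_le_rsqrt) (simp add: power2_eq_square mult_left_le_one_le)
    obtain s where s: "s \<in> Step low" "(\<integral>x. \<bar>g x - st s x\<bar> \<partial>P) \<le> \<eta>"
      using step_approx[OF weight_1 low_J gg \<eta>(1)] by blast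
    note i_s = i01_Step[OF s(1)] and us = ub_st[OF i01_Step[OF s(1)]]
    have m: "st \<beta> \<in> borel_measurable P" "g \<in> borel_measurable P" "st s \<in> borel_measurable P" using u\<beta> ug us by (auto simp: ub_def)
    have close: "(\<integral>x. \<bar>st s x - st \<beta> x\<bar> \<partial>P) \<le> \<eta>"
    proof -
      have "(\<integral>x. \<bar>st s x - st \<beta> x\<bar> \<partial>P) = (\<integral>x. \<bar>g x - st s x\<bar> \<partial>P)"
        using AE m by (intro integral_cong_AE) (auto simp: abs_minus_commute elim: eventually_mono)
      then show ?thesis using s(2) by simp
    qed
    define Q where "Q = (\<integral>x. st \<beta> x * st \<beta> x \<partial>P) - 2 * (\<integral>x. st s x * st \<beta> x \<partial>P) + (\<integral>x. st s x * st s x \<partial>P)"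
    \<comment> \<open>For functions with values in [0,1] the squared L2 distance is at most the L1
      distance.\<close>
    have Q: "Q \<le> \<eta>"
    proof -
      have i: "integrable P (\<lambda>x. st \<beta> x * st \<beta> x)" "integrable P (\<lambda>x. st s x * st \<beta> x)" "integrable P (\<lambda>x. st s x * st s x)"
        using ub_integrable ub_mult us u\<beta> by blast+
      have "Q = (\<integral>x. st \<beta> x * st \<beta> x - 2 * (st s x * st \<beta> x) + st s x * st s x \<partial>P)" using i by (simp add: Q_def)
      also have "\<dots> \<le> (\<integral>x. \<bar>st s x - st \<beta> x\<bar> \<partial>P)"
      proof (rule integral_mono)
        show "integrable P (\<lambda>x. st \<beta> x * st \<beta> x - 2 * (st s x * st \<beta> x) + st s x * st s x)" using i by simp
        show "integrable P (\<lambda>x. \<bar>st s x - st \<beta> x\<bar>)" using ub_integrable us u\<beta> by (intro integrable_abs Bochner_Integration.integrable_diff) auto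
        fix x assume "x \<in> space P"
        then have "\<bar>st s x - st \<beta> x\<bar> \<le> 1" using us u\<beta> by (fastforce simp: ub_def space_loeb weight_1)
        then have "\<bar>st s x - st \<beta> x\<bar> * \<bar>st s x - st \<beta> x\<bar> \<le> \<bar>st s x - st \<beta> x\<bar>" by (intro mult_left_le_one_le) auto
        then show "st \<beta> x * st \<beta> x - 2 * (st s x * st \<beta> x) + st s x * st s x \<le> \<bar>st s x - st \<beta> x\<bar>"
          by (simp add: abs_mult_self_eq algebra_simps)
      qed
      finally show ?thesis using close by simp
    qed
    let ?B = "\<lambda>n. av n (\<lambda>x. w1 n x * (\<beta> n x - s n x)\<^sup>2)"
    have B: "(?B \<longlongrightarrow> Q) U"
    proof -
      have "((\<lambda>n. av n (\<lambda>x. (w1 n x - 1) * (\<beta> n x - s n x)\<^sup>2) +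
          (av n (\<lambda>x. \<beta> n x * \<beta> n x) - 2 * av n (\<lambda>x. s n x * \<beta> n x) + av n (\<lambda>x. s n x * s n x))) \<longlongrightarrow> 0 + Q) U"
        unfolding Q_def by (intro tendsto_intros weighted_L2 s ub_lim i01_beta i_s)
      moreover have "av n (\<lambda>x. (w1 n x - 1) * (\<beta> n x - s n x)\<^sup>2) +
          (av n (\<lambda>x. \<beta> n x * \<beta> n x) - 2 * av n (\<lambda>x. s n x * \<beta> n x) + av n (\<lambda>x. s n x * s n x)) = ?B n" for n
        unfolding avg_add[symmetric] avg_cmult[symmetric] avg_diff[symmetric]
        by (intro avg_cong) (simp add: power2_eq_square algebra_simps)
      ultimately show ?thesis by simp
    qed
    let ?c = "\<lambda>n. av n (\<lambda>x. (indicator (E n) x * s n x) * w1 n x)"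
    have c: "(?c \<longlongrightarrow> (\<integral>x. f x * st s x \<partial>P)) U"
    proof -
      have iE: "i01 (\<lambda>n. indicator (E n))" by (simp add: i01_def indicator_def)
      have "st (\<lambda>n x. indicator (E n) x * s n x) x = indicator (intl E) x * st s x" if "x \<in> Omega" for x
        using st_mult[OF iE i_s that] ul_eqI[OF indicator_tendsto[OF that]] by (simp add: st_def)
      then have "(\<integral>x. st (\<lambda>n x. indicator (E n) x * s n x) x \<partial>loeb w1) = (\<integral>x. indicator (intl E) x * st s x \<partial>loeb w1)"
        by (intro Bochner_Integration.integral_cong) (auto simp: space_loeb weight_w1)
      also have "\<dots> = (\<integral>x. f x * st s x \<partial>loeb w1)"
        using f st_Step_measurable[OF s(1)] st_bounds[OF i_s] unfolding is_ce_def by simp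
      also have "\<dots> = (\<integral>x. f x * st s x \<partial>P)"
        using ff(1) st_Step_measurable[OF s(1)] by (intro integral_low) measurable
      finally show ?thesis using integral_st[OF weight_w1 i01_mult[OF iE i_s]] by simp
    qed
    have fs: "\<bar>(\<integral>x. f x * st s x \<partial>P) - ?l\<bar> \<le> \<eta>"
      using ub_L1(2)[OF us u\<beta> uf close] f\<beta> by simp
    let ?r = "\<lambda>n. av n (\<lambda>x. wb True n x * \<bar>G n x - \<beta> n x\<bar>) + sqrt (av n (w1 n) * ?B n) + \<bar>?c n - (\<integral>x. f x * st s x \<partial>P)\<bar> + \<eta>"
    have "(?r \<longlongrightarrow> 0 + sqrt (1 * Q) + \<bar>(\<integral>x. f x * st s x \<partial>P) - (\<integral>x. f x * st s x \<partial>P)\<bar> + \<eta>) U"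
      by (intro tendsto_intros truncation av_w1 B c)
    moreover have "sqrt (1 * Q) \<le> sqrt \<eta>" using Q by simp
    then have "sqrt (1 * Q) + \<eta> < \<epsilon>" using sq\<eta> \<eta>sq \<epsilon> by linarith
    then have "0 + sqrt (1 * Q) + \<bar>(\<integral>x. f x * st s x \<partial>P) - (\<integral>x. f x * st s x \<partial>P)\<bar> + \<eta> < \<epsilon>" by simp
    ultimately have "eventually (\<lambda>n. ?r n < \<epsilon>) U" by (rule order_tendstoD)
    then show "eventually (\<lambda>n. dist (?a n) ?l < \<epsilon>) U"
    proof eventually_elim
      case (elim n)
      have "?a n = av n (\<lambda>x. (w1 n x * indicator (E n) x) * G n x)"
        using Ei w1_glue by (intro av_G) simp
      then have ac: "?a n - ?c n = av n (\<lambda>x. w1 n x * (indicator (E n) x * (G n x - s n x)))"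
        unfolding avg_diff[symmetric] by (simp add: algebra_simps avg_diff)
      have "\<bar>av n (\<lambda>x. w1 n x * (indicator (E n) x * (G n x - s n x)))\<bar>
          \<le> av n (\<lambda>x. wb True n x * \<bar>G n x - \<beta> n x\<bar> + w1 n x * \<bar>\<beta> n x - s n x\<bar>)"
      proof (rule order_trans[OF avg_abs_le], rule avg_mono)
        fix x assume x: "x \<in> X n"
        have "\<bar>indicator (E n) x * (G n x - s n x)\<bar> \<le> \<bar>G n x - \<beta> n x\<bar> + \<bar>\<beta> n x - s n x\<bar>" by (auto simp: indicator_def)
        then show "\<bar>w1 n x * (indicator (E n) x * (G n x - s n x))\<bar> \<le> wb True n x * \<bar>G n x - \<beta> n x\<bar> + w1 n x * \<bar>\<beta> n x - s n x\<bar>"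
          using w1_nonneg[OF x] by (simp add: abs_mult wb_def distrib_left[symmetric] mult_left_mono)
      qed
      moreover have "av n (\<lambda>x. wb True n x * \<bar>G n x - \<beta> n x\<bar> + w1 n x * \<bar>\<beta> n x - s n x\<bar>)
          = av n (\<lambda>x. wb True n x * \<bar>G n x - \<beta> n x\<bar>) + av n (\<lambda>x. w1 n x * \<bar>\<beta> n x - s n x\<bar>)" by (rule avg_add)
      moreover have "av n (\<lambda>x. w1 n x * \<bar>\<beta> n x - s n x\<bar>) \<le> sqrt (av n (w1 n) * ?B n)"
      proof -
        have "(av n (\<lambda>x. w1 n x * \<bar>\<beta> n x - s n x\<bar>))\<^sup>2 \<le> av n (w1 n) * av n (\<lambda>x. w1 n x * \<bar>\<beta> n x - s n x\<bar>\<^sup>2)"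
          by (rule avg_Cauchy_Schwarz) (rule w1_nonneg)
        then show ?thesis by (intro real_le_rsqrt) simp
      qed
      ultimately have "\<bar>?a n - ?c n\<bar> \<le> av n (\<lambda>x. wb True n x * \<bar>G n x - \<beta> n x\<bar>) + sqrt (av n (w1 n) * ?B n)"
        unfolding ac by linarith
      then show ?case using elim fs unfolding dist_real_def by linarith
    qed
  qed
qed

end

section \<open>Counting and removal for all edges together\<close>

locale relative_system = linear_forms_system J V H d \<nu> U + loeb_setting J V U
  for J :: "'j set" and V :: "nat \<Rightarrow> 'j \<Rightarrow> 'v set" and H d \<nu> U +
  fixes E :: "'j set \<Rightarrow> nat \<Rightarrow> ('j \<Rightarrow> 'v) set"
  assumes E: "e \<in> H \<Longrightarrow> E e \<in> cyl e"
begin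

lemma relative_edge: "e \<in> H \<Longrightarrow> relative_edge J V H d \<nu> U e"
  by (intro relative_edge.intro linear_forms_edge.intro linear_forms_edge_axioms.intro
      linear_forms_system_axioms loeb_setting_axioms)

abbreviation wt where "wt e \<equiv> \<lambda>n x. \<nu> n e (restrict x e)"

lemma weight_wt: "e \<in> H \<Longrightarrow> weight (wt e)"
  using relative_edge.weight_w1[OF relative_edge] .

lemma intl_E_sets: "e \<in> H \<Longrightarrow> weight w \<Longrightarrow> intl (E e) \<in> sets (loeb w)"
  using E[of e] cyl_mono[OF H_J order_refl, of e] by (auto simp: sets_loeb)

definition ft where "ft e = (SOME f. is_ce (wt e) (gens (d - 1) e) (indicator (intl (E e))) f)"

lemma ft: assumes e: "e \<in> H" shows "is_ce (wt e) (gens (d - 1) e) (indicator (intl (E e))) (ft e)"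
proof -
  have "(indicator (intl (E e)) :: _ \<Rightarrow> real) \<in> borel_measurable (loeb (wt e))"
    using intl_E_sets[OF e weight_wt[OF e]] by (rule borel_measurable_indicator)
  then have "\<exists>f. is_ce (wt e) (gens (d - 1) e) (indicator (intl (E e))) f"
    by (rule ce_exists[OF weight_wt[OF e] gens_cyl_J[OF H_J[OF e]]]) (simp add: indicator_def)
  then show ?thesis unfolding ft_def by (rule someI_ex)
qed

lemma ft_meas: "e \<in> H \<Longrightarrow> ft e \<in> borel_measurable (sg (gens (d - 1) e))"
  and ft_bounds: "e \<in> H \<Longrightarrow> x \<in> Omega \<Longrightarrow> 0 \<le> ft e x \<and> ft e x \<le> 1"
  using ft by (auto simp: is_ce_def)

definition base where "base n = (SOME x. x \<in> X n)"

lemma base: "base n \<in> X n"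
  unfolding base_def using X_nonempty[of n] by (simp add: some_in_eq)

lemma glue_restrict: "glue e (restrict x e) y = glue e x y"
  by (auto simp: glue_def)

lemma glue_PiE: "e \<subseteq> J \<Longrightarrow> z \<in> PiE e (V n) \<Longrightarrow> y \<in> X n \<Longrightarrow> glue e z y \<in> X n"
  by (auto simp: X_def glue_def PiE_iff extensional_def)

text \<open>A function on \<open>V_e\<close> is needed, while \<open>E e n\<close> consists of
  points of \<open>V_J\<close>. The missing coordinates come from a base point, whose choice is
  immaterial because \<open>E e n\<close> is a cylinder over \<open>e\<close>.\<close>

definition fE where "fE n e z = \<nu> n e z * indicator (E e n) (glue e z (base n))"

lemma fE_restrict:
  assumes e: "e \<in> H" and x: "x \<in> X n"
  shows "fE n e (restrict x e) = wt e n x * indicator (E e n) x"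
  using cyl_glue_iff[OF H_J[OF e] E[OF e] x base] by (simp add: fE_def glue_restrict indicator_def)

definition unit_family where
  "unit_family b \<longleftrightarrow> (\<forall>n. \<forall>e\<in>H. \<forall>z\<in>PiE e (V n). 0 \<le> b n e z \<and> b n e z \<le> (1::real))"

lemma i01_unit_family: "unit_family b \<Longrightarrow> e \<in> H \<Longrightarrow> i01 (\<lambda>n x. b n e (restrict x e))"
  using restrict_X[OF _ H_J] unfolding i01_def unit_family_def by blast

text \<open>Induction on the set \<open>S\<close> of edges carrying weights. Arbitrary bounded
  functions on the other edges are allowed because the induction hypothesis must supply
  \<open>hyp\<close> of \<open>counting_step\<close>, where a test function \<open>b'\<close> takes
  the place of the weighted factor on \<open>e1\<close>.\<close>

proposition counting:
  assumes "finite S" "S \<subseteq> H" "unit_family b"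
  shows "((\<lambda>n. av n (\<lambda>x. \<Prod>e\<in>H. (if e \<in> S then fE n e else b n e) (restrict x e))) \<longlongrightarrow>
    (\<integral>x. (\<Prod>e\<in>H. if e \<in> S then ft e x else st (\<lambda>n x. b n e (restrict x e)) x) \<partial>P)) U"
  using assms
proof (induction S arbitrary: b rule: finite_induct)
  case empty
  note i = i01_unit_family[OF empty(2)]
  have eq: "(\<integral>x. st (\<lambda>n x. \<Prod>e\<in>H. b n e (restrict x e)) x \<partial>P) = (\<integral>x. (\<Prod>e\<in>H. st (\<lambda>n x. b n e (restrict x e)) x) \<partial>P)"
    by (intro Bochner_Integration.integral_cong refl st_prod i) (simp_all add: space_loeb weight_1)
  have "i01 (\<lambda>n x. \<Prod>e\<in>H. b n e (restrict x e))" by (rule i01_prod) (rule i)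
  from integral_st[OF weight_1 this] show ?case unfolding eq by (simp only: empty_iff if_False mult_1_right)
next
  case (insert e1 S)
  then have e1H: "e1 \<in> H" and SH: "S \<subseteq> H" by auto
  define \<phi> where "\<phi> n e = (if e \<in> S then fE n e else b n e)" for n e
  interpret relative_edge J V H d \<nu> U e1 by (rule relative_edge[OF e1H])
  have LH: "L = H - {e1}" by (rule L_def)
  interpret counting_edge J V H d \<nu> U e1 S \<phi>
  proof unfold_locales
    fix e x n assume e: "e \<in> L" and x: "x \<in> PiE e (V n)"
    show "0 \<le> \<phi> n e x \<and> \<phi> n e x \<le> (if e \<in> S then \<nu> n e x else 1)"
      using nu_nonneg[OF L_H[OF e] x] insert(5) x L_H[OF e]
      by (auto simp: \<phi>_def fE_def indicator_def unit_family_def)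
  qed
  let ?p = "\<lambda>e x. if e \<in> S then ft e x else st (\<lambda>n x. b n e (restrict x e)) x"
  define \<Psi> where "\<Psi> x = (\<Prod>e\<in>L. ?p e x)" for x
  have p_meas: "?p e \<in> borel_measurable (sg GJ)" if e: "e \<in> L" for e
  proof -
    have G: "cyl e \<subseteq> GJ" "gens (d - 1) e \<subseteq> GJ"
      using e gens_cyl[OF H_J[OF L_H[OF e]]] by (auto simp: GJ_def)
    have "st (\<lambda>n x. b n e (restrict x e)) \<in> borel_measurable (sg (cyl e))"
      by (rule st_measurable_cyl[OF H_J[OF L_H[OF e]] i01_unit_family[OF insert(5) L_H[OF e]]]) (simp only: restrict_glue)
    then show ?thesis
      using measurable_sg_mono[OF G(1)] measurable_sg_mono[OF G(2) ft_meas[OF L_H[OF e]]] by (cases "e \<in> S") simp_all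
  qed
  have p_bounds: "0 \<le> ?p e x \<and> ?p e x \<le> 1" if "e \<in> L" "x \<in> Omega" for e x
    using ft_bounds[OF L_H[OF that(1)] that(2)] st_bounds[OF i01_unit_family[OF insert(5) L_H[OF that(1)]] that(2)]
    by (cases "e \<in> S") (simp_all only: if_True if_False simp_thms)
  have \<Psi>: "\<Psi> \<in> borel_measurable (sg GJ)" "\<And>x. x \<in> Omega \<Longrightarrow> 0 \<le> \<Psi> x \<and> \<Psi> x \<le> 1"
    unfolding \<Psi>_def using p_meas p_bounds by (auto intro!: borel_measurable_prod prod_nonneg prod_le_1)
  have remove: "(\<Prod>e\<in>H. h e) = h e1 * (\<Prod>e\<in>L. h e)" for h :: "'j set \<Rightarrow> real"
    unfolding LH using finite_H e1 by (simp add: prod.remove)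
  have neq: "e \<noteq> e1" if "e \<in> L" for e using that LH by auto
  have hyp: "((\<lambda>n. av n (\<lambda>x. b' n x * F n x)) \<longlongrightarrow> (\<integral>x. st b' x * \<Psi> x \<partial>P)) U"
    if b': "i01 b'" "\<And>n x y. x \<in> X n \<Longrightarrow> y \<in> X n \<Longrightarrow> b' n (glue e1 x y) = b' n x" for b'
  proof -
    define c where "c n e = (if e = e1 then (\<lambda>z. b' n (glue e1 z (base n))) else b n e)" for n e
    have c: "unit_family c"
      using insert(5) b'(1) glue_PiE[OF e1_J _ base] by (auto simp: unit_family_def c_def i01_def)
    have ce1: "c n e1 (restrict x e1) = b' n x" if "x \<in> X n" for n x
      using b'(2)[OF that base] by (simp add: c_def glue_restrict)
    have "av n (\<lambda>x. \<Prod>e\<in>H. (if e \<in> S then fE n e else c n e) (restrict x e)) = av n (\<lambda>x. b' n x * F n x)" for n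
      unfolding remove F_def using insert(2) ce1 neq by (intro avg_cong arg_cong2[where f="(*)"] prod.cong) (auto simp: \<phi>_def c_def)
    moreover have "(\<integral>x. (\<Prod>e\<in>H. if e \<in> S then ft e x else st (\<lambda>n x. c n e (restrict x e)) x) \<partial>P) = (\<integral>x. st b' x * \<Psi> x \<partial>P)"
    proof (rule Bochner_Integration.integral_cong[OF refl])
      fix x assume "x \<in> space P"
      then have x: "\<And>n. x n \<in> X n" by (simp add: space_loeb weight_1 Omega_def)
      have "st (\<lambda>n x. c n e1 (restrict x e1)) x = st b' x" unfolding st_def using ce1[OF x] by simp
      then show "(\<Prod>e\<in>H. if e \<in> S then ft e x else st (\<lambda>n x. c n e (restrict x e)) x) = st b' x * \<Psi> x"
        unfolding remove \<Psi>_def using insert(2) neq by (intro arg_cong2[where f="(*)"] prod.cong) (auto simp: c_def)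
    qed
    ultimately show ?thesis using insert(3)[OF SH c] by (simp only:)
  qed
  have lim: "((\<lambda>n. av n (\<lambda>x. (w1 n x * indicator (E e1 n) x) * F n x)) \<longlongrightarrow> (\<integral>x. ft e1 x * \<Psi> x \<partial>P)) U"
    by (rule counting_step[OF \<Psi> hyp E[OF e1H] ft[OF e1H]])
  have "av n (\<lambda>x. \<Prod>e\<in>H. (if e \<in> insert e1 S then fE n e else b n e) (restrict x e)) = av n (\<lambda>x. (w1 n x * indicator (E e1 n) x) * F n x)" for n
    unfolding remove F_def using neq fE_restrict[OF e1H]
    by (intro avg_cong arg_cong2[where f="(*)"] prod.cong) (auto simp: \<phi>_def)
  moreover have "(\<Prod>e\<in>H. if e \<in> insert e1 S then ft e x else st (\<lambda>n x. b n e (restrict x e)) x) = ft e1 x * \<Psi> x" for x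
    unfolding remove \<Psi>_def using neq by (intro arg_cong2[where f="(*)"] prod.cong) auto
  ultimately show ?case using lim by (simp only:)
qed

theorem limit_removal:
  assumes small: "((\<lambda>n. av n (\<lambda>x. \<Prod>e\<in>H. indicator (E e n) x * wt e n x)) \<longlongrightarrow> 0) U"
    and H: "H \<noteq> {}" and \<epsilon>: "\<epsilon> > 0"
  shows "\<exists>E'. (\<forall>e\<in>H. E' e \<in> Alg (gens (d - 1) e)) \<and>
    eventually (\<lambda>n. X n \<inter> (\<Inter>e\<in>H. E' e n) = {}) U \<and>
    (\<forall>e\<in>H. eventually (\<lambda>n. av n (\<lambda>x. indicator (E e n - E' e n) x * wt e n x) < \<epsilon>) U)"
proof -
  have "((\<lambda>n. av n (\<lambda>x. \<Prod>e\<in>H. (if e \<in> H then fE n e else (\<lambda>_. 1)) (restrict x e))) \<longlongrightarrow>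
      (\<integral>x. (\<Prod>e\<in>H. if e \<in> H then ft e x else st (\<lambda>n x. (\<lambda>_. 1) (restrict x e)) x) \<partial>P)) U"
    by (rule counting[where b="\<lambda>n e z. 1"]) (simp_all add: finite_H unit_family_def)
  moreover have "av n (\<lambda>x. \<Prod>e\<in>H. (if e \<in> H then fE n e else (\<lambda>_. 1)) (restrict x e)) = av n (\<lambda>x. \<Prod>e\<in>H. indicator (E e n) x * wt e n x)" for n
    using fE_restrict by (intro avg_cong prod.cong) (auto simp: mult.commute)
  moreover have "(\<Prod>e\<in>H. if e \<in> H then ft e x else st (\<lambda>n x. (\<lambda>_. 1) (restrict x e)) x) = (\<Prod>e\<in>H. ft e x)" for x
    by (rule prod.cong) auto
  ultimately have "((\<lambda>n. av n (\<lambda>x. \<Prod>e\<in>H. indicator (E e n) x * wt e n x)) \<longlongrightarrow> (\<integral>x. (\<Prod>e\<in>H. ft e x) \<partial>P)) U" by (simp only:)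
  then have int0: "(\<integral>x. (\<Prod>e\<in>H. ft e x) \<partial>P) = 0" by (rule tendsto_unique[OF U_nontrivial _ small])
  have ub_ft: "ub (ft e)" if "e \<in> H" for e
    using ub_sg[OF gens_cyl_J[OF H_J[OF that]] ft_meas[OF that] ft_bounds[OF that]] .
  have ub_prod: "ub (\<lambda>x. \<Prod>e\<in>H. ft e x)"
    using ub_ft by (auto simp: ub_def intro!: borel_measurable_prod prod_nonneg prod_le_1)
  define Z where "Z e = {x\<in>Omega. ft e x > 0}" for e
  have Z_sg: "Z e \<in> sets (sg (gens (d - 1) e))" if "e \<in> H" for e
    unfolding Z_def by (rule superlevel_sg[OF ft_meas[OF that]])
  \<comment> \<open>\<open>null_removal\<close> asks for a family closed under subsets, so all
    subsets of edges are added as indices, with the trivial set \<open>Omega\<close> on the new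
    ones.\<close>
  define HH where "HH = {g. \<exists>e\<in>H. g \<subseteq> e}"
  have HH_J: "g \<subseteq> J" if "g \<in> HH" for g using that H_J by (auto simp: HH_def)
  then have finHH: "finite HH" using finite_J by (meson Pow_iff finite_Pow_iff finite_subset subsetI)
  have H_HH: "H \<subseteq> HH" by (auto simp: HH_def)
  define A where "A g = (if g \<in> H then Z g else Omega)" for g
  have A_sg: "A g \<in> sets (sg (gens (d - 1) g))" if "g \<in> HH" for g
    using Z_sg[of g] sets.top[of "sg (gens (d - 1) g)"] by (auto simp: A_def)
  have A_P: "A g \<in> sets P" if "g \<in> HH" for g
    using sets_sg_P[OF gens_cyl_J[OF HH_J[OF that]] A_sg[OF that]] .
  have A\<Omega>: "A g \<subseteq> Omega" for g by (auto simp: A_def Z_def)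
  have null: "measure P (\<Inter>g\<in>HH. A g) = 0"
  proof -
    have "measure P ({x\<in>Omega. (\<Prod>e\<in>H. ft e x) > 0} \<inter> Omega) = 0"
    proof (rule ce_null_support[OF ub_prod])
      show "Omega \<in> sets P" using sets.top[of P] by (simp add: space_loeb weight_1)
      show "(\<integral>x. (\<Prod>e\<in>H. ft e x) * indicator Omega x \<partial>P) = 0"
        using int0 by (subst Bochner_Integration.integral_cong[OF refl, of P _ "\<lambda>x. \<Prod>e\<in>H. ft e x"]) (auto simp: space_loeb weight_1)
    qed
    moreover have "(\<Inter>g\<in>HH. A g) = {x\<in>Omega. (\<Prod>e\<in>H. ft e x) > 0} \<inter> Omega"
    proof (intro set_eqI iffI)
      fix x assume x: "x \<in> (\<Inter>g\<in>HH. A g)"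
      then have "x \<in> Omega" using H H_HH A\<Omega> by blast
      moreover have "ft e x > 0" if "e \<in> H" for e
      proof -
        have "x \<in> A e" using x that H_HH by blast
        then show ?thesis using that by (simp add: A_def Z_def)
      qed
      ultimately show "x \<in> {x\<in>Omega. (\<Prod>e\<in>H. ft e x) > 0} \<inter> Omega" by (auto intro: prod_pos)
    next
      fix x assume x: "x \<in> {x\<in>Omega. (\<Prod>e\<in>H. ft e x) > 0} \<inter> Omega"
      have "ft e x > 0" if e: "e \<in> H" for e
      proof -
        have "(\<Prod>e\<in>H. ft e x) \<noteq> 0" using x by (metis (mono_tags, lifting) IntD1 less_irrefl mem_Collect_eq)
        then have "ft e x \<noteq> 0" using prod_zero[OF finite_H, of "\<lambda>e. ft e x"] e by blast
        then show ?thesis using ft_bounds[OF e, of x] x by auto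
      qed
      then show "x \<in> (\<Inter>g\<in>HH. A g)" using x by (auto simp: A_def Z_def)
    qed
    ultimately show ?thesis by simp
  qed
  define \<epsilon>' where "\<epsilon>' = \<epsilon> / (2 * real (card HH))"
  have HHne: "HH \<noteq> {}" using H H_HH by auto
  then have cpos: "real (card HH) > 0" using finHH by (simp add: card_gt_0_iff)
  then have \<epsilon>': "\<epsilon>' > 0" using \<epsilon> by (simp add: \<epsilon>'_def)
  have down: "f \<in> HH" if "e \<in> HH" "f \<subseteq> e" for e f using that by (auto simp: HH_def)
  obtain E3 where E3: "\<And>g. g \<in> HH \<Longrightarrow> E3 g \<in> Alg (gens (d - 1) g)"
      "\<And>g. g \<in> HH \<Longrightarrow> measure P (A g - intl (E3 g)) \<le> \<epsilon>'" "(\<Inter>g\<in>HH. intl (E3 g)) = {}"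
  proof -
    have "\<exists>E'. (\<forall>g\<in>HH. E' g \<in> Alg (gens (d - 1) g)) \<and> (\<forall>g\<in>HH. measure P (A g - intl (E' g)) \<le> \<epsilon>') \<and>
        (\<Inter>g\<in>HH. intl (E' g)) = {}"
      by (rule null_removal[OF finHH HHne _ _ _ null \<epsilon>']) (erule HH_J, erule (1) down, erule A_sg)
    then show ?thesis using that by blast
  qed
  \<comment> \<open>The sets obtained on proper subsets of \<open>e\<close> are moved onto
    \<open>e\<close>. As no edge contains another, such a subset carries \<open>Omega\<close>, so
    its set misses at most \<open>\<epsilon>'\<close>.\<close>
  define E' where "E' e = (\<lambda>n. {x\<in>X n. \<forall>g\<in>Pow e. x \<in> E3 g n})" for e
  have E'_Alg: "E' e \<in> Alg (gens (d - 1) e)" if e: "e \<in> H" for e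
    unfolding E'_def
  proof (rule Alg_finite_Inter)
    show "finite (Pow e)" using finite_edge[OF e] by simp
    show "E3 g \<in> Alg (gens (d - 1) e)" if "g \<in> Pow e" for g
      using E3(1)[of g] that e Alg_mono[OF gens_mono[of g e]] by (auto simp: HH_def)
  qed
  have intl_E': "intl (E' e) = {x\<in>Omega. \<forall>g\<in>Pow e. x \<in> intl (E3 g)}" if "e \<in> H" for e
    unfolding E'_def using finite_edge[OF that] by (intro intl_finite_Inter) simp
  have "intl (\<lambda>n. {x\<in>X n. \<forall>e\<in>H. x \<in> E' e n}) = {x\<in>Omega. \<forall>e\<in>H. x \<in> intl (E' e)}"
    by (rule intl_finite_Inter[OF finite_H])
  also have "\<dots> \<subseteq> (\<Inter>g\<in>HH. intl (E3 g))" by (auto simp: intl_E' HH_def)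
  finally have "intl (\<lambda>n. {x\<in>X n. \<forall>e\<in>H. x \<in> E' e n}) = {}" using E3(3) by auto
  then have empty: "eventually (\<lambda>n. X n \<inter> (\<Inter>e\<in>H. E' e n) = {}) U"
    unfolding intl_empty_iff by eventually_elim blast
  have "eventually (\<lambda>n. av n (\<lambda>x. indicator (E e n - E' e n) x * wt e n x) < \<epsilon>) U" if e: "e \<in> H" for e
  proof -
    interpret relative_edge J V H d \<nu> U e by (rule relative_edge[OF e])
    let ?S = "\<lambda>n. E e n - E' e n" and ?C = "Omega - intl (E' e)"
    have EX: "E e n \<subseteq> X n" for n using E[OF e] cyl_subset[OF H_J[OF e]] by auto
    have C_eq: "intl (\<lambda>n. X n - E' e n) = ?C" by (rule intl_compl)
    have C_sg: "?C \<in> sets (sg low)" unfolding C_eq[symmetric] by (intro intl_in_sg Alg.compl E'_Alg e)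
    have C_P: "?C \<in> sets P" using C_sg sets_sg_P[OF low_J] by blast
    have S_eq: "intl ?S = intl (E e) \<inter> ?C"
    proof -
      have "?S = (\<lambda>n. E e n \<inter> (X n - E' e n))" using EX by auto
      then show ?thesis by (simp only: intl_Int C_eq)
    qed
    have "?S \<in> cyl J" using EX by (auto simp: cyl_J)
    \<comment> \<open>The complement \<open>?C\<close> has lower order. Hence the model
      \<open>ft e\<close> may replace the indicator of \<open>E e\<close>, after which the uniform
      measure may replace the weighted one.\<close>
    from measure_loeb[OF weight_w1 this] have "mass w1 ?S = measure (loeb w1) (intl (E e) \<inter> ?C)" unfolding S_eq by (rule sym)
    also have "\<dots> = (\<integral>x. indicator (intl (E e)) x * indicator ?C x \<partial>loeb w1)"
      using sets.sets_into_space[OF intl_E_sets[OF e weight_w1]]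
      by (simp add: indicator_inter_arith[symmetric] Int_absorb2 le_infI1)
    also have "\<dots> = (\<integral>x. ft e x * indicator ?C x \<partial>loeb w1)"
    proof -
      have "(indicator ?C :: _ \<Rightarrow> real) \<in> borel_measurable (sg low)" using C_sg by (rule borel_measurable_indicator)
      then show ?thesis by (rule is_ce_integral[OF ft[OF e]]) (simp add: indicator_def)
    qed
    also have "\<dots> = (\<integral>x. ft e x * indicator ?C x \<partial>P)"
      using ft_meas[OF e] C_sg by (intro integral_low borel_measurable_times borel_measurable_indicator)
    also have "\<dots> \<le> (\<integral>x. indicator (A e - intl (E' e)) x \<partial>P)"
    proof (rule integral_mono)
      have ae: "A e - intl (E' e) \<in> sets P"
      proof -
        have "A e - intl (E' e) = A e \<inter> ?C" using A\<Omega> by auto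
        then show ?thesis using A_P[of e] C_P e H_HH by auto
      qed
      show "integrable P (\<lambda>x. ft e x * indicator ?C x)"
        using ub_integrable[OF ub_mult[OF ub_ft[OF e] ub_indicator[OF C_P]]] .
      show "integrable P (indicator (A e - intl (E' e)) :: _ \<Rightarrow> real)" using ub_integrable[OF ub_indicator[OF ae]] .
      show "ft e x * indicator ?C x \<le> indicator (A e - intl (E' e)) x" if "x \<in> space P" for x
        using ft_bounds[OF e, of x] e that by (auto simp: indicator_def A_def Z_def space_loeb weight_1)
    qed
    also have "\<dots> = measure P (A e - intl (E' e))"
    proof -
      have "(A e - intl (E' e)) \<inter> space P = A e - intl (E' e)" using A\<Omega>[of e] by (auto simp: space_loeb weight_1)
      then show ?thesis by simp
    qed
    also have "\<dots> \<le> measure P (\<Union>g\<in>Pow e. A g - intl (E3 g))"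
    proof (rule P.finite_measure_mono)
      show "A e - intl (E' e) \<subseteq> (\<Union>g\<in>Pow e. A g - intl (E3 g))"
      proof
        fix x assume x: "x \<in> A e - intl (E' e)"
        then have x\<Omega>: "x \<in> Omega" using A\<Omega> by auto
        then obtain g where g: "g \<in> Pow e" "x \<notin> intl (E3 g)" using x intl_E'[OF e] by auto
        have "x \<in> A g"
        proof (cases "g \<in> H")
          case True
          then have "g = e" using g edge_not_subset e by auto
          then show ?thesis using x by simp
        next
          case False then show ?thesis using x\<Omega> by (simp add: A_def)
        qed
        then show "x \<in> (\<Union>g\<in>Pow e. A g - intl (E3 g))" using g by auto
      qed
      show "(\<Union>g\<in>Pow e. A g - intl (E3 g)) \<in> sets P"
      proof (intro sets.finite_UN sets.Diff)
        fix g assume "g \<in> Pow e"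
        then have g: "g \<in> HH" using e by (auto simp: HH_def)
        show "A g \<in> sets P" using A_P[OF g] .
        show "intl (E3 g) \<in> sets P" using sets_sg_P[OF gens_cyl_J[OF HH_J[OF g]] intl_in_sg[OF E3(1)[OF g]]] .
      qed (use finite_edge[OF e] in simp)
    qed
    also have "\<dots> \<le> (\<Sum>g\<in>Pow e. measure P (A g - intl (E3 g)))"
    proof (rule measure_UNION_le)
      fix g assume "g \<in> Pow e"
      then have g: "g \<in> HH" using e by (auto simp: HH_def)
      show "A g - intl (E3 g) \<in> sets P"
        using A_P[OF g] sets_sg_P[OF gens_cyl_J[OF HH_J[OF g]] intl_in_sg[OF E3(1)[OF g]]] by auto
    qed (use finite_edge[OF e] in simp)
    also have "\<dots> \<le> (\<Sum>g\<in>Pow e. \<epsilon>')" using e by (intro sum_mono E3(2)) (auto simp: HH_def)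
    also have "\<dots> \<le> real (card HH) * \<epsilon>'"
    proof -
      have "card (Pow e) \<le> card HH" using e by (intro card_mono finHH) (auto simp: HH_def)
      then show ?thesis using \<epsilon>' by (simp del: card_Pow add: mult_right_mono)
    qed
    also have "\<dots> = \<epsilon> / 2" using cpos by (simp add: \<epsilon>'_def)
    finally have "mass w1 ?S < \<epsilon>" using \<epsilon> by simp
    then show ?thesis using order_tendstoD(2)[OF mass_tendsto[OF weight_w1]] by blast
  qed
  then show ?thesis using E'_Alg empty by blast
qed

end

section \<open>The removal lemma\<close>

text \<open>Membership of a point depends only on which generators contain it. With \<open>m\<close>
  generators there are at most \<open>2 ^ m\<close> patterns, whence the doubly exponential bound in
  the next lemma.\<close>

lemma sigma_sets_finite_atoms:
  assumes "A \<in> sigma_sets \<Omega> \<S>" "\<S> \<subseteq> Pow \<Omega>"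
  shows "\<exists>T\<subseteq>Pow \<S>. A = {x\<in>\<Omega>. {S\<in>\<S>. x \<in> S} \<in> T}"
  using assms(1)
proof (induction rule: sigma_sets.induct)
  case (Basic a)
  then have "a = {x\<in>\<Omega>. {S\<in>\<S>. x \<in> S} \<in> {\<tau>\<in>Pow \<S>. a \<in> \<tau>}}" using assms(2) by auto
  then show ?case by (intro exI[of _ "{\<tau>\<in>Pow \<S>. a \<in> \<tau>}"]) auto
next
  case Empty
  show ?case by (intro exI[of _ "{}"]) auto
next
  case (Compl a)
  then obtain T where T: "T \<subseteq> Pow \<S>" "a = {x\<in>\<Omega>. {S\<in>\<S>. x \<in> S} \<in> T}" by blast
  then show ?case by (intro exI[of _ "Pow \<S> - T"]) auto
next
  case (Union a)
  have "\<forall>i. \<exists>T. T \<subseteq> Pow \<S> \<and> a i = {x\<in>\<Omega>. {S\<in>\<S>. x \<in> S} \<in> T}" by (rule allI) (rule Union(2))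
  from choice[OF this] obtain T where T': "\<forall>i. T i \<subseteq> Pow \<S> \<and> a i = {x\<in>\<Omega>. {S\<in>\<S>. x \<in> S} \<in> T i}" by (rule exE)
  have T: "T i \<subseteq> Pow \<S>" "a i = {x\<in>\<Omega>. {S\<in>\<S>. x \<in> S} \<in> T i}" for i using spec[OF T', of i] by simp_all
  have "(\<Union>i. a i) = {x\<in>\<Omega>. {S\<in>\<S>. x \<in> S} \<in> (\<Union>i. T i)}" unfolding T(2) by blast
  then show ?case using T(1) by (intro exI[of _ "\<Union>i. T i"]) blast
qed

lemma card_sigma_sets_le:
  assumes "finite \<S>" "\<S> \<subseteq> Pow \<Omega>" "card \<S> \<le> m"
  shows "card (sigma_sets \<Omega> \<S>) \<le> 2 ^ (2 ^ m)"
proof -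
  let ?f = "\<lambda>T. {x\<in>\<Omega>. {S\<in>\<S>. x \<in> S} \<in> T}"
  have "sigma_sets \<Omega> \<S> \<subseteq> ?f ` Pow (Pow \<S>)"
    using sigma_sets_finite_atoms[OF _ assms(2)] by blast
  then have "card (sigma_sets \<Omega> \<S>) \<le> card (?f ` Pow (Pow \<S>))"
    using assms(1) by (intro card_mono) auto
  also have "\<dots> \<le> card (Pow (Pow \<S>))" using assms(1) by (intro card_image_le) auto
  also have "\<dots> = 2 ^ (2 ^ card \<S>)" using assms(1) by (simp add: card_Pow)
  also have "\<dots> \<le> 2 ^ (2 ^ m)" using assms(3) by (intro power_increasing) auto
  finally show ?thesis .
qed

section \<open>From the limit space to finite levels\<close>

definition removable ::
  "'j set \<Rightarrow> nat \<Rightarrow> 'j set set \<Rightarrow> ('j \<Rightarrow> 'v set) \<Rightarrow> ('j set \<Rightarrow> ('j \<Rightarrow> 'v) \<Rightarrow> real) \<Rightarrow>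
   ('j set \<Rightarrow> ('j \<Rightarrow> 'v) set) \<Rightarrow> real \<Rightarrow> real \<Rightarrow> bool" where
  "removable J d H W \<mu> E \<epsilon> C \<longleftrightarrow> (\<exists>E' B.
     (\<forall>e\<in>H. E' e \<in> cylAlg J W e) \<and>
     VJ J W \<inter> (\<Inter>e\<in>H. E' e) = {} \<and>
     (\<forall>e\<in>H. \<bar>avg (VJ J W) (\<lambda>x. indicator (E e - E' e) x * \<mu> e (restrict x e))\<bar> \<le> \<epsilon>) \<and>
     (\<forall>e'. e' \<subseteq> J \<and> card e' < d \<longrightarrow>
        sigma_algebra (VJ J W) (B e') \<and> B e' \<subseteq> cylAlg J W e' \<and> real (card (B e')) \<le> C) \<and>
     (\<forall>e\<in>H. E' e \<in> sigma_sets (VJ J W) (\<Union>e'\<in>{e'. e' \<subset> e}. B e')))"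

lemma removable_mono:
  assumes "removable J d H W \<mu> E \<epsilon> C" "C \<le> C'"
  shows "removable J d H W \<mu> E \<epsilon> C'"
proof -
  obtain E' B where *: "\<forall>e\<in>H. E' e \<in> cylAlg J W e" "VJ J W \<inter> (\<Inter>e\<in>H. E' e) = {}"
    "\<forall>e\<in>H. \<bar>avg (VJ J W) (\<lambda>x. indicator (E e - E' e) x * \<mu> e (restrict x e))\<bar> \<le> \<epsilon>"
    "\<forall>e'. e' \<subseteq> J \<and> card e' < d \<longrightarrow>
        sigma_algebra (VJ J W) (B e') \<and> B e' \<subseteq> cylAlg J W e' \<and> real (card (B e')) \<le> C"
    "\<forall>e\<in>H. E' e \<in> sigma_sets (VJ J W) (\<Union>e'\<in>{e'. e' \<subset> e}. B e')"
    using assms(1) unfolding removable_def by (elim exE conjE)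
  moreover have "\<forall>e'. e' \<subseteq> J \<and> card e' < d \<longrightarrow>
        sigma_algebra (VJ J W) (B e') \<and> B e' \<subseteq> cylAlg J W e' \<and> real (card (B e')) \<le> C'"
    using *(4) assms(2) order_trans by blast
  ultimately show ?thesis unfolding removable_def by (intro exI[of _ E'] exI[of _ B] conjI)
qed

context relative_system
begin

lemma removable_eventually:
  assumes small: "((\<lambda>n. av n (\<lambda>x. \<Prod>e\<in>H. indicator (E e n) x * wt e n x)) \<longlongrightarrow> 0) U"
    and H: "H \<noteq> {}" and \<epsilon>: "\<epsilon> > 0"
  shows "\<exists>C. eventually (\<lambda>n. removable J d H (V n) (\<nu> n) (\<lambda>e. E e n) \<epsilon> C) U"
proof -
  obtain E' where E': "\<And>e. e \<in> H \<Longrightarrow> E' e \<in> Alg (gens (d - 1) e)"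
      "eventually (\<lambda>n. X n \<inter> (\<Inter>e\<in>H. E' e n) = {}) U"
      "\<And>e. e \<in> H \<Longrightarrow> eventually (\<lambda>n. av n (\<lambda>x. indicator (E e n - E' e n) x * wt e n x) < \<epsilon>) U"
    using limit_removal[OF assms] by blast
  have "\<exists>G0\<subseteq>gens (d - 1) e. finite G0 \<and> E' e \<in> Alg G0" if "e \<in> H" for e
    using Alg_finite_generators[OF E'(1)[OF that]] .
  then obtain G0 where G0: "\<And>e. e \<in> H \<Longrightarrow> G0 e \<subseteq> gens (d - 1) e" "\<And>e. e \<in> H \<Longrightarrow> finite (G0 e)" "\<And>e. e \<in> H \<Longrightarrow> E' e \<in> Alg (G0 e)"
    by metis
  define GG where "GG = (\<Union>e\<in>H. G0 e)"
  have finGG: "finite GG" using G0(2) finite_H by (simp add: GG_def)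
  \<comment> \<open>The finitely many generators used by all \<open>E' e\<close> are evaluated at
    level \<open>n\<close> and assigned to each \<open>g\<close> over which they are cylinders.
    Their number does not depend on \<open>n\<close>, so neither does the bound on the
    cardinalities.\<close>
  define B0 where "B0 n g = (\<lambda>S. S n) ` (GG \<inter> cyl g)" for n g
  define B where "B n g = sigma_sets (X n) (B0 n g)" for n g
  have B0_cyl: "B0 n g \<subseteq> cylAlg J (V n) g" for n g by (auto simp: B0_def cyl_def)
  have B0_X: "B0 n g \<subseteq> Pow (X n)" if "g \<subseteq> J" for n g
    using B0_cyl[of n g] cylAlg_iff[OF that] by blast
  have B_cyl: "B n g \<subseteq> cylAlg J (V n) g" if "g \<subseteq> J" for n g
    unfolding B_def by (rule sigma_sets_cylAlg[OF that B0_cyl])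
  have B_X: "B n g \<subseteq> Pow (X n)" if "g \<subseteq> J" for n g
    using B_cyl[OF that, of n] cylAlg_iff[OF that] by blast
  have B_card: "card (B n g) \<le> 2 ^ (2 ^ card GG)" if "g \<subseteq> J" for n g
    unfolding B_def
  proof (rule card_sigma_sets_le)
    show "finite (B0 n g)" using finGG by (simp add: B0_def)
    have "card (B0 n g) \<le> card (GG \<inter> cyl g)" unfolding B0_def using finGG by (intro card_image_le) auto
    also have "\<dots> \<le> card GG" using finGG by (intro card_mono) auto
    finally show "card (B0 n g) \<le> card GG" .
  qed (rule B0_X[OF that])
  have E'_sigma: "E' e n \<in> sigma_sets (X n) (\<Union>g\<in>{g. g \<subset> e}. B n g)" if e: "e \<in> H" for e n
  proof (rule Alg_level[OF G0(3)[OF e]])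
    show "(\<Union>g\<in>{g. g \<subset> e}. B n g) \<subseteq> Pow (X n)" using B_X H_J[OF e] by blast
    fix S assume S: "S \<in> G0 e"
    then obtain g where g: "g \<subseteq> e" "card g \<le> d - 1" "S \<in> cyl g" using G0(1)[OF e] by (auto simp: gens_def)
    then have "g \<subset> e" using H_card[OF e] d_pos by auto
    moreover have "S n \<in> B n g" unfolding B_def B0_def using S g e by (intro sigma_sets.Basic) (auto simp: GG_def)
    ultimately show "S n \<in> (\<Union>g\<in>{g. g \<subset> e}. B n g)" by blast
  qed
  have E'_cyl: "E' e n \<in> cylAlg J (V n) e" if e: "e \<in> H" for e n
    using Alg_cyl[OF gens_cyl[OF H_J[OF e]] H_J[OF e]] E'(1)[OF e] by (auto simp: cyl_def)
  have VJ_X: "VJ J (V n) = X n" for n by (simp add: VJ_def X_def)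
  have "eventually (\<lambda>n. \<forall>e\<in>H. av n (\<lambda>x. indicator (E e n - E' e n) x * wt e n x) < \<epsilon>) U"
    using E'(3) finite_H by (intro eventually_ball_finite) auto
  with E'(2) have "eventually (\<lambda>n. removable J d H (V n) (\<nu> n) (\<lambda>e. E e n) \<epsilon> (2 ^ (2 ^ card GG))) U"
  proof eventually_elim
    case (elim n)
    show ?case unfolding removable_def VJ_X
    proof (rule exI[of _ "\<lambda>e. E' e n"], rule exI[of _ "B n"], intro conjI ballI allI impI)
      fix e assume e: "e \<in> H"
      have "0 \<le> av n (\<lambda>x. indicator (E e n - E' e n) x * wt e n x)"
        using nu_nonneg[OF e restrict_X[OF _ H_J[OF e]]] by (intro avg_nonneg mult_nonneg_nonneg) (auto simp: indicator_def)
      then show "\<bar>av n (\<lambda>x. indicator (E e n - E' e n) x * wt e n x)\<bar> \<le> \<epsilon>"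
        using bspec[OF elim(2) e] by linarith
      show "E' e n \<in> cylAlg J (V n) e" "E' e n \<in> sigma_sets (X n) (\<Union>g\<in>{g. g \<subset> e}. B n g)"
        using E'_cyl E'_sigma e by auto
    next
      fix g assume g: "g \<subseteq> J \<and> card g < d"
      show "sigma_algebra (X n) (B n g)" unfolding B_def using g by (intro sigma_algebra_sigma_sets B0_X) simp
      show "B n g \<subseteq> cylAlg J (V n) g" using g by (intro B_cyl) simp
      have "card (B n g) \<le> 2 ^ (2 ^ card GG)" using g by (intro B_card) simp
      then show "real (card (B n g)) \<le> 2 ^ (2 ^ card GG)" by (metis of_nat_le_iff of_nat_numeral of_nat_power)
    qed (use elim(1) in simp)
  qed
  then show ?thesis by blast
qed

end

lemma pseudorandom_nonneg:
  assumes "pseudorandom J V H \<nu>" "e \<in> H" "x \<in> PiE e (V N)"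
  shows "0 \<le> \<nu> N e x"
proof -
  have "system_of_measures J V H \<nu>" using assms(1) unfolding pseudorandom_def by (rule conjunct1)
  then show ?thesis using assms(2,3) by (simp add: system_of_measures_def)
qed

text \<open>The cube vertex \<open>\<omega>\<close> corresponds to the set of coordinates at which
  it is true; exponent 1 then means membership of this set in \<open>T e\<close>.\<close>

lemma pseudorandom_linear_forms:
  assumes hyp: "hypergraph_system J V d H" and psr: "pseudorandom J V H \<nu>"
    and T: "\<And>e. e \<in> H \<Longrightarrow> T e \<subseteq> Pow e"
  shows "(\<lambda>N. avg (PiE J (V N)) (\<lambda>x0. avg (PiE J (V N)) (\<lambda>x1.
    \<Prod>e\<in>H. \<Prod>D\<in>T e. \<nu> N e (restrict (glue D x1 x0) e)))) \<longlonglongrightarrow> 1"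
proof -
  have fin: "finite e" if "e \<in> H" for e
    using hyp that finite_subset[of e J] unfolding hypergraph_system_def by auto
  define n where "n e \<omega> = ({j\<in>e. \<omega> j} \<in> T e)" for e and \<omega> :: "'a \<Rightarrow> bool"
  have eq: "(\<Prod>\<omega>\<in>cube e. if n e \<omega> then \<nu> N e (cpt x0 x1 \<omega> e) else 1) = (\<Prod>D\<in>T e. \<nu> N e (restrict (glue D x1 x0) e))"
    if e: "e \<in> H" for N e x0 x1
  proof -
    let ?f = "\<lambda>D. \<nu> N e (restrict (glue D x1 x0) e)"
    have "(\<Prod>\<omega>\<in>cube e. if n e \<omega> then \<nu> N e (cpt x0 x1 \<omega> e) else 1) = (\<Prod>D\<in>Pow e. if D \<in> T e then ?f D else 1)"
    proof (rule prod.reindex_bij_witness[of _ "\<lambda>D. restrict (\<lambda>j. j \<in> D) e" "\<lambda>\<omega>. {j\<in>e. \<omega> j}"])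
      fix \<omega> assume "\<omega> \<in> cube e"
      then show "restrict (\<lambda>j. j \<in> {j\<in>e. \<omega> j}) e = \<omega>"
        by (auto simp: cube_def PiE_iff extensional_def restrict_def fun_eq_iff)
      show "{j\<in>e. \<omega> j} \<in> Pow e" by auto
      have "restrict (glue {j\<in>e. \<omega> j} x1 x0) e = cpt x0 x1 \<omega> e" by (auto simp: glue_def cpt_def restrict_def fun_eq_iff)
      then show "(if {j\<in>e. \<omega> j} \<in> T e then ?f {j\<in>e. \<omega> j} else 1) = (if n e \<omega> then \<nu> N e (cpt x0 x1 \<omega> e) else 1)"
        by (simp only: n_def)
    qed (auto simp: cube_def)
    also have "\<dots> = (\<Prod>D\<in>Pow e \<inter> T e. ?f D)" using fin[OF e] by (subst prod.inter_restrict) auto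
    also have "Pow e \<inter> T e = T e" using T[OF e] by auto
    finally show ?thesis .
  qed
  have "(\<lambda>N. avg (PiE J (V N) \<times> PiE J (V N)) (\<lambda>(x0, x1). \<Prod>e\<in>H. \<Prod>\<omega>\<in>cube e.
      (if n e \<omega> then \<nu> N e (cpt x0 x1 \<omega> e) else 1))) \<longlonglongrightarrow> 1"
    using psr unfolding pseudorandom_def by blast
  then show ?thesis unfolding avg_Times prod.case by (simp only: eq cong: prod.cong)
qed

lemma removal_uniform:
  fixes J :: "'j set" and V :: "nat \<Rightarrow> 'j \<Rightarrow> 'v set"
  assumes hyp: "hypergraph_system J V d H" and psr: "pseudorandom J V H \<nu>" and \<epsilon>: "\<epsilon> > 0"
  shows "\<exists>\<delta>>0. \<exists>C. \<exists>N0. \<forall>N\<ge>N0. \<forall>E. (\<forall>e\<in>H. E e \<in> cylAlg J (V N) e) \<and>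
    avg (VJ J (V N)) (\<lambda>x. \<Prod>e\<in>H. indicator (E e) x * \<nu> N e (restrict x e)) \<le> \<delta> \<longrightarrow>
    removable J d H (V N) (\<nu> N) E \<epsilon> C"
proof (rule ccontr)
  assume neg: "\<not> ?thesis"
  \<comment> \<open>The \<open>k\<close>-th counterexample defeats
    \<open>\<delta> = 1 / (k + 2)\<close>, the bound \<open>C = k\<close> and the threshold
    \<open>N0 = k\<close> together, so any constant found in the limit is eventually exceeded. The
    shift by 2 keeps \<open>\<delta>\<close> below 1 even for \<open>k = 0\<close>, which rules out
    an empty \<open>H\<close>.\<close>
  define Q where "Q k N E \<longleftrightarrow> N \<ge> k \<and> (\<forall>e\<in>H. E e \<in> cylAlg J (V N) e) \<and>
    avg (VJ J (V N)) (\<lambda>x. \<Prod>e\<in>H. indicator (E e) x * \<nu> N e (restrict x e)) \<le> 1 / real (Suc (Suc k)) \<and>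
    \<not> removable J d H (V N) (\<nu> N) E \<epsilon> (real k)" for k N E
  have "\<exists>N E. Q k N E" for k
  proof -
    have "1 / real (Suc (Suc k)) > 0" by simp
    then show ?thesis using neg unfolding Q_def by blast
  qed
  then obtain N E where Q: "\<And>k. Q k (N k) (E k)" by metis
  have N: "\<And>k. N k \<ge> k" and E: "\<And>k e. e \<in> H \<Longrightarrow> E k e \<in> cylAlg J (V (N k)) e"
    and small: "\<And>k. avg (VJ J (V (N k))) (\<lambda>x. \<Prod>e\<in>H. indicator (E k e) x * \<nu> (N k) e (restrict x e)) \<le> 1 / real (Suc (Suc k))"
    and bad: "\<And>k. \<not> removable J d H (V (N k)) (\<nu> (N k)) (E k) \<epsilon> (real k)"
    using Q unfolding Q_def by blast+
  obtain U :: "nat filter" where U: "U \<noteq> bot" "U \<le> sequentially" "\<And>P. eventually P U \<or> eventually (\<lambda>n. \<not> P n) U"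
    using ultrafilter_exists by blast
  have "filterlim N at_top sequentially"
    using N by (intro filterlim_at_top_mono[OF filterlim_ident]) auto
  then have NU: "filterlim N sequentially U" by (rule filterlim_mono[OF _ order_refl U(2)])
  have sys: "finite J" "d \<ge> 1" "\<And>e. e \<in> H \<Longrightarrow> e \<subseteq> J \<and> card e = d"
      "\<And>n j. j \<in> J \<Longrightarrow> finite (V n j) \<and> V n j \<noteq> {}"
    using hyp unfolding hypergraph_system_def by auto
  have nn: "0 \<le> \<nu> n e x" if "e \<in> H" "x \<in> PiE e (V n)" for n e x
    using pseudorandom_nonneg[OF psr that] .
  interpret vertex_system J "\<lambda>k. V (N k)"
    using sys by unfold_locales auto
  interpret linear_forms_system J "\<lambda>k. V (N k)" H d "\<lambda>k. \<nu> (N k)" U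
  proof unfold_locales
    fix T :: "'j set \<Rightarrow> 'j set set" assume T: "\<And>e. e \<in> H \<Longrightarrow> T e \<subseteq> Pow e"
    show "((\<lambda>n. av n (\<lambda>x0. av n (\<lambda>x1. \<Prod>e\<in>H. \<Prod>D\<in>T e. \<nu> (N n) e (restrict (glue D x1 x0) e)))) \<longlongrightarrow> 1) U"
      using filterlim_compose[OF pseudorandom_linear_forms[OF hyp psr T] NU] by (simp only: X_def)
  qed (use sys nn in auto)
  interpret relative_system J "\<lambda>k. V (N k)" H d "\<lambda>k. \<nu> (N k)" U "\<lambda>e k. E k e"
  proof unfold_locales
    interpret loeb_setting J "\<lambda>k. V (N k)" U using U by unfold_locales auto
    show "(\<lambda>k. E k e) \<in> cyl e" if "e \<in> H" for e using E[OF that] by (simp add: cyl_def)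
  qed (use U in auto)
  have VX: "VJ J (V (N n)) = X n" for n by (simp add: VJ_def X_def)
  have "H \<noteq> {}"
  proof
    assume "H = {}"
    then have "av 0 (\<lambda>_. 1) \<le> 1 / real (Suc (Suc 0))" using small[of 0] unfolding VX by simp
    then show False by simp
  qed
  moreover have "((\<lambda>n. av n (\<lambda>x. \<Prod>e\<in>H. indicator (E n e) x * \<nu> (N n) e (restrict x e))) \<longlongrightarrow> 0) U"
  proof (rule tendsto_sandwich[OF _ _ tendsto_const])
    show "eventually (\<lambda>n. 0 \<le> av n (\<lambda>x. \<Prod>e\<in>H. indicator (E n e) x * \<nu> (N n) e (restrict x e))) U"
      using nu_nonneg restrict_X H_J by (intro always_eventually allI avg_nonneg prod_nonneg mult_nonneg_nonneg) (auto simp: indicator_def)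
    show "eventually (\<lambda>n. av n (\<lambda>x. \<Prod>e\<in>H. indicator (E n e) x * \<nu> (N n) e (restrict x e)) \<le> 1 / real (Suc (Suc n))) U"
      using small unfolding VX by (intro always_eventually) blast
    have "(\<lambda>n. 1 / real (Suc (Suc n))) \<longlonglongrightarrow> 0"
      using LIMSEQ_Suc[OF LIMSEQ_inverse_real_of_nat] by (simp add: inverse_eq_divide)
    then show "((\<lambda>n. 1 / real (Suc (Suc n))) \<longlongrightarrow> 0) U" using U(2) by (rule tendsto_mono[rotated])
  qed
  ultimately obtain C where "eventually (\<lambda>n. removable J d H (V (N n)) (\<nu> (N n)) (\<lambda>e. E n e) \<epsilon> C) U"
    using removable_eventually[OF _ _ \<epsilon>] by blast
  moreover have "eventually (\<lambda>n. real n \<ge> C) U"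
    using filterlim_real_sequentially U(2) unfolding filterlim_at_top by (blast intro: filter_leD)
  ultimately have "eventually (\<lambda>n. False) U"
    by eventually_elim (use bad removable_mono in blast)
  then show False using U(1) by (simp add: trivial_limit_def)
qed

theorem mainTheorem3:
  fixes J :: "'j set" and d :: nat and H :: "'j set set"
    and V :: "nat \<Rightarrow> 'j \<Rightarrow> 'v set"
    and \<nu> :: "nat \<Rightarrow> 'j set \<Rightarrow> ('j \<Rightarrow> 'v) \<Rightarrow> real"
  assumes "hypergraph_system J V d H"
    and "pseudorandom J V H \<nu>"
  shows "\<exists>(c1 :: real \<Rightarrow> real) (c2 :: nat \<Rightarrow> real \<Rightarrow> real) (Cb :: real \<Rightarrow> real) (N0 :: real \<Rightarrow> nat).
    (c1 \<longlongrightarrow> 0) (at_right 0) \<and>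
    (\<forall>\<delta>. 0 < \<delta> \<and> \<delta> < 1 \<longrightarrow> (\<lambda>N. c2 N \<delta>) \<longlonglongrightarrow> 0) \<and>
    (\<forall>\<delta> N (E :: 'j set \<Rightarrow> ('j \<Rightarrow> 'v) set).
       0 < \<delta> \<and> \<delta> < 1 \<and> N \<ge> N0 \<delta> \<and>
       (\<forall>e\<in>H. E e \<in> cylAlg J (V N) e) \<and>
       avg (VJ J (V N)) (\<lambda>x. \<Prod>e\<in>H. indicator (E e) x * \<nu> N e (restrict x e)) \<le> \<delta>
       \<longrightarrow>
       (\<exists>(E' :: 'j set \<Rightarrow> ('j \<Rightarrow> 'v) set) (B :: 'j set \<Rightarrow> ('j \<Rightarrow> 'v) set set).
          (\<forall>e\<in>H. E' e \<in> cylAlg J (V N) e) \<and>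
          VJ J (V N) \<inter> (\<Inter>e\<in>H. E' e) = {} \<and>
          (\<forall>e\<in>H. \<bar>avg (VJ J (V N))
                     (\<lambda>x. indicator (E e - E' e) x * \<nu> N e (restrict x e))\<bar>
                  \<le> c1 \<delta> + c2 N \<delta>) \<and>
          (\<forall>e'. e' \<subseteq> J \<and> card e' < d \<longrightarrow>
             sigma_algebra (VJ J (V N)) (B e') \<and> B e' \<subseteq> cylAlg J (V N) e' \<and>
             real (card (B e')) \<le> Cb \<delta>) \<and>
          (\<forall>e\<in>H. E' e \<in> sigma_sets (VJ J (V N)) (\<Union>e'\<in>{e'. e' \<subset> e}. B e'))))"
proof -
  define R where "R N \<delta> \<epsilon> C \<longleftrightarrow> (\<forall>E. (\<forall>e\<in>H. E e \<in> cylAlg J (V N) e) \<and>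
    avg (VJ J (V N)) (\<lambda>x. \<Prod>e\<in>H. indicator (E e) x * \<nu> N e (restrict x e)) \<le> \<delta> \<longrightarrow>
    removable J d H (V N) (\<nu> N) E \<epsilon> C)" for N \<delta> \<epsilon> C
  have R_mono: "R N \<delta> \<epsilon> C" if "R N \<delta>' \<epsilon> C" "\<delta> \<le> \<delta>'" for N \<delta> \<delta>' \<epsilon> C
    using that unfolding R_def by (meson order_trans)
  have "\<exists>\<delta> C N0. \<delta> > 0 \<and> (\<forall>N\<ge>N0. R N \<delta> (1 / real (Suc m)) C)" for m
    using removal_uniform[OF assms, of "1 / real (Suc m)"] unfolding R_def by simp
  then obtain \<Delta> C M where M: "\<And>m. \<Delta> m > 0" "\<And>m N. N \<ge> M m \<Longrightarrow> R N (\<Delta> m) (1 / real (Suc m)) (C m)"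
    by metis
  text \<open>For \<open>\<delta>\<close> too large for the removal lemma one removes everything: \<open>E' = \<emptyset>\<close> costs about 1.\<close>
  obtain N1 where N1: "\<And>N \<delta>. N \<ge> N1 \<Longrightarrow> \<delta> < 1 \<Longrightarrow> R N \<delta> 2 2"
  proof -
    have finH: "finite H"
      using assms(1) unfolding hypergraph_system_def by (metis (no_types, lifting) Pow_iff finite_Pow_iff finite_subset mem_Collect_eq subset_iff)
    have "eventually (\<lambda>N. avg (PiE J (V N)) (\<lambda>x. \<nu> N e (restrict x e)) < 2) sequentially" if e: "e \<in> H" for e
    proof -
      have finP: "finite (PiE J (V N))" and neP: "PiE J (V N) \<noteq> {}" for N
        using assms(1) unfolding hypergraph_system_def by (auto intro!: finite_PiE simp: PiE_eq_empty_iff)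
      have g: "glue {} x1 x0 = x0" for x0 x1 :: "'j \<Rightarrow> 'v" by (simp add: glue_def)
      have "(\<Prod>e'\<in>H. \<Prod>D\<in>(if e' = e then {{}} else {}). \<nu> N e' (restrict (glue D x1 x0) e')) = \<nu> N e (restrict x0 e)" for N x0 x1
      proof -
        have "(\<Prod>e'\<in>H. \<Prod>D\<in>(if e' = e then {{}} else {}). \<nu> N e' (restrict (glue D x1 x0) e'))
          = (\<Prod>e'\<in>H. if e' = e then \<nu> N e' (restrict x0 e') else 1)"
          by (rule prod.cong) (auto simp only: g if_True if_False prod.empty prod.insert finite.emptyI empty_iff not_False_eq_True mult_1_right split: if_splits)
        then show ?thesis using finH e by (simp only: prod.delta if_True)
      qed
      then have "(\<lambda>N. avg (PiE J (V N)) (\<lambda>x0. avg (PiE J (V N)) (\<lambda>x1. \<nu> N e (restrict x0 e)))) \<longlonglongrightarrow> 1"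
        using pseudorandom_linear_forms[OF assms, of "\<lambda>e'. if e' = e then {{}} else {}"] by (simp only:) (simp split: if_splits)
      then have "(\<lambda>N. avg (PiE J (V N)) (\<lambda>x. \<nu> N e (restrict x e))) \<longlonglongrightarrow> 1"
        using avg_const[OF finP neP] by (simp only:)
      then show ?thesis by (rule order_tendstoD) simp
    qed
    then have "eventually (\<lambda>N. \<forall>e\<in>H. avg (PiE J (V N)) (\<lambda>x. \<nu> N e (restrict x e)) < 2) sequentially"
      using finH by (intro eventually_ball_finite) auto
    then obtain N1 where N1: "\<And>N e. N \<ge> N1 \<Longrightarrow> e \<in> H \<Longrightarrow> avg (PiE J (V N)) (\<lambda>x. \<nu> N e (restrict x e)) < 2"
      by (auto simp: eventually_sequentially)
    have "R N \<delta> 2 2" if N: "N \<ge> N1" and \<delta>: "\<delta> < 1" for N \<delta>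
      unfolding R_def
    proof (intro allI impI)
      fix E assume E: "(\<forall>e\<in>H. E e \<in> cylAlg J (V N) e) \<and>
        avg (VJ J (V N)) (\<lambda>x. \<Prod>e\<in>H. indicator (E e) x * \<nu> N e (restrict x e)) \<le> \<delta>"
      have fin: "finite (VJ J (V N))" "VJ J (V N) \<noteq> {}"
        using assms(1) unfolding hypergraph_system_def VJ_def by (auto intro!: finite_PiE simp: PiE_eq_empty_iff)
      \<comment> \<open>For empty \<open>H\<close> the average is that of the constant 1 and cannot
        be at most \<open>\<delta>\<close>. An index in \<open>H\<close> is needed for the
        intersection of empty sets to be empty.\<close>
      have H: "H \<noteq> {}" using E \<delta> avg_const[OF fin, of 1] by auto
      have e_cyl: "{} \<in> cylAlg J (V N) g" "VJ J (V N) \<in> cylAlg J (V N) g" if g: "g \<subseteq> J" for g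
      proof -
        have "restrict x g \<in> PiE g (V N)" if "x \<in> PiE J (V N)" for x using that g by (auto simp: PiE_iff)
        then have "VJ J (V N) = {x \<in> PiE J (V N). restrict x g \<in> PiE g (V N)}" by (auto simp: VJ_def)
        then show "VJ J (V N) \<in> cylAlg J (V N) g" unfolding cylAlg_def by blast
        show "{} \<in> cylAlg J (V N) g" unfolding cylAlg_def by blast
      qed
      have nn: "0 \<le> \<nu> N e (restrict x e)" if "e \<in> H" "x \<in> VJ J (V N)" for e x
      proof -
        have "restrict x e \<in> PiE e (V N)" using that assms(1) by (auto simp: hypergraph_system_def VJ_def PiE_iff)
        then show ?thesis using pseudorandom_nonneg[OF assms(2) that(1)] by blast
      qed
      have bnd: "\<bar>avg (VJ J (V N)) (\<lambda>x. indicator (E e - {}) x * \<nu> N e (restrict x e))\<bar> \<le> 2" if e: "e \<in> H" for e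
      proof -
        have "0 \<le> avg (VJ J (V N)) (\<lambda>x. indicator (E e - {}) x * \<nu> N e (restrict x e))"
          using nn[OF e] by (intro avg_nonneg mult_nonneg_nonneg) (auto simp: indicator_def)
        moreover have "avg (VJ J (V N)) (\<lambda>x. indicator (E e - {}) x * \<nu> N e (restrict x e)) \<le> avg (VJ J (V N)) (\<lambda>x. \<nu> N e (restrict x e))"
          using nn[OF e] by (intro avg_mono) (auto simp: indicator_def)
        ultimately show ?thesis using N1[OF N e] unfolding VJ_def by linarith
      qed
      have sa: "sigma_algebra (VJ J (V N)) {{}, VJ J (V N)}" by (rule sigma_algebra_trivial)
      have "card {{}, VJ J (V N)} \<le> 2" by (simp add: card_insert_if)
      then have c2: "real (card {{}, VJ J (V N)}) \<le> 2" by simp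
      show "removable J d H (V N) (\<nu> N) E 2 2"
        unfolding removable_def
        by (rule exI[of _ "\<lambda>_. {}"], rule exI[of _ "\<lambda>_. {{}, VJ J (V N)}"], intro conjI ballI allI impI)
           (use H bnd sa c2 e_cyl assms(1) in \<open>auto simp: hypergraph_system_def intro: sigma_sets.Empty\<close>)
    qed
    then show ?thesis using that by blast
  qed
  \<comment> \<open>The indices \<open>m\<close> whose accuracy \<open>1 / (m + 1)\<close> is
    available at \<open>\<delta>\<close>. The cut-off at
    \<open>\<lfloor>1 / \<delta>\<rfloor>\<close> makes the set finite, so a best index exists; it
    grows as \<open>\<delta>\<close> tends to 0 and finally admits every fixed
    \<open>m\<close>.\<close>
  define K where "K \<delta> = {m. m \<le> nat \<lfloor>1 / \<delta>\<rfloor> \<and> \<delta> \<le> \<Delta> m}" for \<delta> :: real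
  define k where "k \<delta> = Max (K \<delta>)" for \<delta>
  define c1 where "c1 \<delta> = (if K \<delta> = {} then 2 else 1 / real (Suc (k \<delta>)))" for \<delta>
  define Cb where "Cb \<delta> = (if K \<delta> = {} then 2 else C (k \<delta>))" for \<delta>
  define N0 where "N0 \<delta> = (if K \<delta> = {} then N1 else M (k \<delta>))" for \<delta>
  have finK: "finite (K \<delta>)" for \<delta> by (rule finite_subset[of _ "{..nat \<lfloor>1 / \<delta>\<rfloor>}"]) (auto simp: K_def)
  have main: "R N \<delta> (c1 \<delta>) (Cb \<delta>)" if "0 < \<delta>" "\<delta> < 1" "N \<ge> N0 \<delta>" for N \<delta>
  proof (cases "K \<delta> = {}")
    case True
    then show ?thesis using that N1 by (simp add: c1_def Cb_def N0_def)
  next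
    case False
    then have "k \<delta> \<in> K \<delta>" unfolding k_def using finK by (intro Max_in)
    then have "\<delta> \<le> \<Delta> (k \<delta>)" by (simp add: K_def)
    moreover have "R N (\<Delta> (k \<delta>)) (1 / real (Suc (k \<delta>))) (C (k \<delta>))" using that False by (intro M(2)) (simp add: N0_def)
    ultimately show ?thesis using False R_mono by (simp add: c1_def Cb_def)
  qed
  have lim: "(c1 \<longlongrightarrow> 0) (at_right 0)"
  proof (rule tendstoI)
    fix \<epsilon> :: real assume "\<epsilon> > 0"
    then obtain m where m: "1 / real (Suc m) < \<epsilon>" using nat_approx_posE by metis
    have "\<bar>c1 \<delta>\<bar> < \<epsilon>" if \<delta>: "0 < \<delta>" "\<delta> < min (\<Delta> m) (1 / real (Suc m))" for \<delta>
    proof -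
      have "real m \<le> 1 / \<delta>"
      proof -
        have "\<delta> * real m \<le> \<delta> * real (Suc m)" using \<delta> by simp
        also have "\<dots> \<le> 1" using \<delta> by (simp add: pos_less_divide_eq less_imp_le)
        finally show ?thesis using \<delta> by (simp add: pos_le_divide_eq mult.commute)
      qed
      then have "m \<le> nat \<lfloor>1 / \<delta>\<rfloor>" by (simp add: le_nat_floor)
      then have mK: "m \<in> K \<delta>" using \<delta> by (simp add: K_def)
      then have "m \<le> k \<delta>" unfolding k_def using finK by (intro Max_ge)
      then have "1 / real (Suc (k \<delta>)) \<le> 1 / real (Suc m)" by (intro divide_left_mono) auto
      then show ?thesis using mK m by (auto simp: c1_def)
    qed
    then have "\<forall>\<delta>>0. \<delta> < min (\<Delta> m) (1 / real (Suc m)) \<longrightarrow> dist (c1 \<delta>) 0 < \<epsilon>" by (simp add: dist_real_def)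
    moreover have "min (\<Delta> m) (1 / real (Suc m)) > 0" using M(1)[of m] by simp
    ultimately show "eventually (\<lambda>\<delta>. dist (c1 \<delta>) 0 < \<epsilon>) (at_right 0)"
      unfolding eventually_at_right_field by blast
  qed
  show ?thesis
  \<comment> \<open>The error term depending on \<open>N\<close> is taken to be 0: as
    \<open>N0\<close> may depend on \<open>\<delta>\<close>, the whole error is at most
    \<open>c1 \<delta>\<close> beyond it.\<close>
  proof (rule exI[of _ c1], rule exI[of _ "\<lambda>_ _. 0"], rule exI[of _ Cb], rule exI[of _ N0], intro conjI allI impI)
    fix \<delta> N and E :: "'j set \<Rightarrow> ('j \<Rightarrow> 'v) set"
    assume *: "0 < \<delta> \<and> \<delta> < 1 \<and> N \<ge> N0 \<delta> \<and> (\<forall>e\<in>H. E e \<in> cylAlg J (V N) e) \<and>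
       avg (VJ J (V N)) (\<lambda>x. \<Prod>e\<in>H. indicator (E e) x * \<nu> N e (restrict x e)) \<le> \<delta>"
    then have "removable J d H (V N) (\<nu> N) E (c1 \<delta> + 0) (Cb \<delta>)"
      using main[of \<delta> N] unfolding R_def by simp
    then show "\<exists>(E' :: 'j set \<Rightarrow> ('j \<Rightarrow> 'v) set) (B :: 'j set \<Rightarrow> ('j \<Rightarrow> 'v) set set).
          (\<forall>e\<in>H. E' e \<in> cylAlg J (V N) e) \<and>
          VJ J (V N) \<inter> (\<Inter>e\<in>H. E' e) = {} \<and>
          (\<forall>e\<in>H. \<bar>avg (VJ J (V N))
                     (\<lambda>x. indicator (E e - E' e) x * \<nu> N e (restrict x e))\<bar>
                  \<le> c1 \<delta> + 0) \<and>
          (\<forall>e'. e' \<subseteq> J \<and> card e' < d \<longrightarrow>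
             sigma_algebra (VJ J (V N)) (B e') \<and> B e' \<subseteq> cylAlg J (V N) e' \<and>
             real (card (B e')) \<le> Cb \<delta>) \<and>
          (\<forall>e\<in>H. E' e \<in> sigma_sets (VJ J (V N)) (\<Union>e'\<in>{e'. e' \<subset> e}. B e'))"
      unfolding removable_def .
  qed (use lim in auto)
qed

end
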